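(* Let $s\ge1$ and $t\ge0$ be integers and $a\in\mathbb{C}$. For each $n\ge1$ define $f_i=f_i^{(n)}$ ($0\le i\le nt$) by $$\Big(\sum_{m=0}^{t}S_m(x+y)z^{-t-1+m}\Big)^n=\sum_{i=0}^{nt}f_i^{(n)}z^{-n(t+1)+i},$$ and let $$p_n=\sum_{i=0}^{nt}f_i^{(n)}\,(n(t+1)-i)\,x_{n(t+1)-i},\qquad A_{s,t}=\sum_{m=0}^{t}S_m(x+y)S_{s+t-m}(-x-y).$$ Then in $\mathbb{C}[[x,y]]$ $$\exp(a\varphi_{-s}\varphi^*_{-t})\cdot1=\frac{1}{1-aA_{s,t}}\exp\left(-\sum_{n\ge1}\frac{p_n}{n}\left(\frac{-aS_{s-1}(-x-y)}{1-aA_{s,t}}\right)^n\right).$$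
   Context: Let $x=(x_1,x_2,\dots)$, $y=(y_1,y_2,\dots)$ and $p$ be formal variables and let $\mathcal{B}=\mathbb{C}[[x,y;p,p^{-1}]]$ be the (completed) bosonic Fock space. Write $\partial x_n=\partial/\partial x_n$, $\partial y_n=\partial/\partial y_n$, $\partial p=\partial/\partial p$. The operators $\varphi_i,\varphi^*_i$ ($i\in\mathbb{Z}$) on $\mathcal{B}$ are defined by the generating series $\varphi(z)=\sum_{i\in\mathbb{Z}}\varphi_iz^{-i-1}$ and $\varphi^*(z)=\sum_{i\in\mathbb{Z}}\varphi^*_iz^{-i}$, where $$\varphi^{*}(z)=p\exp\Big(\sum_{n>0}(x_n+y_n)z^n\Big)\Big(\sum_{k>0}kx_kz^{k-1}+\sum_{k>0}\partial x_k\,z^{-k-1}+p\,\partial p\,z^{-1}\Big)\exp\Big(-\sum_{n>0}(\partial x_n-\partial y_n)\tfrac{z^{-n}}{n}\Big),$$ $$\varphi(z)=p^{-1}\exp\Big(-\sum_{n>0}(x_n+y_n)z^n\Big)\exp\Big(\sum_{n>0}(\partial x_n-\partial y_n)\tfrac{z^{-n}}{n}\Big).$$ They satisfy $[\varphi_i,\varphi^*_j]=\delta_{i,-j}$, $[\varphi_i,\varphi_j]=[\varphi^*_i,\varphi^*_j]=0$, and $1\in\mathcal{B}$ is a vacuum vector: $\varphi_i\cdot1=\varphi^*_{i+1}\cdot1=0$ for $i\ge0$. For a sequence $t=(t_1,t_2,\dots)$ the elementary Schur polynomials $S_k(t)$ are defined by $\sum_{k\ge0}S_k(t)w^k=\exp(\sum_{n\ge1}t_nw^n)$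 (and $S_k=0$ for $k<0$); $S_k(x+y)$ and $S_k(-x-y)$ are the values at $t_n=x_n+y_n$ and $t_n=-x_n-y_n$. The operator exponential is the usual power series applied to $1$; it converges coefficientwise in $\mathbb{C}[[x,y]]$. Inverses of power series with constant term $1$ are taken in $\mathbb{C}[[x,y]]$. *)

theory Defs
  imports
    "HOL-Analysis.Analysis"
    "HOL-Library.Multiset"
    "HOL-Library.Function_Algebras"
    "HOL-Computational_Algebra.Formal_Laurent_Series"
begin

section \<open>Formal power series in arbitrarily many variables\<close>

text \<open>A monomial in the variables \<open>'v\<close> is a finite multiset of variables, so \<open>'v mps\<close> is the full
  power series ring over the complex numbers, infinite sums of monomials of one degree included.\<close>

typedef 'v mps = "UNIV :: ('v multiset \<Rightarrow> complex) set"
  morphisms mps_coeff Abs_mps ..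

setup_lifting type_definition_mps

lemma mps_eqI: "(\<And>M. mps_coeff f M = mps_coeff g M) \<Longrightarrow> f = g"
  by transfer auto

lemma finite_submsets: "finite {A. A \<subseteq># M}"
proof (induction M)
  case (add x M)
  have "{A. A \<subseteq># add_mset x M} \<subseteq> {A. A \<subseteq># M} \<union> add_mset x ` {A. A \<subseteq># M}"
  proof
    fix A assume A: "A \<in> {A. A \<subseteq># add_mset x M}"
    show "A \<in> {A. A \<subseteq># M} \<union> add_mset x ` {A. A \<subseteq># M}"
    proof (cases "x \<in># A")
      case True
      then obtain B where B: "A = add_mset x B" by (meson mset_add)
      with A show ?thesis by auto
    next
      case False
      have "A \<subseteq># M"
      proof (rule mset_subset_eqI)
        fix v
        have "count A v \<le> count (add_mset x M) v"
          using A by (intro mset_subset_eq_count) simp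
        thus "count A v \<le> count M v"
          using False by (cases "v = x") (auto simp: not_in_iff)
      qed
      thus ?thesis by simp
    qed
  qed
  thus ?case using add by (meson finite_UnI finite_imageI finite_subset)
qed simp

lemma diff_diff_mset: "A \<subseteq># M \<Longrightarrow> M - (M - A) = A"
  by (metis add_diff_cancel_left' subset_mset.diff_add)

instantiation mps :: (type) comm_ring_1
begin

lift_definition zero_mps :: "'a mps" is "\<lambda>_. 0" .
lift_definition one_mps :: "'a mps" is "\<lambda>M. if M = {#} then 1 else 0" .
lift_definition plus_mps :: "'a mps \<Rightarrow> 'a mps \<Rightarrow> 'a mps" is "\<lambda>f g M. f M + g M" .
lift_definition minus_mps :: "'a mps \<Rightarrow> 'a mps \<Rightarrow> 'a mps" is "\<lambda>f g M. f M - g M" .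
lift_definition uminus_mps :: "'a mps \<Rightarrow> 'a mps" is "\<lambda>f M. - f M" .
lift_definition times_mps :: "'a mps \<Rightarrow> 'a mps \<Rightarrow> 'a mps"
  is "\<lambda>f g M. \<Sum>A | A \<subseteq># M. f A * g (M - A)" .

instance
proof
  fix a b c :: "'a mps"
  show "a * b * c = a * (b * c)"
  proof (rule mps_eqI)
    fix M
    have "mps_coeff (a * b * c) M =
        (\<Sum>A | A \<subseteq># M. \<Sum>B | B \<subseteq># A. mps_coeff a B * mps_coeff b (A - B) * mps_coeff c (M - A))"
      by (simp add: times_mps.rep_eq sum_distrib_right)
    also have "\<dots> = (\<Sum>(A, B)\<in>Sigma {A. A \<subseteq># M} (\<lambda>A. {B. B \<subseteq># A}).
        mps_coeff a B * mps_coeff b (A - B) * mps_coeff c (M - A))"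
      by (rule sum.Sigma) (auto simp: finite_submsets)
    also have "\<dots> = (\<Sum>(B, C)\<in>Sigma {B. B \<subseteq># M} (\<lambda>B. {C. C \<subseteq># M - B}).
        mps_coeff a B * (mps_coeff b C * mps_coeff c (M - B - C)))"
    proof (rule sum.reindex_bij_witness[of _ "\<lambda>(B, C). (B + C, B)" "\<lambda>(A, B). (B, A - B)"])
      fix z assume "z \<in> Sigma {A. A \<subseteq># M} (\<lambda>A. {B. B \<subseteq># A})"
      then obtain A B where z: "z = (A, B)" "A \<subseteq># M" "B \<subseteq># A" by auto
      show "(case (case z of (A, B) \<Rightarrow> (B, A - B)) of (B, C) \<Rightarrow> (B + C, B)) = z"
        using z by simp
      show "(case z of (A, B) \<Rightarrow> (B, A - B)) \<in> Sigma {B. B \<subseteq># M} (\<lambda>B. {C. C \<subseteq># M - B})"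
        using z subset_mset.order_trans[OF z(3) z(2)]
        by (auto simp: subset_eq_diff_conv subset_mset.diff_add)
      have "M - B - (A - B) = M - A"
        using z by (metis diff_diff_add_mset subset_mset.add_diff_inverse)
      thus "(case (case z of (A, B) \<Rightarrow> (B, A - B)) of (B, C) \<Rightarrow>
          mps_coeff a B * (mps_coeff b C * mps_coeff c (M - B - C))) =
        (case z of (A, B) \<Rightarrow> mps_coeff a B * mps_coeff b (A - B) * mps_coeff c (M - A))"
        using z by (simp add: mult.assoc)
    next
      fix z assume "z \<in> Sigma {B. B \<subseteq># M} (\<lambda>B. {C. C \<subseteq># M - B})"
      then obtain B C where z: "z = (B, C)" "B \<subseteq># M" "C \<subseteq># M - B" by auto
      have "B + C \<subseteq># M"
        using subset_mset.add_left_mono[OF z(3), of B] subset_mset.add_diff_inverse[OF z(2)] by simp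
      thus "(case z of (B, C) \<Rightarrow> (B + C, B)) \<in> Sigma {A. A \<subseteq># M} (\<lambda>A. {B. B \<subseteq># A})"
        using z by simp
      show "(case (case z of (B, C) \<Rightarrow> (B + C, B)) of (A, B) \<Rightarrow> (B, A - B)) = z"
        using z by simp
    qed
    also have "\<dots> = (\<Sum>B | B \<subseteq># M. \<Sum>C | C \<subseteq># M - B.
        mps_coeff a B * (mps_coeff b C * mps_coeff c (M - B - C)))"
      by (rule sum.Sigma [symmetric]) (auto simp: finite_submsets)
    also have "\<dots> = mps_coeff (a * (b * c)) M"
      by (simp add: times_mps.rep_eq sum_distrib_left)
    finally show "mps_coeff (a * b * c) M = mps_coeff (a * (b * c)) M" .
  qed
  show "a * b = b * a"
  proof (rule mps_eqI)
    fix M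
    show "mps_coeff (a * b) M = mps_coeff (b * a) M"
      unfolding times_mps.rep_eq
      by (rule sum.reindex_bij_witness[of _ "\<lambda>A. M - A" "\<lambda>A. M - A"])
        (auto simp: diff_diff_mset mult.commute)
  qed
  show "1 * a = a"
  proof (rule mps_eqI)
    fix M
    have "mps_coeff (1 * a) M = (\<Sum>A | A \<subseteq># M. if A = {#} then mps_coeff a M else 0)"
      unfolding times_mps.rep_eq one_mps.rep_eq by (rule sum.cong) auto
    thus "mps_coeff (1 * a) M = mps_coeff a M"
      by (simp add: finite_submsets)
  qed
  show "(a + b) * c = a * c + b * c"
    by (rule mps_eqI) (simp add: times_mps.rep_eq plus_mps.rep_eq ring_distribs sum.distrib)
  show "a + b + c = a + (b + c)" "a + b = b + a" "0 + a = a" "- a + a = 0" "a - b = a + - b"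
    by (transfer; simp add: fun_eq_iff)+
  show "(0 :: 'a mps) \<noteq> 1"
    by transfer (metis zero_neq_one)
qed

end

text \<open>Inverses exist exactly when the constant term is nonzero; the value \<open>0\<close> otherwise is a
  convention. Uniqueness is automatic in a commutative ring.\<close>

instantiation mps :: (type) inverse
begin

definition inverse_mps :: "'a mps \<Rightarrow> 'a mps" where
  "inverse_mps f = (if \<exists>g. f * g = 1 then THE g. f * g = 1 else 0)"

definition divide_mps :: "'a mps \<Rightarrow> 'a mps \<Rightarrow> 'a mps" where
  "divide_mps f g = f * inverse g"

instance ..

end

lift_definition mps_const :: "complex \<Rightarrow> 'v mps" is "\<lambda>c M. if M = {#} then c else 0" .

lift_definition mps_var :: "'v \<Rightarrow> 'v mps" is "\<lambda>v M. if M = {#v#} then 1 else 0" .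

lift_definition mps_deriv :: "'v \<Rightarrow> 'v mps \<Rightarrow> 'v mps"
  is "\<lambda>v f M. of_nat (count M v + 1) * f (add_mset v M)" .

text \<open>The topology of coefficientwise convergence. It gives meaning to the library's notions
  of series and infinite sum.\<close>

instantiation mps :: (type) topological_space
begin

definition open_mps :: "'a mps set \<Rightarrow> bool" where
  "open_mps U \<longleftrightarrow> open (Abs_mps -` U)"

instance
proof
  show "open (UNIV :: 'a mps set)"
    by (simp add: open_mps_def)
  show "open (S \<inter> T)" if "open S" "open T" for S T :: "'a mps set"
    using that by (simp add: open_mps_def vimage_Int open_Int)
  show "open (\<Union>K)" if "\<forall>S\<in>K. open S" for K :: "'a mps set set"
    using that by (auto simp: open_mps_def vimage_Union)
qed

end

lemma open_fun_vimage: "open W \<Longrightarrow> open ((\<lambda>h :: 'a \<Rightarrow> 'b :: topological_space. h i) -` W)"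
  by (rule open_vimage) auto

instance "fun" :: (type, t0_space) t0_space
proof
  fix f g :: "'a \<Rightarrow> 'b"
  assume "f \<noteq> g"
  then obtain i where "f i \<noteq> g i" by auto
  then obtain U where "open U" "\<not> (f i \<in> U \<longleftrightarrow> g i \<in> U)"
    using separation_t0[of "f i" "g i"] by auto
  thus "\<exists>U. open U \<and> \<not> (f \<in> U \<longleftrightarrow> g \<in> U)"
    by (intro exI[of _ "(\<lambda>h. h i) -` U"]) (auto intro: open_fun_vimage)
qed

instance "fun" :: (type, t1_space) t1_space
proof
  fix f g :: "'a \<Rightarrow> 'b"
  assume "f \<noteq> g"
  then obtain i where "f i \<noteq> g i" by auto
  then obtain U where "open U" "f i \<in> U" "g i \<notin> U"
    using separation_t1[of "f i" "g i"] by auto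
  thus "\<exists>U. open U \<and> f \<in> U \<and> g \<notin> U"
    by (intro exI[of _ "(\<lambda>h. h i) -` U"]) (auto intro: open_fun_vimage)
qed

instance "fun" :: (type, t2_space) t2_space
proof
  fix f g :: "'a \<Rightarrow> 'b"
  assume "f \<noteq> g"
  then obtain i where "f i \<noteq> g i" by auto
  then obtain U V where "open U" "open V" "f i \<in> U" "g i \<in> V" "U \<inter> V = {}"
    by (meson separation_t2)
  thus "\<exists>U V. open U \<and> open V \<and> f \<in> U \<and> g \<in> V \<and> U \<inter> V = {}"
    by (intro exI[of _ "(\<lambda>h. h i) -` U"] exI[of _ "(\<lambda>h. h i) -` V"]) (auto intro: open_fun_vimage)
qed

instance mps :: (type) t2_space
proof
  fix f g :: "'a mps"
  assume "f \<noteq> g"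
  hence "mps_coeff f \<noteq> mps_coeff g" using mps_eqI[of f g] by auto
  then obtain U V where UV: "open U" "open V" "mps_coeff f \<in> U" "mps_coeff g \<in> V" "U \<inter> V = {}"
    by (meson separation_t2)
  have "Abs_mps -` (mps_coeff -` W) = W" for W :: "('a multiset \<Rightarrow> complex) set"
    by (simp add: vimage_def Abs_mps_inverse)
  with UV show "\<exists>U V. open U \<and> open V \<and> f \<in> U \<and> g \<in> V \<and> U \<inter> V = {}"
    by (intro exI[of _ "mps_coeff -` U"] exI[of _ "mps_coeff -` V"]) (auto simp: open_mps_def)
qed

definition mps_exp :: "'v mps \<Rightarrow> 'v mps" where
  "mps_exp f = (\<Sum>n. mps_const (1 / fact n) * f ^ n)"


section \<open>Elementary Schur polynomials\<close>

text \<open>The coefficient of \<open>w^k\<close> in \<open>exp (\<Sum>n\<ge>1. t n w^n)\<close>. The value \<open>t 0\<close>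
  is ignored.\<close>

definition schur :: "(nat \<Rightarrow> 'v mps) \<Rightarrow> nat \<Rightarrow> 'v mps" where
  "schur t k =
    fps_nth (Abs_fps (\<lambda>n. mps_const (1 / fact n)) oo Abs_fps (\<lambda>n. if n = 0 then 0 else t n)) k"


section \<open>The Fock space and the fields\<close>

text \<open>\<open>Xv k\<close> and \<open>Yv k\<close> stand for \<open>x_(k+1)\<close> and \<open>y_(k+1)\<close>. The functions below that take an
  index \<open>n\<close> use the usual numbering and are meant for \<open>n \<ge> 1\<close>.\<close>

datatype fock_var = Xv nat | Yv nat

definition xv :: "nat \<Rightarrow> fock_var mps" where "xv n = mps_var (Xv (n - 1))"
definition yv :: "nat \<Rightarrow> fock_var mps" where "yv n = mps_var (Yv (n - 1))"

abbreviation S_plus :: "nat \<Rightarrow> fock_var mps" where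
  "S_plus \<equiv> schur (\<lambda>n. xv n + yv n)"

abbreviation S_minus :: "nat \<Rightarrow> fock_var mps" where
  "S_minus \<equiv> schur (\<lambda>n. - xv n - yv n)"

text \<open>\<open>v c\<close> is the coefficient of \<open>p^c\<close> in the element \<open>v\<close> of the Fock space. Note that the
  numeral \<open>1\<close> at this function type is not the vacuum; the vacuum is \<open>charge0 1\<close>.\<close>

type_synonym fock = "int \<Rightarrow> fock_var mps"

definition charge0 :: "fock_var mps \<Rightarrow> fock" where
  "charge0 f = (\<lambda>c. if c = 0 then f else 0)"

definition fmult :: "fock_var mps \<Rightarrow> fock \<Rightarrow> fock"  (infixr \<open>\<bullet>\<^sub>F\<close> 75) where
  "f \<bullet>\<^sub>F v = (\<lambda>c. f * v c)"

definition scale :: "complex \<Rightarrow> fock \<Rightarrow> fock"  (infixr \<open>\<bullet>\<^sub>C\<close> 75) where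
  "a \<bullet>\<^sub>C v = mps_const a \<bullet>\<^sub>F v"

definition dx :: "nat \<Rightarrow> fock \<Rightarrow> fock" where "dx n v = (\<lambda>c. mps_deriv (Xv (n - 1)) (v c))"
definition dy :: "nat \<Rightarrow> fock \<Rightarrow> fock" where "dy n v = (\<lambda>c. mps_deriv (Yv (n - 1)) (v c))"

definition p_power :: "int \<Rightarrow> fock \<Rightarrow> fock" where
  "p_power k v = (\<lambda>c. v (c - k))"

definition p_dp :: "fock \<Rightarrow> fock" where
  "p_dp v = (\<lambda>c. of_int c * v c)"

text \<open>Operator-valued power series in \<open>w = 1/z\<close>: \<open>op_pow D n k\<close> is the coefficient of \<open>w^k\<close> in the
  \<open>n\<close>-th power of \<open>\<Sum>k. D k w^k\<close>, and \<open>op_exp D k\<close> is that of its exponential. The sum over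
  \<open>n \<le> k\<close> is the whole exponential series provided that \<open>D 0 = 0\<close>.\<close>

primrec op_pow :: "(nat \<Rightarrow> fock \<Rightarrow> fock) \<Rightarrow> nat \<Rightarrow> nat \<Rightarrow> fock \<Rightarrow> fock" where
  "op_pow D 0 k v = (if k = 0 then v else 0)"
| "op_pow D (Suc n) k v = (\<Sum>i\<le>k. D i (op_pow D n (k - i) v))"

definition op_exp :: "(nat \<Rightarrow> fock \<Rightarrow> fock) \<Rightarrow> nat \<Rightarrow> fock \<Rightarrow> fock" where
  "op_exp D k v = (\<Sum>n\<le>k. (1 / fact n) \<bullet>\<^sub>C op_pow D n k v)"

definition Dser :: "nat \<Rightarrow> fock \<Rightarrow> fock" where
  "Dser n v = (if n = 0 then 0 else (1 / of_nat n) \<bullet>\<^sub>C (dx n v - dy n v))"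

text \<open>\<open>current j\<close> is the coefficient of \<open>z^j\<close> in the middle factor of the second field.\<close>

definition current :: "int \<Rightarrow> fock \<Rightarrow> fock" where
  "current j v =
    (if j \<ge> 0 then (of_nat (nat j + 1) * xv (nat j + 1)) \<bullet>\<^sub>F v
     else if j = -1 then p_dp v
     else dx (nat (- j - 1)) v)"

text \<open>\<open>phi i\<close> is the coefficient of \<open>z^(-i-1)\<close> in the first field and \<open>phi_star i\<close> that of \<open>z^(-i)\<close>
  in the second: \<open>m\<close> and \<open>j\<close> are exponents of \<open>z\<close>, and \<open>k\<close> is an exponent of \<open>1/z\<close>. The leading
  exponentials contribute \<open>S_minus m\<close> and \<open>S_plus m\<close>, by definition of the Schur polynomials. Only
  finitely many summands contribute to a given coefficient of the result.\<close>

definition phi :: "int \<Rightarrow> fock \<Rightarrow> fock" where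
  "phi i v = p_power (-1)
    (\<Sum>\<^sub>\<infinity>(m, k) \<in> {(m, k). int m - int k = - i - 1}.
      S_minus m \<bullet>\<^sub>F op_exp Dser k v)"

definition phi_star :: "int \<Rightarrow> fock \<Rightarrow> fock" where
  "phi_star i v = p_power 1
    (\<Sum>\<^sub>\<infinity>(m, j, k) \<in> {(m, j, k). int m + j - int k = - i}.
      S_plus m \<bullet>\<^sub>F current j (op_exp (\<lambda>n. - Dser n) k v))"

definition exp_series :: "(fock \<Rightarrow> fock) \<Rightarrow> fock \<Rightarrow> nat \<Rightarrow> fock" where
  "exp_series T v n = (1 / fact n) \<bullet>\<^sub>C (T ^^ n) v"


section \<open>The ingredients of the formula\<close>

definition f_coeff :: "nat \<Rightarrow> nat \<Rightarrow> nat \<Rightarrow> fock_var mps" where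
  "f_coeff t n i =
    fls_nth ((\<Sum>m\<le>t. fls_const (S_plus m) * fls_X_intpow (- int t - 1 + int m)) ^ n)
      (- int (n * (t + 1)) + int i)"

definition p_elem :: "nat \<Rightarrow> nat \<Rightarrow> fock_var mps" where
  "p_elem t n = (\<Sum>i\<le>n * t. f_coeff t n i * of_nat (n * (t + 1) - i) * xv (n * (t + 1) - i))"

definition A_elem :: "nat \<Rightarrow> nat \<Rightarrow> fock_var mps" where
  "A_elem s t = (\<Sum>m\<le>t. S_plus m * S_minus (s + t - m))"

end

(*
  Write u = x + y. The Schur polynomials S_k(u), S_k(-u) are killed by dx_n - dy_n, so on products
  of series in u with exponentials linear in x the exponential factors of both fields act by
  multiplication. Put E(z) = sum_m S_m(u) z^m, let R(z) be the part of z^(-t-1) E(z) with negative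
  exponents, X(z) = sum_k k x_k z^(k-1), A = A_{s,t}, B = S_(s-1)(-u), q = a B / (1 - a A). The
  right-hand side is
    F = (1 - a A)^(-1) exp (Res X(z) log (1 + q R(z))),
  and with Y = Res X R / (1 + q R) one finds, up to powers of p,
    phi*_(-t) F = F Y / (1 - a A),
    phi_(-s) (F Y / (1 - a A)) = F (A + B Y / (1 - a A)) / (1 - a A).
  Scaling x_n and y_n by weight n, this says that the Euler operator sends F to
  (s + t) a phi_(-s) phi*_(-t) F, while phi_(-s) phi*_(-t) raises weights by s + t. Hence the
  component of F of weight n (s + t) is the n-th term of the operator exponential, and the other
  components vanish.
*)
theory Submission
  imports Defs
begin

section \<open>Derivations and composition of formal power series\<close>

unbundle fps_syntax
unbundle no vec_syntax

text \<open>The powers of phi_(-s) phi_star_(-t) on 1 are never computed. The whole series F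
  reproduces itself under both fields up to a factor, so it is taken as a guess and only its Euler
  equation is checked. Its exponent is the prescribed one because p_n = Res X R^n, which makes the
  sum over n a logarithm. As \<open>a\<close> is a number, the weight takes over the part of the
  parameter of the exponential: an outer series variable records it and makes every infinite sum
  finite in each degree.

  The obstacle is the sum over k of z^(-k-1) dx_k inside the second field. These derivatives do not
  kill functions of x + y: they multiply E(z) by z^k, and since R and A are cut off at a fixed
  exponent, truncations of z^k R appear. Summed over k against the coefficients of g = H / (1 + y),
  with H = z^(-t-1) E and y = q R, they reassemble into truncations of products with g. What is left
  collapses by splitting H = g (1 + y) into negative and nonnegative exponents.\<close>

definition derivation :: "('a::comm_ring_1 \<Rightarrow> 'a) \<Rightarrow> bool" where
  "derivation d \<longleftrightarrow> (\<forall>x y. d (x + y) = d x + d y) \<and> (\<forall>x y. d (x * y) = d x * y + x * d y)"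

lemma derivation_add: "derivation d \<Longrightarrow> d (x + y) = d x + d y"
  and derivation_mult: "derivation d \<Longrightarrow> d (x * y) = d x * y + x * d y"
  by (auto simp: derivation_def)

lemma derivation_zero: "derivation d \<Longrightarrow> d 0 = 0"
  using derivation_add[of d 0 0] by simp

lemma derivation_one: "derivation d \<Longrightarrow> d 1 = 0"
  using derivation_mult[of d 1 1] by simp

lemma derivation_minus: "derivation d \<Longrightarrow> d (- x) = - d x"
  using derivation_add[of d x "- x"] by (simp add: derivation_zero eq_neg_iff_add_eq_0 add.commute)

lemma derivation_diff: "derivation d \<Longrightarrow> d (x - y) = d x - d y"
  using derivation_add[of d x "- y"] by (simp add: derivation_minus)

lemma derivation_sum: "derivation d \<Longrightarrow> d (sum f A) = (\<Sum>x\<in>A. d (f x))"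
  by (induction A rule: infinite_finite_induct) (auto simp: derivation_zero derivation_add)

lemma derivation_of_nat: "derivation d \<Longrightarrow> d (of_nat n) = 0"
  by (induction n) (auto simp: derivation_zero derivation_add derivation_one)

lemma derivation_power:
  "derivation d \<Longrightarrow> d (x ^ n) = of_nat n * x ^ (n - 1) * d x"
proof (induction n)
  case (Suc n)
  then show ?case
    by (cases n) (auto simp: derivation_mult algebra_simps)
qed (simp add: derivation_one)

lemmas derivation_simps = derivation_add derivation_mult derivation_zero derivation_one
  derivation_minus derivation_diff derivation_sum derivation_of_nat derivation_power

section \<open>Coefficientwise maps of power series and Laurent series\<close>

definition fps_map :: "('a::zero \<Rightarrow> 'b::zero) \<Rightarrow> 'a fps \<Rightarrow> 'b fps" where
  "fps_map h f = Abs_fps (\<lambda>n. h (f $ n))"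

lemma fps_map_nth [simp]: "fps_map h f $ n = h (f $ n)"
  by (simp add: fps_map_def)

definition fls_map :: "('a::zero \<Rightarrow> 'b::zero) \<Rightarrow> 'a fls \<Rightarrow> 'b fls" where
  "fls_map h f = Abs_fls (\<lambda>k. h (f $$ k))"

lemma fls_map_nth: "h 0 = 0 \<Longrightarrow> fls_map h f $$ n = h (f $$ n)"
proof -
  assume h: "h 0 = 0"
  obtain N where "\<forall>n<N. f $$ n = 0" by (rule fls_nth_vanishes_belowE)
  then show ?thesis
    unfolding fls_map_def using h by (intro nth_Abs_fls_lower_bound[of N]) auto
qed

text \<open>The range of summation may be any that reaches past the lower ends of both supports.
  Products of \<open>f\<close>, \<open>g\<close> and their images under a coefficientwise map, whose
  subdegrees may differ, can then be expanded over one common range.\<close>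

lemma fls_times_nth_range:
  fixes f g :: "'a::comm_ring_1 fls"
  assumes f: "\<And>i. i < lo \<Longrightarrow> f $$ i = 0" and g: "\<And>i. i < n - hi \<Longrightarrow> g $$ i = 0"
  shows "(f * g) $$ n = (\<Sum>i=lo..hi. f $$ i * g $$ (n - i))"
proof -
  have "(f * g) $$ n = (\<Sum>i=fls_subdegree f..n - fls_subdegree g. f $$ i * g $$ (n - i))"
    by (rule fls_times_nth(2))
  also have "\<dots> = (\<Sum>i\<in>{min lo (fls_subdegree f)..max hi (n - fls_subdegree g)}. f $$ i * g $$ (n - i))"
    by (rule sum.mono_neutral_left) auto
  also have "\<dots> = (\<Sum>i=lo..hi. f $$ i * g $$ (n - i))"
    by (rule sum.mono_neutral_right) (auto simp: f g)
  finally show ?thesis .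
qed

lemma fls_map_fps_to_fls: "h 0 = 0 \<Longrightarrow> fls_map h (fps_to_fls f) = fps_to_fls (fps_map h f)"
  by (rule fls_eqI) (simp add: fls_map_nth)

lemma derivation_fps_map:
  assumes "derivation d" shows "derivation (fps_map d)"
  using assms unfolding derivation_def fps_eq_iff
  by (auto simp: fps_mult_nth derivation_simps[OF assms] sum.distrib)

lemma derivation_fls_map:
  assumes "derivation d" shows "derivation (fls_map d)"
proof -
  note nth = fls_map_nth[of d, OF derivation_zero[OF assms]]
  have "fls_map d (f * g) $$ n = (fls_map d f * g + f * fls_map d g) $$ n" for f g n
  proof -
    obtain a b where ab: "\<And>i. i < a \<Longrightarrow> f $$ i = 0" "\<And>i. i < b \<Longrightarrow> g $$ i = 0"
      by (metis fls_nth_vanishes_belowE)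
    have "(f * g) $$ n = (\<Sum>i=a..n-b. f $$ i * g $$ (n - i))"
         "(fls_map d f * g) $$ n = (\<Sum>i=a..n-b. fls_map d f $$ i * g $$ (n - i))"
         "(f * fls_map d g) $$ n = (\<Sum>i=a..n-b. f $$ i * fls_map d g $$ (n - i))"
      by (rule fls_times_nth_range; simp add: ab nth derivation_zero[OF assms])+
    then show ?thesis
      by (simp add: nth derivation_simps[OF assms] sum.distrib)
  qed
  then show ?thesis
    unfolding derivation_def fls_eq_iff by (auto simp: nth derivation_add[OF assms])
qed

section \<open>Local derivations, the chain rule and the geometric series\<close>

lemma derivation_cmult: "derivation d \<Longrightarrow> derivation (\<lambda>x. c * d x)"
  by (simp add: derivation_def algebra_simps)

lemma derivation_diff_fun: "derivation d \<Longrightarrow> derivation e \<Longrightarrow> derivation (\<lambda>x. d x - e x)"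
  by (simp add: derivation_def algebra_simps)

lemma derivation_fps_deriv: "derivation (fps_deriv :: 'a::comm_ring_1 fps \<Rightarrow> _)"
  by (simp add: derivation_def algebra_simps)

text \<open>Once the outer variable records weights, this operator multiplies each component by its
  weight. Unlike \<open>fps_deriv\<close> it does not lower orders.\<close>

definition fps_theta :: "'a::comm_ring_1 fps \<Rightarrow> 'a fps" where
  "fps_theta f = fps_X * fps_deriv f"

lemma derivation_fps_theta: "derivation fps_theta"
  unfolding fps_theta_def by (intro derivation_cmult derivation_fps_deriv)

lemma fps_theta_nth [simp]: "fps_theta f $ n = of_nat n * f $ n"
  by (cases n) (simp_all add: fps_theta_def)

text \<open>For an additive \<open>D\<close> this means that coefficient \<open>n\<close> of the
  image depends only on the coefficients up to \<open>n\<close>. It replaces continuity when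
  \<open>D\<close> is applied to an infinite composition.\<close>

definition fps_local :: "('a::zero fps \<Rightarrow> 'b::zero fps) \<Rightarrow> bool" where
  "fps_local D \<longleftrightarrow> (\<forall>f n. (\<forall>i\<le>n. f $ i = 0) \<longrightarrow> (\<forall>i\<le>n. D f $ i = 0))"

lemma fps_local_theta: "fps_local fps_theta"
  by (simp add: fps_local_def)

lemma fps_local_map: "h 0 = 0 \<Longrightarrow> fps_local (fps_map h)"
  by (simp add: fps_local_def)

lemma fps_mult_cong_upto:
  assumes "\<And>i. i \<le> n \<Longrightarrow> f $ i = f' $ i" "\<And>i. i \<le> n \<Longrightarrow> g $ i = g' $ i"
  shows "(f * g) $ n = (f' * g') $ n"
  using assms by (auto simp: fps_mult_nth intro!: sum.cong)

lemma power_nth_eq_0: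
  fixes y :: "'a::comm_ring_1 fps"
  assumes "y $ 0 = 0" "i < j" shows "(y ^ j) $ i = 0"
  using assms(2)
proof (induction j arbitrary: i)
  case (Suc j)
  have "y $ k * y ^ j $ (i - k) = 0" if "k \<le> i" for k
    using that Suc assms(1) by (cases k) auto
  then show ?case by (simp add: fps_mult_nth)
qed simp

lemma fps_compose_nth_trunc:
  fixes y :: "'a::comm_ring_1 fps"
  assumes "y $ 0 = 0" "i \<le> N"
  shows "(a oo y) $ i = (\<Sum>j\<le>N. fps_const (a $ j) * y ^ j) $ i"
proof -
  have "(a oo y) $ i = (\<Sum>j\<in>{0..i}. a $ j * (y ^ j) $ i)"
    by (rule fps_compose_nth)
  also have "\<dots> = (\<Sum>j\<le>N. a $ j * (y ^ j) $ i)"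
    by (rule sum.mono_neutral_left) (use assms in \<open>auto simp: power_nth_eq_0\<close>)
  finally show ?thesis by (simp add: fps_sum_nth)
qed

text \<open>Up to order \<open>n\<close> the composition agrees with a polynomial in
  \<open>y\<close> whose coefficients are constants of \<open>D\<close>. By locality that polynomial
  can be differentiated instead.\<close>

lemma derivation_fps_compose:
  fixes y :: "'a::comm_ring_1 fps"
  assumes D: "derivation D" "fps_local D" and a: "\<And>i. D (fps_const (a $ i)) = 0" and y: "y $ 0 = 0"
  shows "D (a oo y) = (fps_deriv a oo y) * D y"
proof (rule fps_ext)
  fix n
  \<comment> \<open>One power more than order \<open>n\<close> requires: differentiation lowers the
    exponent, and \<open>y ^ n\<close> must still occur in \<open>D T\<close>.\<close>
  define T where "T = (\<Sum>j\<le>Suc n. fps_const (a $ j) * y ^ j)"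
  have T: "((a oo y) - T) $ i = 0" if "i \<le> n" for i
    using fps_compose_nth_trunc[OF y, of i "Suc n" a] that by (simp add: T_def)
  then have T0: "D ((a oo y) - T) $ n = 0"
    using D(2) unfolding fps_local_def by (metis order_refl)
  then have "D (a oo y) $ n = D T $ n"
    by (simp add: derivation_simps[OF D(1)])
  also have "D T = (\<Sum>j\<le>Suc n. fps_const (a $ j) * (of_nat j * y ^ (j - 1))) * D y"
    by (simp add: T_def derivation_simps[OF D(1)] a sum_distrib_right mult.assoc del: sum.atMost_Suc)
  also have "(\<Sum>j\<le>Suc n. fps_const (a $ j) * (of_nat j * y ^ (j - 1))) =
      (\<Sum>j\<le>n. fps_const (fps_deriv a $ j) * y ^ j)"
  proof -
    have "fps_const (a $ Suc j) * (of_nat (Suc j) * y ^ j) = fps_const (fps_deriv a $ j) * y ^ j" for j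
    proof -
      have "fps_const (fps_deriv a $ j) = of_nat (Suc j) * fps_const (a $ Suc j)"
        by (metis Suc_eq_plus1 fps_const_mult fps_deriv_nth fps_of_nat)
      then show ?thesis by (simp only: ac_simps)
    qed
    then show ?thesis
      by (subst sum.atMost_Suc_shift) (simp del: fps_deriv_nth of_nat_Suc)
  qed
  also have "(\<dots> * D y) $ n = ((fps_deriv a oo y) * D y) $ n"
    by (rule fps_mult_cong_upto) (auto simp: fps_compose_nth_trunc[OF y, of _ n])
  finally show "D (a oo y) $ n = ((fps_deriv a oo y) * D y) $ n" .
qed

text \<open>The truncated sum telescopes, and its error \<open>(- y) ^ Suc n\<close> starts beyond
  order \<open>n\<close>.\<close>

lemma fps_geometric_compose:
  fixes y :: "'a::comm_ring_1 fps"
  assumes y: "y $ 0 = 0"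
  shows "(Abs_fps (\<lambda>n. (-1) ^ n) oo y) * (1 + y) = 1"
proof (rule fps_ext)
  fix n
  have "((Abs_fps (\<lambda>n. (-1) ^ n) oo y) * (1 + y)) $ n = ((\<Sum>j\<le>n. (- y) ^ j) * (1 + y)) $ n"
  proof (rule fps_mult_cong_upto)
    fix i assume "i \<le> n"
    have "fps_const ((-1) ^ j) * y ^ j = (- y) ^ j" for j
    proof -
      have "fps_const (- 1 :: 'a) = - 1"
        using fps_const_neg[of "1 :: 'a"] by simp
      then have "fps_const ((- 1 :: 'a) ^ j) = (- 1) ^ j"
        using fps_const_power[of "- 1 :: 'a" j] by metis
      then show ?thesis by (simp only: power_minus[of y])
    qed
    then show "(Abs_fps (\<lambda>n. (-1) ^ n) oo y) $ i = (\<Sum>j\<le>n. (- y) ^ j) $ i"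
      using fps_compose_nth_trunc[OF y \<open>i \<le> n\<close>] by simp
  qed auto
  also have "(\<Sum>j\<le>n. (- y) ^ j) * (1 + y) = 1 - (- y) ^ Suc n"
    using one_diff_power_eq[of "- y" "Suc n"]
    by (simp add: mult.commute lessThan_Suc_atMost del: power_Suc)
  also have "\<dots> $ n = 1 $ n"
    using y by (simp add: power_nth_eq_0 del: power_Suc)
  finally show "((Abs_fps (\<lambda>n. (-1) ^ n) oo y) * (1 + y)) $ n = 1 $ n" .
qed

lemma fps_theta_eqD:
  fixes f g :: "'a::comm_ring_1 fps"
  assumes tf: "\<And>n (x::'a). n > 0 \<Longrightarrow> of_nat n * x = 0 \<Longrightarrow> x = 0"
    and "fps_theta f = fps_theta g" "f $ 0 = g $ 0"
  shows "f = g"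
proof (rule fps_ext)
  fix n show "f $ n = g $ n"
  proof (cases "n = 0")
    case False
    have "of_nat n * (f $ n - g $ n) = 0"
      using assms(2) by (simp add: fps_eq_iff algebra_simps)
    then have "f $ n - g $ n = 0"
      using tf[of n] False by blast
    then show ?thesis by simp
  qed (use assms in auto)
qed

section \<open>Power series in arbitrarily many variables\<close>

lemmas mps_coeff_simps [simp] = plus_mps.rep_eq minus_mps.rep_eq uminus_mps.rep_eq
  zero_mps.rep_eq one_mps.rep_eq mps_const.rep_eq mps_var.rep_eq

lemma mps_coeff_sum [simp]: "mps_coeff (sum f A) M = (\<Sum>x\<in>A. mps_coeff (f x) M)"
  by (induction A rule: infinite_finite_induct) auto

lemma mps_coeff_const_mult [simp]: "mps_coeff (mps_const c * f) M = c * mps_coeff f M"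
proof -
  have "mps_coeff (mps_const c * f) M = (\<Sum>A | A \<subseteq># M. if A = {#} then c * mps_coeff f M else 0)"
    unfolding times_mps.rep_eq by (rule sum.cong) auto
  then show ?thesis by (simp add: finite_submsets)
qed

lemma mps_const_1 [simp]: "mps_const 1 = 1"
  and mps_const_0 [simp]: "mps_const 0 = 0"
  and mps_const_add: "mps_const (a + b) = mps_const a + mps_const b"
  and mps_const_minus: "mps_const (- a) = - mps_const a"
  and mps_const_mult: "mps_const (a * b) = mps_const a * mps_const b"
  by (rule mps_eqI; simp)+

lemma mps_const_of_nat: "mps_const (of_nat n) = of_nat n"
  by (induction n) (auto simp: mps_const_add)

lemma mps_const_power: "mps_const (a ^ n) = mps_const a ^ n"
  by (induction n) (auto simp: mps_const_mult)

lemma mps_coeff_of_nat_mult [simp]: "mps_coeff (of_nat n * f) M = of_nat n * mps_coeff f M"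
  by (simp flip: mps_const_of_nat)

lemma mps_of_nat_mult_eq_0D: "n > 0 \<Longrightarrow> of_nat n * (f :: 'v mps) = 0 \<Longrightarrow> f = 0"
  by (rule mps_eqI) (metis mps_coeff_of_nat_mult mult_eq_0_iff of_nat_eq_0_iff less_irrefl zero_mps.rep_eq)

lemma mps_of_nat_mult_cancel: "n > 0 \<Longrightarrow> of_nat n * (f :: 'v mps) = of_nat n * g \<Longrightarrow> f = g"
  using mps_of_nat_mult_eq_0D[of n "f - g"] by (simp add: algebra_simps)

text \<open>The multiplicity of \<open>v\<close> in \<open>add_mset v M\<close> is the sum of its
  multiplicities in the two parts of each splitting; these two shares give the two terms of the
  product rule.\<close>

lemma derivation_mps_deriv: "derivation (mps_deriv v)"
proof -
  have add: "mps_deriv v (f + g) = mps_deriv v f + mps_deriv v g" for f g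
    by (rule mps_eqI) (simp add: mps_deriv.rep_eq algebra_simps)
  have "mps_deriv v (f * g) = mps_deriv v f * g + f * mps_deriv v g" for f g
  proof (rule mps_eqI)
    fix M
    let ?N = "add_mset v M" and ?c = "\<lambda>A. complex_of_nat (count A v)"
    let ?h = "\<lambda>A. mps_coeff f A * mps_coeff g (?N - A)"
    have "mps_coeff (mps_deriv v (f * g)) M = (\<Sum>A | A \<subseteq># ?N. ?c ?N * ?h A)"
      by (simp add: mps_deriv.rep_eq times_mps.rep_eq sum_distrib_left)
    also have "\<dots> = (\<Sum>A | A \<subseteq># ?N. ?c A * ?h A + ?c (?N - A) * ?h A)"
    proof (rule sum.cong)
      fix A assume "A \<in> {A. A \<subseteq># ?N}"
      then have "?N = A + (?N - A)" by simp
      then have "count ?N v = count A v + count (?N - A) v" by (metis count_union)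
      then have "?c ?N = ?c A + ?c (?N - A)" by (metis of_nat_add)
      then show "?c ?N * ?h A = ?c A * ?h A + ?c (?N - A) * ?h A" by (simp only: distrib_right)
    qed auto
    also have "\<dots> = (\<Sum>A | A \<subseteq># ?N. ?c A * ?h A) + (\<Sum>A | A \<subseteq># ?N. ?c (?N - A) * ?h A)"
      by (rule sum.distrib)
    also have "(\<Sum>A | A \<subseteq># ?N. ?c A * ?h A) = (\<Sum>A | v \<in># A \<and> A \<subseteq># ?N. ?c A * ?h A)"
      by (rule sum.mono_neutral_right) (auto simp: finite_submsets not_in_iff)
    also have "\<dots> = (\<Sum>A | A \<subseteq># M. ?c (add_mset v A) * ?h (add_mset v A))"
      by (rule sum.reindex_bij_witness[of _ "add_mset v" "\<lambda>A. A - {#v#}"])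
        (auto simp: insert_subset_eq_iff dest!: multi_member_split)
    also have "\<dots> = mps_coeff (mps_deriv v f * g) M"
      unfolding times_mps.rep_eq by (rule sum.cong) (auto simp: mps_deriv.rep_eq)
    also have "(\<Sum>A | A \<subseteq># ?N. ?c (?N - A) * ?h A) = (\<Sum>A | A \<subseteq># M. ?c (?N - A) * ?h A)"
    proof (rule sum.mono_neutral_right)
      show "\<forall>A\<in>{A. A \<subseteq># ?N} - {A. A \<subseteq># M}. ?c (?N - A) * ?h A = 0"
      proof
        fix A assume "A \<in> {A. A \<subseteq># ?N} - {A. A \<subseteq># M}"
        then have A: "A \<subseteq># ?N" "\<not> A \<subseteq># M" by auto
        \<comment> \<open>A part of \<open>add_mset v M\<close> that does not fit into
          \<open>M\<close> contains all copies of \<open>v\<close>.\<close>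
        have "v \<notin># ?N - A"
        proof
          assume "v \<in># ?N - A"
          then obtain B where "?N - A = add_mset v B" by (meson mset_add)
          with A(1) have "?N = A + add_mset v B" by (metis subset_mset.add_diff_inverse)
          then have "M = A + B" by simp
          with A(2) show False by simp
        qed
        then show "?c (?N - A) * ?h A = 0" by (simp add: not_in_iff)
      qed
    qed (auto simp: finite_submsets intro: subset_mset.order_trans)
    also have "\<dots> = mps_coeff (f * mps_deriv v g) M"
      unfolding times_mps.rep_eq
    proof (rule sum.cong)
      fix A assume "A \<in> {A. A \<subseteq># M}"
      then have "?N - A = add_mset v (M - A)" using mset_subset_eq_count[of A M]
        by (auto intro!: multiset_eqI simp: Suc_diff_le)
      then show "?c (?N - A) * ?h A = mps_coeff f A * mps_coeff (mps_deriv v g) (M - A)"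
        by (simp add: mps_deriv.rep_eq)
    qed auto
    finally show "mps_coeff (mps_deriv v (f * g)) M =
        mps_coeff (mps_deriv v f * g + f * mps_deriv v g) M" by simp
  qed
  with add show ?thesis by (simp add: derivation_def)
qed

lemma mps_deriv_const [simp]: "mps_deriv v (mps_const c) = 0"
  by (rule mps_eqI) (simp add: mps_deriv.rep_eq)

lemma mps_deriv_var: "mps_deriv v (mps_var w) = (if v = w then 1 else 0)"
  by (rule mps_eqI) (auto simp: mps_deriv.rep_eq)

section \<open>Powers, inverses and coefficientwise convergence\<close>

lemma mps_coeff_power_eq_0:
  assumes "mps_coeff h {#} = 0" "size M < n"
  shows "mps_coeff (h ^ n) M = 0"
  using assms(2)
proof (induction n arbitrary: M)
  case (Suc n)
  have "mps_coeff h A * mps_coeff (h ^ n) (M - A) = 0" if "A \<subseteq># M" for A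
  proof (cases "A = {#}")
    case False
    then have "size A > 0" by (simp add: nonempty_has_size)
    moreover have "size A \<le> size M" using that by (rule size_mset_mono)
    moreover have "size (M - A) = size M - size A" using that by (rule size_Diff_submset)
    ultimately have "size (M - A) < n" using Suc.prems by simp
    then show ?thesis using Suc.IH by simp
  qed (simp add: assms(1))
  then show ?case by (auto simp: times_mps.rep_eq intro!: sum.neutral)
qed simp

lemma mps_coeff_mult_0 [simp]: "mps_coeff (f * g) {#} = mps_coeff f {#} * mps_coeff g {#}"
  by (simp add: times_mps.rep_eq)

text \<open>Geometric series in \<open>1 - f\<close>: this has no constant term, so a monomial of
  size \<open>d\<close> sees only the powers up to \<open>d\<close>.\<close>

lemma mps_inverse:
  fixes f :: "'v mps"
  assumes "mps_coeff f {#} = 1"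
  shows "f * inverse f = 1"
proof -
  define g where "g = Abs_mps (\<lambda>M. \<Sum>n\<le>size M. mps_coeff ((1 - f) ^ n) M)"
  have g: "mps_coeff g M = mps_coeff (\<Sum>n<N. (1 - f) ^ n) M" if "size M < N" for M :: "'v multiset" and N
  proof -
    have "mps_coeff g M = (\<Sum>n\<le>size M. mps_coeff ((1 - f) ^ n) M)"
      by (simp add: g_def Abs_mps_inverse)
    also have "\<dots> = (\<Sum>n<N. mps_coeff ((1 - f) ^ n) M)"
      by (rule sum.mono_neutral_left)
        (use that assms in \<open>auto simp: mps_coeff_power_eq_0\<close>)
    finally show ?thesis by simp
  qed
  have "f * g = 1"
  proof (rule mps_eqI)
    fix M :: "'v multiset"
    let ?N = "Suc (size M)"
    have "mps_coeff (f * g) M = mps_coeff (f * (\<Sum>n<?N. (1 - f) ^ n)) M"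
      unfolding times_mps.rep_eq
      by (rule sum.cong) (auto simp: g[of _ ?N] size_Diff_submset simp del: sum.lessThan_Suc mps_coeff_sum)
    also have "f * (\<Sum>n<?N. (1 - f) ^ n) = 1 - (1 - f) ^ ?N"
      using one_diff_power_eq[of "1 - f" ?N] by simp
    also have "mps_coeff \<dots> M = mps_coeff 1 M"
      using mps_coeff_power_eq_0[of "1 - f" M ?N] assms by (simp del: power_Suc)
    finally show "mps_coeff (f * g) M = mps_coeff 1 M" .
  qed
  moreover have "h = g" if "f * h = 1" for h
    by (metis calculation mult.commute mult.left_commute mult_1 that)
  ultimately have "(THE g. f * g = 1) = g" by blast
  with \<open>f * g = 1\<close> show ?thesis by (auto simp: inverse_mps_def)
qed

lemma mps_inverse_eqI: "f * g = 1 \<Longrightarrow> inverse f = (g :: 'v mps)"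
  unfolding inverse_mps_def
  by (auto intro!: the_equality) (metis mult.commute mult.left_commute mult_1)

lemma mps_inverse_of_nat: "n > 0 \<Longrightarrow> inverse (of_nat n :: 'v mps) = mps_const (1 / of_nat n)"
  by (rule mps_inverse_eqI) (simp flip: mps_const_of_nat mps_const_mult)

lemma tendsto_funI:
  fixes f :: "'a \<Rightarrow> 'b \<Rightarrow> 'c::topological_space"
  assumes "\<And>i. ((\<lambda>x. f x i) \<longlongrightarrow> l i) F"
  shows "(f \<longlongrightarrow> l) F"
proof -
  have "limitin (product_topology (\<lambda>_. euclidean) UNIV) f l F"
    unfolding limitin_componentwise using assms by (auto simp: limitin_canonical_iff)
  then show ?thesis
    by (simp add: euclidean_product_topology limitin_canonical_iff)
qed

lemma mps_tendstoI:
  fixes f :: "'a \<Rightarrow> 'v mps"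
  assumes "\<And>M. ((\<lambda>x. mps_coeff (f x) M) \<longlongrightarrow> mps_coeff l M) F"
  shows "(f \<longlongrightarrow> l) F"
proof (rule topological_tendstoI)
  fix S :: "'v mps set" assume S: "open S" "l \<in> S"
  have "((\<lambda>x. mps_coeff (f x)) \<longlongrightarrow> mps_coeff l) F"
    by (intro tendsto_funI assms)
  moreover have "open (Abs_mps -` S)" "mps_coeff l \<in> Abs_mps -` S"
    using S by (auto simp: open_mps_def mps_coeff_inverse)
  ultimately have "eventually (\<lambda>x. mps_coeff (f x) \<in> Abs_mps -` S) F"
    by (rule topological_tendstoD)
  then show "eventually (\<lambda>x. f x \<in> S) F"
    by (simp add: mps_coeff_inverse)
qed

lemma mps_sumsI:
  fixes f :: "nat \<Rightarrow> 'v mps"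
  assumes "\<And>M. eventually (\<lambda>N. (\<Sum>n<N. mps_coeff (f n) M) = mps_coeff l M) sequentially"
  shows "f sums l"
  unfolding sums_def
  by (rule mps_tendstoI) (use assms in \<open>auto intro: tendsto_eventually\<close>)

text \<open>Each coefficient is eventually constant along the finite subsets of \<open>A\<close>;
  the finite set \<open>B M\<close> from which on it is constant may vary with the monomial.\<close>

lemma mps_infsum_coeff:
  fixes f :: "'a \<Rightarrow> 'v mps"
  assumes B: "\<And>M. finite (B M)" "\<And>M. B M \<subseteq> A" "\<And>M x. x \<in> A - B M \<Longrightarrow> mps_coeff (f x) M = 0"
  shows "mps_coeff (infsum f A) M = (\<Sum>x\<in>B M. mps_coeff (f x) M)"
proof -
  define l where "l = Abs_mps (\<lambda>M. \<Sum>x\<in>B M. mps_coeff (f x) M)"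
  have "(f has_sum l) A"
    unfolding has_sum_def
  proof (rule mps_tendstoI)
    fix M
    have "eventually (\<lambda>X. mps_coeff (sum f X) M = mps_coeff l M) (finite_subsets_at_top A)"
      unfolding eventually_finite_subsets_at_top
    proof (intro exI[of _ "B M"] conjI allI impI)
      fix X assume X: "finite X \<and> B M \<subseteq> X \<and> X \<subseteq> A"
      have "mps_coeff (sum f X) M = (\<Sum>x\<in>B M. mps_coeff (f x) M)"
        unfolding mps_coeff_sum by (rule sum.mono_neutral_right) (use X B in auto)
      then show "mps_coeff (sum f X) M = mps_coeff l M"
        by (simp add: l_def Abs_mps_inverse)
    qed (use B in auto)
    then show "((\<lambda>X. mps_coeff (sum f X) M) \<longlongrightarrow> mps_coeff l M) (finite_subsets_at_top A)"
      by (rule tendsto_eventually)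
  qed
  then have "infsum f A = l" by (rule infsumI)
  then show ?thesis by (simp add: l_def Abs_mps_inverse)
qed

lemma mps_exp_coeff:
  assumes f: "mps_coeff f {#} = 0" and N: "size M \<le> N"
  shows "mps_coeff (mps_exp f) M = (\<Sum>n\<le>N. mps_coeff (f ^ n) M / fact n)"
proof -
  define l where "l = Abs_mps (\<lambda>M. \<Sum>n\<le>size M. mps_coeff (f ^ n) M / fact n)"
  have l: "mps_coeff l M = (\<Sum>n\<in>I. mps_coeff (f ^ n) M / fact n)" if "{..size M} \<subseteq> I" "finite I" for M I
  proof -
    have "mps_coeff l M = (\<Sum>n\<le>size M. mps_coeff (f ^ n) M / fact n)"
      by (simp add: l_def Abs_mps_inverse)
    also have "\<dots> = (\<Sum>n\<in>I. mps_coeff (f ^ n) M / fact n)"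
      by (rule sum.mono_neutral_left) (use that f in \<open>auto simp: mps_coeff_power_eq_0\<close>)
    finally show ?thesis .
  qed
  have "(\<lambda>n. mps_const (1 / fact n) * f ^ n) sums l"
  proof (rule mps_sumsI)
    fix M
    show "\<forall>\<^sub>F N in sequentially. (\<Sum>n<N. mps_coeff (mps_const (1 / fact n) * f ^ n) M) = mps_coeff l M"
      using eventually_gt_at_top[of "size M"]
      by eventually_elim (simp, subst l[where I = "{..<_}"], auto)
  qed
  then have "mps_exp f = l" unfolding mps_exp_def by (simp add: sums_iff)
  with l[of M "{..N}"] N show ?thesis by simp
qed

section \<open>The weight grading\<close>

text \<open>\<open>Xv k\<close> and \<open>Yv k\<close> are x_(k+1) and y_(k+1), hence the
  shift.\<close>

fun var_weight :: "fock_var \<Rightarrow> nat" where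
  "var_weight (Xv k) = Suc k"
| "var_weight (Yv k) = Suc k"

lemma var_weight_pos [simp]: "var_weight v > 0"
  by (cases v) auto

definition weight :: "fock_var multiset \<Rightarrow> nat" where
  "weight M = (\<Sum>v\<in>#M. var_weight v)"

lemma weight_simps [simp]: "weight {#} = 0" "weight (add_mset v M) = var_weight v + weight M"
  "weight (A + B) = weight A + weight B"
  by (auto simp: weight_def)

lemma weight_diff: "A \<subseteq># M \<Longrightarrow> weight M = weight A + weight (M - A)"
  by (metis subset_mset.add_diff_inverse weight_simps(3))

lemma size_le_weight: "size M \<le> weight M"
proof (induction M)
  case (add v M)
  have "1 \<le> var_weight v" using var_weight_pos[of v] by linarith
  with add show ?case by simp
qed simp

definition homogeneous :: "nat \<Rightarrow> fock_var mps \<Rightarrow> bool" where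
  "homogeneous n f \<longleftrightarrow> (\<forall>M. mps_coeff f M \<noteq> 0 \<longrightarrow> weight M = n)"

lemma homogeneousI: "(\<And>M. weight M \<noteq> n \<Longrightarrow> mps_coeff f M = 0) \<Longrightarrow> homogeneous n f"
  by (auto simp: homogeneous_def)

lemma homogeneousD: "homogeneous n f \<Longrightarrow> weight M \<noteq> n \<Longrightarrow> mps_coeff f M = 0"
  by (auto simp: homogeneous_def)

lemma homogeneous_0 [simp]: "homogeneous n 0"
  and homogeneous_const [simp]: "homogeneous 0 (mps_const c)"
  and homogeneous_1 [simp]: "homogeneous 0 1"
  and homogeneous_add: "homogeneous n f \<Longrightarrow> homogeneous n g \<Longrightarrow> homogeneous n (f + g)"
  and homogeneous_diff: "homogeneous n f \<Longrightarrow> homogeneous n g \<Longrightarrow> homogeneous n (f - g)"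
  and homogeneous_minus: "homogeneous n f \<Longrightarrow> homogeneous n (- f)"
  and homogeneous_of_nat_mult: "homogeneous n f \<Longrightarrow> homogeneous n (of_nat k * f)"
  by (auto intro!: homogeneousI simp: homogeneousD)

lemma homogeneous_sum: "(\<And>x. x \<in> A \<Longrightarrow> homogeneous n (f x)) \<Longrightarrow> homogeneous n (sum f A)"
  by (induction A rule: infinite_finite_induct) (auto intro: homogeneous_add)

lemma homogeneous_mult:
  assumes "homogeneous m f" "homogeneous n g" "m + n = k"
  shows "homogeneous k (f * g)"
  unfolding homogeneous_def
proof (intro allI impI)
  fix M assume "mps_coeff (f * g) M \<noteq> 0"
  then obtain A where "A \<subseteq># M" "mps_coeff f A * mps_coeff g (M - A) \<noteq> 0"
    unfolding times_mps.rep_eq by (metis (mono_tags, lifting) mem_Collect_eq sum.neutral)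
  with assms show "weight M = k" by (auto simp: homogeneous_def weight_diff)
qed

lemma homogeneous_var: "var_weight v = n \<Longrightarrow> homogeneous n (mps_var v)"
  by (auto simp: homogeneous_def split: if_splits)

lemma homogeneous_of_nat_multD: "k > 0 \<Longrightarrow> homogeneous n (of_nat k * f) \<Longrightarrow> homogeneous n f"
  by (auto simp: homogeneous_def)

lemma mps_deriv_homogeneous_eq_0:
  assumes "homogeneous n f" "n < var_weight v"
  shows "mps_deriv v f = 0"
  by (rule mps_eqI) (use assms in \<open>auto simp: mps_deriv.rep_eq intro!: homogeneousD[OF assms(1)]\<close>)

text \<open>Scaling each variable of weight \<open>n\<close> by the \<open>n\<close>-th power of a
  new variable is a ring homomorphism; this is the image of \<open>f\<close>, expanded in the new
  variable.\<close>

definition grading :: "fock_var mps \<Rightarrow> fock_var mps fps" where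
  "grading f = Abs_fps (\<lambda>n. Abs_mps (\<lambda>M. if weight M = n then mps_coeff f M else 0))"

lemma mps_coeff_grading: "mps_coeff (grading f $ n) M = (if weight M = n then mps_coeff f M else 0)"
  by (simp add: grading_def Abs_mps_inverse)

lemma homogeneous_grading: "homogeneous n (grading f $ n)"
  by (auto simp: homogeneous_def mps_coeff_grading)

lemma grading_homogeneous: "homogeneous n f \<Longrightarrow> grading f = fps_const f * fps_X ^ n"
  by (rule fps_ext, rule mps_eqI)
    (auto simp: mps_coeff_grading fps_X_power_mult_right_nth homogeneous_def)

lemma grading_diff: "grading (f - g) = grading f - grading g"
  by (rule fps_ext, rule mps_eqI, simp add: mps_coeff_grading)+

lemma grading_const: "grading (mps_const c) = fps_const (mps_const c)"
  using grading_homogeneous[of 0 "mps_const c"] by simp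

lemma grading_1: "grading 1 = 1"
  using grading_homogeneous[of 0 1] by simp

lemma grading_mult: "grading (f * g) = grading f * grading g"
proof (rule fps_ext, rule mps_eqI)
  fix n M
  have "mps_coeff ((grading f * grading g) $ n) M =
      (\<Sum>i=0..n. \<Sum>A | A \<subseteq># M. mps_coeff (grading f $ i) A * mps_coeff (grading g $ (n - i)) (M - A))"
    by (simp add: fps_mult_nth times_mps.rep_eq)
  also have "\<dots> = (\<Sum>A | A \<subseteq># M. \<Sum>i=0..n. mps_coeff (grading f $ i) A * mps_coeff (grading g $ (n - i)) (M - A))"
    by (rule sum.swap)
  also have "\<dots> = (\<Sum>A | A \<subseteq># M. if weight M = n then mps_coeff f A * mps_coeff g (M - A) else 0)"
  proof (rule sum.cong)
    fix A assume "A \<in> {A. A \<subseteq># M}"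
    then have w: "weight M = weight A + weight (M - A)" by (simp add: weight_diff)
    have "(\<Sum>i=0..n. mps_coeff (grading f $ i) A * mps_coeff (grading g $ (n - i)) (M - A)) =
        (\<Sum>i=0..n. if i = weight A then (if weight M = n then mps_coeff f A * mps_coeff g (M - A) else 0) else 0)"
      by (rule sum.cong) (auto simp: mps_coeff_grading w)
    also have "\<dots> = (if weight M = n then mps_coeff f A * mps_coeff g (M - A) else 0)"
      using w by auto
    finally show "(\<Sum>i=0..n. mps_coeff (grading f $ i) A * mps_coeff (grading g $ (n - i)) (M - A)) =
      (if weight M = n then mps_coeff f A * mps_coeff g (M - A) else 0)" .
  qed auto
  also have "\<dots> = mps_coeff (grading (f * g) $ n) M"
    by (simp add: mps_coeff_grading times_mps.rep_eq)
  finally show "mps_coeff (grading (f * g) $ n) M = mps_coeff ((grading f * grading g) $ n) M" ..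
qed

lemma grading_power: "grading (f ^ n) = grading f ^ n"
  by (induction n) (auto simp: grading_1 grading_mult)

text \<open>On a monomial of weight \<open>n\<close> both sides are the exponential sum cut off at
  \<open>n\<close>, because the size of a monomial is at most its weight.\<close>

lemma grading_exp:
  assumes "mps_coeff f {#} = 0"
  shows "grading (mps_exp f) = Abs_fps (\<lambda>n. mps_const (1 / fact n)) oo grading f"
proof (rule fps_ext, rule mps_eqI)
  fix n M
  show "mps_coeff (grading (mps_exp f) $ n) M =
    mps_coeff ((Abs_fps (\<lambda>n. mps_const (1 / fact n)) oo grading f) $ n) M"
    using mps_exp_coeff[OF assms, of M n] size_le_weight[of M]
    by (auto simp: fps_compose_nth mps_coeff_grading atLeast0AtMost simp flip: grading_power)
qed

lemma derivation_exp_compose: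
  fixes y :: "'v mps fps"
  assumes D: "derivation D" "fps_local D" "\<And>c. D (fps_const (mps_const c)) = 0" and y: "y $ 0 = 0"
  defines "E \<equiv> Abs_fps (\<lambda>n. mps_const (1 / fact n))"
  shows "D (E oo y) = (E oo y) * D y"
proof -
  have "fps_deriv E = E"
  proof (rule fps_ext)
    fix n
    have "of_nat (Suc n) / fact (Suc n) = (1 / fact n :: complex)"
      by (simp del: of_nat_Suc)
    then show "fps_deriv E $ n = E $ n"
      by (simp add: E_def del: of_nat_Suc fact_Suc flip: mps_const_of_nat mps_const_mult)
  qed
  then show ?thesis
    using derivation_fps_compose[OF D(1,2) _ y, of E] D(3) by (simp add: E_def)
qed

section \<open>Laurent series in two variables\<close>

text \<open>The inner Laurent variable is \<open>z\<close>; the outer variable records weights. Every series below has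
  coefficients of fixed weight that are Laurent series in \<open>z\<close> bounded below, so that products
  such as \<open>E(z) / (1 + q R(z))\<close>, which are unbounded in both directions as series in \<open>z\<close>, stay
  inside a commutative ring.\<close>

definition emb :: "'a::comm_ring_1 fps \<Rightarrow> 'a fls fps" where
  "emb = fps_map fls_const"

definition zcoeff :: "int \<Rightarrow> 'a::comm_ring_1 fls fps \<Rightarrow> 'a fps" where
  "zcoeff k = fps_map (\<lambda>g. g $$ k)"

definition zpos :: "'a::comm_ring_1 fls fps \<Rightarrow> 'a fls fps" where
  "zpos = fps_map (\<lambda>g. fps_to_fls (fls_regpart g))"

definition zneg :: "'a::comm_ring_1 fls fps \<Rightarrow> 'a fls fps" where
  "zneg g = g - zpos g"

definition zpow :: "int \<Rightarrow> 'a::comm_ring_1 fls fps" where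
  "zpow k = fps_const (fls_X_intpow k)"

definition lift2 :: "('a::comm_ring_1 \<Rightarrow> 'a) \<Rightarrow> 'a fls fps \<Rightarrow> 'a fls fps" where
  "lift2 d = fps_map (fls_map d)"

lemma zcoeff_nth [simp]: "zcoeff k g $ n = g $ n $$ k"
  by (simp add: zcoeff_def)

lemma emb_nth [simp]: "emb f $ n = fls_const (f $ n)"
  by (simp add: emb_def)

lemma two_var_eqI: "(\<And>k. zcoeff k f = zcoeff k g) \<Longrightarrow> f = g"
  by (auto simp: fps_eq_iff intro!: fls_eqI)

lemma zcoeff_add [simp]: "zcoeff k (f + g) = zcoeff k f + zcoeff k g"
  and zcoeff_diff [simp]: "zcoeff k (f - g) = zcoeff k f - zcoeff k g"
  and zcoeff_minus [simp]: "zcoeff k (- f) = - zcoeff k f"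
  and zcoeff_0 [simp]: "zcoeff k 0 = 0"
  and zcoeff_1 [simp]: "zcoeff k 1 = (if k = 0 then 1 else 0)"
  by (rule fps_ext; simp)+

lemma zcoeff_sum [simp]: "zcoeff k (sum f A) = (\<Sum>x\<in>A. zcoeff k (f x))"
  by (induction A rule: infinite_finite_induct) auto

lemma zcoeff_emb_mult [simp]: "zcoeff k (emb f * g) = f * zcoeff k g"
  by (rule fps_ext) (simp add: fps_mult_nth fls_nth_sum)

lemma zcoeff_const [simp]: "zcoeff k (fps_const h) = fps_const (h $$ k)"
  by (rule fps_ext) simp

lemma zcoeff_zpow_mult [simp]: "zcoeff k (zpow j * g) = zcoeff (k - j) g"
  by (rule fps_ext) (simp add: zpow_def fls_X_intpow_times_conv_shift)

lemma zcoeff_zpow: "zcoeff k (zpow j) = (if k = j then 1 else 0)"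
  by (rule fps_ext) (simp add: zpow_def)

lemma zpow_0 [simp]: "zpow 0 = 1"
  by (simp add: zpow_def)

lemma emb_0 [simp]: "emb 0 = 0"
  and emb_1 [simp]: "emb 1 = 1"
  by (rule fps_ext; rule fls_eqI; simp)+

lemma emb_mult: "emb (f * g) = emb f * emb g"
  by (rule two_var_eqI, rule fps_ext) (simp add: fps_mult_nth fls_nth_sum)

lemma emb_power: "emb (f ^ n) = emb f ^ n"
  by (induction n) (auto simp: emb_mult)

lemma zcoeff_emb: "zcoeff k (emb f) = (if k = 0 then f else 0)"
  using zcoeff_emb_mult[of k f 1] by simp

lemma zcoeff_zpos: "zcoeff k (zpos g) = (if k < 0 then 0 else zcoeff k g)"
  by (rule fps_ext) (simp add: zpos_def)

lemma zcoeff_zneg: "zcoeff k (zneg g) = (if k < 0 then zcoeff k g else 0)"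
  by (simp add: zneg_def zcoeff_zpos)

lemma zpos_add: "zpos (f + g) = zpos f + zpos g"
  and zneg_add: "zneg (f + g) = zneg f + zneg g"
  and zpos_emb_mult: "zpos (emb h * g) = emb h * zpos g"
  and zneg_emb_mult: "zneg (emb h * g) = emb h * zneg g"
  by (rule two_var_eqI; simp add: zcoeff_zpos zcoeff_zneg)+

lemma derivation_lift2: "derivation d \<Longrightarrow> derivation (lift2 d)"
  unfolding lift2_def by (intro derivation_fps_map derivation_fls_map)

lemma fps_local_lift2: "derivation d \<Longrightarrow> fps_local (lift2 d)"
  unfolding lift2_def by (intro fps_local_map) (simp add: derivation_fls_map derivation_zero)

lemma zcoeff_lift2: "derivation d \<Longrightarrow> zcoeff k (lift2 d g) = fps_map d (zcoeff k g)"
  by (rule fps_ext) (simp add: lift2_def fls_map_nth derivation_zero)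

lemma lift2_emb: "derivation d \<Longrightarrow> lift2 d (emb f) = emb (fps_map d f)"
  by (rule two_var_eqI, rule fps_ext) (simp add: zcoeff_lift2 zcoeff_emb derivation_zero)

lemma lift2_const: "derivation d \<Longrightarrow> lift2 d (fps_const h) = fps_const (fls_map d h)"
  by (rule two_var_eqI, rule fps_ext) (simp add: zcoeff_lift2 fls_map_nth derivation_zero)

lemma lift2_zpow: "derivation d \<Longrightarrow> lift2 d (zpow k) = 0"
  by (rule two_var_eqI, rule fps_ext)
    (simp add: zcoeff_lift2 zcoeff_zpow derivation_zero derivation_one)

lemma lift2_zneg: "derivation d \<Longrightarrow> lift2 d (zneg g) = zneg (lift2 d g)"
  by (rule two_var_eqI) (simp add: zcoeff_zneg zcoeff_lift2, rule impI, rule fps_ext, simp add: derivation_zero)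

lemma fps_theta_emb: "fps_theta (emb f) = emb (fps_theta f)"
proof (rule two_var_eqI, rule fps_ext)
  fix k n
  have "of_nat n * (c :: 'a fls) $$ k = (of_nat n * c) $$ k" for c
    by (simp add: fls_of_nat)
  then show "zcoeff k (fps_theta (emb f)) $ n = zcoeff k (emb (fps_theta f)) $ n"
    by (simp add: zcoeff_emb fls_of_nat)
qed

lemma zcoeff_theta: "zcoeff k (fps_theta g) = fps_theta (zcoeff k g)"
  by (rule fps_ext) (simp add: fls_of_nat)

lemma fps_theta_const [simp]: "fps_theta (fps_const c) = 0"
  by (rule fps_ext) simp

text \<open>The operator -z d/dz. The sign gives z^(-k) the eigenvalue \<open>k\<close>, which suits
  recurrences in powers of 1/z.\<close>

definition fls_euler :: "'a::comm_ring_1 fls \<Rightarrow> 'a fls" where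
  "fls_euler g = - (fls_X * fls_deriv g)"

definition zeuler :: "'a::comm_ring_1 fls fps \<Rightarrow> 'a fls fps" where
  "zeuler = fps_map fls_euler"

lemma fls_euler_nth: "fls_euler g $$ k = of_int (- k) * g $$ k"
  by (simp add: fls_euler_def fls_X_times_conv_shift)

lemma derivation_fls_euler: "derivation fls_euler"
  by (simp add: derivation_def fls_euler_def algebra_simps)

lemma derivation_zeuler: "derivation zeuler"
  unfolding zeuler_def by (intro derivation_fps_map derivation_fls_euler)

lemma fps_local_zeuler: "fps_local zeuler"
  unfolding zeuler_def by (intro fps_local_map) (simp add: fls_euler_def)

lemma zcoeff_zeuler: "zcoeff k (zeuler g) = of_int (- k) * zcoeff k g"
  by (rule fps_ext) (simp add: zeuler_def fls_euler_nth flip: fps_of_int)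

lemma zeuler_emb [simp]: "zeuler (emb f) = 0"
  by (rule two_var_eqI) (simp add: zcoeff_zeuler zcoeff_emb)

text \<open>The bound holds for all outer exponents at once, whereas the Laurent coefficients by
  themselves are bounded below only one by one.\<close>

definition zge :: "int \<Rightarrow> 'a::comm_ring_1 fls fps \<Rightarrow> bool" where
  "zge a g \<longleftrightarrow> (\<forall>k<a. zcoeff k g = 0)"

definition zle :: "int \<Rightarrow> 'a::comm_ring_1 fls fps \<Rightarrow> bool" where
  "zle a g \<longleftrightarrow> (\<forall>k>a. zcoeff k g = 0)"

lemma zgeD: "zge a g \<Longrightarrow> k < a \<Longrightarrow> zcoeff k g = 0"
  and zleD: "zle a g \<Longrightarrow> k > a \<Longrightarrow> zcoeff k g = 0"
  by (auto simp: zge_def zle_def)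

lemma zge_mono: "zge a g \<Longrightarrow> b \<le> a \<Longrightarrow> zge b g"
  and zle_mono: "zle a g \<Longrightarrow> a \<le> b \<Longrightarrow> zle b g"
  by (auto simp: zge_def zle_def)

lemma fls_mult_nth_ge:
  fixes f g :: "'a::comm_ring_1 fls"
  assumes "\<And>i. i < a \<Longrightarrow> f $$ i = 0" "\<And>i. i < b \<Longrightarrow> g $$ i = 0" "k < a + b"
  shows "(f * g) $$ k = 0"
  using fls_times_nth_range[where lo = a and f = f and g = g and n = k and hi = "k - b"] assms by simp

lemma fls_mult_nth_le:
  fixes f g :: "'a::comm_ring_1 fls"
  assumes "\<And>i. i > a \<Longrightarrow> f $$ i = 0" "\<And>i. i > b \<Longrightarrow> g $$ i = 0" "k > a + b"
  shows "(f * g) $$ k = 0"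
proof -
  have "f $$ i * g $$ (k - i) = 0" for i
    using assms(1)[of i] assms(2)[of "k - i"] assms(3) by (cases "i > a") auto
  then show ?thesis by (simp add: fls_times_nth(2))
qed

lemma zge_mult: "zge a f \<Longrightarrow> zge b g \<Longrightarrow> c \<le> a + b \<Longrightarrow> zge c (f * g)"
  unfolding zge_def fps_eq_iff
  by (auto simp: fps_mult_nth fls_nth_sum intro!: sum.neutral fls_mult_nth_ge[of a _ b])

lemma zle_mult: "zle a f \<Longrightarrow> zle b g \<Longrightarrow> a + b \<le> c \<Longrightarrow> zle c (f * g)"
  unfolding zle_def fps_eq_iff
  by (auto simp: fps_mult_nth fls_nth_sum intro!: sum.neutral fls_mult_nth_le[of a _ b])

lemma
  fixes f g :: "'a::comm_ring_1 fls fps"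
  shows zle_emb_mult: "zle a g \<Longrightarrow> zle a (emb h * g)"
  and zle_add: "zle a f \<Longrightarrow> zle a g \<Longrightarrow> zle a (f + g)"
  and zge_zpos: "zge 0 (zpos g)"
  and zle_zneg: "zle (-1) (zneg g)"
  and zge_1: "zge 0 (1 :: 'a fls fps)"
  and zle_1: "zle 0 (1 :: 'a fls fps)"
  by (auto simp: zge_def zle_def zcoeff_zpos zcoeff_zneg)

lemma zpos_eq: "zge 0 g \<Longrightarrow> zpos g = g"
  and zpos_eq_0: "zle (-1) g \<Longrightarrow> zpos g = 0"
  and zneg_eq: "zle (-1) g \<Longrightarrow> zneg g = g"
  and zneg_eq_0: "zge 0 g \<Longrightarrow> zneg g = 0"
  by (rule two_var_eqI; auto simp: zcoeff_zpos zcoeff_zneg zge_def zle_def not_less)+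

lemma zneg_zpos_cases: "g = zneg g + zpos g"
  by (simp add: zneg_def)

text \<open>An additive functional that is linear over series in the outer variable need not be
  continuous in \<open>z\<close>, hence the hypothesis that it only sees finitely many powers of \<open>z\<close>.\<close>

lemma functional_expansion:
  assumes add: "\<And>f g. \<Phi> (f + g) = \<Phi> f + \<Phi> g" and scale: "\<And>h g. \<Phi> (emb h * g) = h * \<Phi> g"
    and supp: "\<And>g. (\<And>k. 0 \<le> k \<Longrightarrow> k \<le> int V \<Longrightarrow> zcoeff k g = 0) \<Longrightarrow> \<Phi> g = 0"
  shows "\<Phi> g = (\<Sum>k\<le>V. zcoeff (int k) g * \<Phi> (zpow (int k)))"
proof -
  define T where "T = (\<Sum>k\<le>V. emb (zcoeff (int k) g) * zpow (int k))"
  have "\<Phi> (g - T) = 0"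
  proof (rule supp)
    fix j :: int assume j: "0 \<le> j" "j \<le> int V"
    have "zcoeff j T = (\<Sum>k\<le>V. if k = nat j then zcoeff j g else 0)"
      unfolding T_def zcoeff_sum by (rule sum.cong) (use j in \<open>auto simp: zcoeff_zpow\<close>)
    also have "\<dots> = zcoeff j g" using j by auto
    finally show "zcoeff j (g - T) = 0" by simp
  qed
  then have "\<Phi> g = \<Phi> T" using add[of "g - T" T] by simp
  moreover have "\<Phi> (sum h A) = (\<Sum>k\<in>A. \<Phi> (h k))" if "finite A" for h :: "nat \<Rightarrow> _" and A
    using that
  proof (induction A)
    case empty then show ?case using add[of 0 0] by simp
  qed (simp add: add)
  ultimately show ?thesis by (simp add: T_def scale)
qed

text \<open>Only z^k and z^(-k) with \<open>k > 0\<close> meet in the coefficient of z^0. Up to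
  outer exponent \<open>n\<close> just finitely many Laurent series are involved, and a common lower
  bound of their exponents gives \<open>V0\<close>; such a bound depends on
  \<open>n\<close>.\<close>

lemma zcoeff_mult_zle_nth:
  assumes h: "zle (-1) h"
  shows "\<exists>V0. \<forall>V\<ge>V0. \<forall>m\<le>n. (\<Sum>k=1..V. zcoeff (int k) g * zcoeff (- int k) h) $ m = zcoeff 0 (g * h) $ m"
proof -
  have "\<exists>N::nat. \<forall>j\<le>n. \<forall>i < - int N. h $ j $$ i = 0"
  proof (induction n)
    case 0
    obtain N where "\<forall>i<N. h $ 0 $$ i = 0" by (rule fls_nth_vanishes_belowE)
    then show ?case by (intro exI[of _ "nat (-N)"]) auto
  next
    case (Suc n)
    then obtain M where M: "\<forall>j\<le>n. \<forall>i < - int M. h $ j $$ i = 0" by blast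
    obtain N where N: "\<forall>i<N. h $ Suc n $$ i = 0" by (rule fls_nth_vanishes_belowE)
    then show ?case
      using M by (intro exI[of _ "max M (nat (-N))"]) (auto simp: le_Suc_eq)
  qed
  then obtain V0 :: nat where V0: "\<And>j i. j \<le> n \<Longrightarrow> i < - int V0 \<Longrightarrow> h $ j $$ i = 0" by blast
  have h0: "h $ j $$ i = 0" if "i \<ge> 0" for i j
    using zleD[OF h, of i] that by (metis zcoeff_nth fps_zero_nth zero_le less_le_trans neg_less_0_iff_less zero_less_one)
  have main: "(g $ i * h $ j) $$ 0 = (\<Sum>k=1..V. g $ i $$ int k * h $ j $$ (- int k))" if "j \<le> n" "V0 \<le> V" for i j V
  proof -
    obtain L where L: "\<And>k. k < L \<Longrightarrow> g $ i $$ k = 0" by (meson fls_nth_vanishes_belowE)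
    have "(h $ j * g $ i) $$ 0 = (\<Sum>k=-int V..-L. h $ j $$ k * g $ i $$ (0 - k))"
      by (rule fls_times_nth_range) (use V0 that L in auto)
    also have "\<dots> = (\<Sum>k\<in>{-int V..max (-1) (-L)}. h $ j $$ k * g $ i $$ (0 - k))"
      by (rule sum.mono_neutral_left) (auto simp: L)
    also have "\<dots> = (\<Sum>k\<in>{-int V..-1}. h $ j $$ k * g $ i $$ (0 - k))"
      by (rule sum.mono_neutral_right) (auto simp: h0)
    also have "\<dots> = (\<Sum>k=1..V. g $ i $$ int k * h $ j $$ (- int k))"
      by (rule sum.reindex_bij_witness[of _ "\<lambda>k. - int k" "\<lambda>k. nat (- k)"]) auto
    finally show ?thesis by (simp add: mult.commute)
  qed
  show ?thesis
  proof (intro exI[of _ V0] allI impI)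
    fix V m assume V: "V0 \<le> V" and m: "m \<le> n"
    have "(\<Sum>k=1..V. zcoeff (int k) g * zcoeff (- int k) h) $ m =
        (\<Sum>k=1..V. \<Sum>i=0..m. g $ i $$ int k * h $ (m - i) $$ (- int k))"
      by (simp add: fps_sum_nth fps_mult_nth)
    also have "\<dots> = (\<Sum>i=0..m. \<Sum>k=1..V. g $ i $$ int k * h $ (m - i) $$ (- int k))"
      by (rule sum.swap)
    also have "\<dots> = zcoeff 0 (g * h) $ m"
      using V m by (simp add: fps_mult_nth fls_nth_sum main)
    finally show "(\<Sum>k=1..V. zcoeff (int k) g * zcoeff (- int k) h) $ m = zcoeff 0 (g * h) $ m" .
  qed
qed

lemma fps_map_X_power_mult: "h 0 = 0 \<Longrightarrow> fps_map h (f * fps_X ^ n) = fps_map h f * fps_X ^ n"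
  by (rule fps_ext) (simp add: fps_X_power_mult_right_nth)

lemma fls_mult_nth_nonpos:
  fixes f g :: "'a::comm_ring_1 fls"
  assumes "\<And>i. i > - 1 \<Longrightarrow> f $$ i = 0" "\<And>i. i > 0 \<Longrightarrow> g $$ i = 0"
  shows "(f * g) $$ (- int k) = (\<Sum>i=1..k. f $$ (- int i) * g $$ (- int (k - i)))"
proof -
  obtain a b where ab: "\<And>i. i < a \<Longrightarrow> f $$ i = 0" "\<And>i. i < b \<Longrightarrow> g $$ i = 0"
    by (metis fls_nth_vanishes_belowE)
  have "(f * g) $$ (- int k) = (\<Sum>i=a..- int k - b. f $$ i * g $$ (- int k - i))"
    by (rule fls_times_nth_range) (auto simp: ab)
  also have "\<dots> = (\<Sum>i\<in>{min a (- int k)..max (- int k - b) (- 1)}. f $$ i * g $$ (- int k - i))"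
    by (rule sum.mono_neutral_left) (auto simp: ab)
  also have "\<dots> = (\<Sum>i\<in>{- int k..-1}. f $$ i * g $$ (- int k - i))"
    by (rule sum.mono_neutral_right) (auto simp: assms)
  also have "\<dots> = (\<Sum>i=1..k. f $$ (- int i) * g $$ (- int (k - i)))"
    by (rule sum.reindex_bij_witness[of _ "\<lambda>i. - int i" "\<lambda>i. nat (- i)"]) (auto simp: of_nat_diff)
  finally show ?thesis .
qed

text \<open>A Cauchy product in 1/z, starting at \<open>i = 1\<close> because \<open>f\<close> has
  no term z^0. It turns equations for \<open>zeuler\<close> into the recurrence that characterizes
  \<open>gen_exp\<close>.\<close>

lemma zcoeff_mult_nonpos:
  assumes "zle (-1) f" "zle 0 g"
  shows "zcoeff (- int k) (f * g) = (\<Sum>i=1..k. zcoeff (- int i) f * zcoeff (- int (k - i)) g)"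
proof (rule fps_ext)
  fix n
  have f: "f $ j $$ i = 0" if "i > -1" for i j
    using zleD[OF assms(1) that] by (metis zcoeff_nth fps_zero_nth)
  have g: "g $ j $$ i = 0" if "i > 0" for i j
    using zleD[OF assms(2) that] by (metis zcoeff_nth fps_zero_nth)
  have "zcoeff (- int k) (f * g) $ n = (\<Sum>j=0..n. \<Sum>i=1..k. f $ j $$ (- int i) * g $ (n - j) $$ (- int (k - i)))"
    by (simp add: fps_mult_nth fls_nth_sum fls_mult_nth_nonpos f g)
  also have "\<dots> = (\<Sum>i=1..k. \<Sum>j=0..n. f $ j $$ (- int i) * g $ (n - j) $$ (- int (k - i)))"
    by (rule sum.swap)
  finally show "zcoeff (- int k) (f * g) $ n =
      (\<Sum>i=1..k. zcoeff (- int i) f * zcoeff (- int (k - i)) g) $ n"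
    by (simp add: fps_sum_nth fps_mult_nth)
qed

lemma fls_mult_nth_window:
  fixes f g :: "'a::comm_ring_1 fls"
  assumes f: "\<And>i. i < 0 \<Longrightarrow> f $$ i = 0"
    and g: "\<And>i. i > 0 \<Longrightarrow> g $$ i = 0" "\<And>i. i < - int V \<Longrightarrow> g $$ i = 0"
  shows "(f * g) $$ m = (\<Sum>k\<le>V. f $$ (m + int k) * g $$ (- int k))"
proof -
  have "(g * f) $$ m = (\<Sum>i=- int V..max 0 m. g $$ i * f $$ (m - i))"
    by (rule fls_times_nth_range) (auto simp: f g)
  also have "\<dots> = (\<Sum>i=- int V..0. g $$ i * f $$ (m - i))"
    by (rule sum.mono_neutral_right) (auto simp: g)
  also have "\<dots> = (\<Sum>k\<le>V. f $$ (m + int k) * g $$ (- int k))"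
    by (rule sum.reindex_bij_witness[of _ "\<lambda>i. - int i" "\<lambda>i. nat (- i)"]) (auto simp: mult.commute)
  finally show ?thesis by (simp add: mult.commute)
qed

section \<open>Elementary Schur polynomials\<close>

lemma schur_series: "Abs_fps (schur t) =
    Abs_fps (\<lambda>n. mps_const (1 / fact n)) oo Abs_fps (\<lambda>n. if n = 0 then 0 else t n)"
  by (rule fps_ext) (simp add: schur_def)

lemma schur_0 [simp]: "schur t 0 = 1"
  by (simp add: schur_def)

lemma derivation_schur_series:
  assumes "derivation D" "fps_local D" "\<And>c. D (fps_const (mps_const c)) = 0"
  shows "D (Abs_fps (schur t)) = Abs_fps (schur t) * D (Abs_fps (\<lambda>n. if n = 0 then 0 else t n))"
  unfolding schur_series by (rule derivation_exp_compose) (use assms in auto)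

text \<open>Coefficient \<open>k\<close> of w E' = E (w T') for E = exp T. The value
  \<open>t 0\<close> enters only with the factor 0.\<close>

lemma schur_recurrence:
  "of_nat k * schur t k = (\<Sum>i=0..k. schur t i * (of_nat (k - i) * t (k - i)))"
proof -
  have "fps_theta (Abs_fps (schur t)) $ k =
      (Abs_fps (schur t) * fps_theta (Abs_fps (\<lambda>n. if n = 0 then 0 else t n))) $ k"
    by (subst derivation_schur_series[OF derivation_fps_theta fps_local_theta]) auto
  also have "\<dots> = (\<Sum>i=0..k. schur t i * (of_nat (k - i) * t (k - i)))"
    by (auto simp: fps_mult_nth intro!: sum.cong)
  finally show ?thesis by simp
qed

text \<open>The Euler derivation kills the product of exp T and exp (-T), so it equals its constant
  term.\<close>

lemma schur_minus_mult: "Abs_fps (schur t) * Abs_fps (schur (\<lambda>n. - t n)) = 1"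
proof (rule fps_theta_eqD[OF mps_of_nat_mult_eq_0D])
  have "Abs_fps (\<lambda>n. if n = 0 then 0 else - t n) = - Abs_fps (\<lambda>n. if n = 0 then 0 else t n)"
    by (rule fps_ext) simp
  then show "fps_theta (Abs_fps (schur t) * Abs_fps (schur (\<lambda>n. - t n))) = fps_theta 1"
    using derivation_schur_series[OF derivation_fps_theta fps_local_theta, of t]
      derivation_schur_series[OF derivation_fps_theta fps_local_theta, of "\<lambda>n. - t n"]
    by (simp add: derivation_simps[OF derivation_fps_theta])
qed auto

text \<open>The recurrence expresses \<open>k\<close> times the polynomial by earlier ones, and the
  factor \<open>k > 0\<close> does not change the support.\<close>

lemma homogeneous_schur:
  assumes "\<And>n. n > 0 \<Longrightarrow> homogeneous n (t n)"
  shows "homogeneous k (schur t k)"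
proof (induction k rule: less_induct)
  case (less k)
  show ?case
  proof (cases "k = 0")
    case False
    have "homogeneous k (schur t i * (of_nat (k - i) * t (k - i)))" if "i \<le> k" for i
    proof (cases "i = k")
      case False
      with that show ?thesis
        by (intro homogeneous_mult[OF less homogeneous_of_nat_mult[OF assms]]) auto
    qed simp
    then have "homogeneous k (\<Sum>i=0..k. schur t i * (of_nat (k - i) * t (k - i)))"
      by (intro homogeneous_sum) (simp only: atLeastAtMost_iff)
    then have "homogeneous k (of_nat k * schur t k)"
      by (subst schur_recurrence)
    with False show ?thesis using homogeneous_of_nat_multD[of k] by blast
  qed simp
qed

lemma homogeneous_xv: "n > 0 \<Longrightarrow> homogeneous n (xv n)"
  and homogeneous_yv: "n > 0 \<Longrightarrow> homogeneous n (yv n)"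
  by (auto simp: xv_def yv_def intro!: homogeneous_var)

lemma homogeneous_S_plus: "homogeneous k (S_plus k)"
  and homogeneous_S_minus: "homogeneous k (S_minus k)"
  by (rule homogeneous_schur;
      simp add: homogeneous_add homogeneous_diff homogeneous_minus homogeneous_xv homogeneous_yv)+

text \<open>\<open>deriv_xy k\<close> is the derivative by \<open>x_k\<close> in the coordinates \<open>(x, x + y)\<close>.\<close>

definition deriv_x :: "nat \<Rightarrow> fock_var mps \<Rightarrow> fock_var mps" where
  "deriv_x k = mps_deriv (Xv (k - 1))"

definition deriv_xy :: "nat \<Rightarrow> fock_var mps \<Rightarrow> fock_var mps" where
  "deriv_xy k f = mps_deriv (Xv (k - 1)) f - mps_deriv (Yv (k - 1)) f"

lemma derivation_deriv_x: "derivation (deriv_x k)"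
  unfolding deriv_x_def by (rule derivation_mps_deriv)

lemma derivation_deriv_xy: "derivation (deriv_xy k)"
  using derivation_diff_fun[OF derivation_mps_deriv derivation_mps_deriv]
  unfolding deriv_xy_def[abs_def] .

lemma deriv_x_const [simp]: "deriv_x k (mps_const c) = 0"
  and deriv_xy_const [simp]: "deriv_xy k (mps_const c) = 0"
  by (auto simp: deriv_x_def deriv_xy_def)

lemma deriv_x_xv: "k > 0 \<Longrightarrow> n > 0 \<Longrightarrow> deriv_x k (xv n) = (if n = k then 1 else 0)"
  and deriv_x_yv: "deriv_x k (yv n) = 0"
  and deriv_xy_xv: "k > 0 \<Longrightarrow> n > 0 \<Longrightarrow> deriv_xy k (xv n) = (if n = k then 1 else 0)"
  and deriv_xy_yv: "k > 0 \<Longrightarrow> n > 0 \<Longrightarrow> deriv_xy k (yv n) = (if n = k then - 1 else 0)"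
  by (auto simp: deriv_x_def deriv_xy_def xv_def yv_def mps_deriv_var)

lemma fps_map_derivation_schur:
  assumes "derivation d" "\<And>c. d (mps_const c) = 0"
  shows "fps_map d (Abs_fps (schur t)) =
    Abs_fps (schur t) * Abs_fps (\<lambda>n. if n = 0 then 0 else d (t n))"
proof -
  have "fps_map d (Abs_fps (\<lambda>n. if n = 0 then 0 else t n)) = Abs_fps (\<lambda>n. if n = 0 then 0 else d (t n))"
    by (rule fps_ext) (simp add: derivation_zero[OF assms(1)])
  moreover have "fps_map d (fps_const (mps_const c)) = 0" for c
    by (rule fps_ext) (simp add: assms(2) derivation_zero[OF assms(1)])
  ultimately show ?thesis
    using derivation_schur_series[OF derivation_fps_map[OF assms(1)] fps_local_map[of d]]
      derivation_zero[OF assms(1)] by simp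
qed

lemma deriv_x_S_plus:
  assumes "k > 0" shows "fps_map (deriv_x k) (Abs_fps S_plus) = Abs_fps S_plus * fps_X ^ k"
proof -
  have "Abs_fps (\<lambda>n. if n = 0 then 0 else deriv_x k (xv n + yv n)) = fps_X ^ k"
    using assms by (intro fps_ext) (auto simp: fps_X_power_iff derivation_simps[OF derivation_deriv_x] deriv_x_xv deriv_x_yv)
  then show ?thesis by (simp add: fps_map_derivation_schur derivation_deriv_x)
qed

lemma deriv_x_S_minus:
  assumes "k > 0" shows "fps_map (deriv_x k) (Abs_fps S_minus) = - (Abs_fps S_minus * fps_X ^ k)"
proof -
  have "Abs_fps (\<lambda>n. if n = 0 then 0 else deriv_x k (- xv n - yv n)) = - (fps_X ^ k)"
    using assms by (intro fps_ext) (auto simp: fps_X_power_iff derivation_simps[OF derivation_deriv_x] deriv_x_xv deriv_x_yv)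
  then show ?thesis by (simp add: fps_map_derivation_schur derivation_deriv_x)
qed

lemma deriv_xy_S_plus: "k > 0 \<Longrightarrow> deriv_xy k (S_plus m) = 0"
  and deriv_xy_S_minus: "k > 0 \<Longrightarrow> deriv_xy k (S_minus m) = 0"
proof -
  have *: "deriv_xy k (schur t m) = 0"
    if "\<And>n. n > 0 \<Longrightarrow> deriv_xy k (t n) = 0" for t
  proof -
    have "Abs_fps (\<lambda>n. if n = 0 then 0 else deriv_xy k (t n)) = 0"
      using that by (intro fps_ext) auto
    then have "fps_map (deriv_xy k) (Abs_fps (schur t)) $ m = 0"
      by (simp add: fps_map_derivation_schur derivation_deriv_xy)
    then show ?thesis by simp
  qed
  show "deriv_xy k (S_plus m) = 0" "deriv_xy k (S_minus m) = 0" if "k > 0"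
    by (rule *; use that in \<open>simp add: derivation_simps[OF derivation_deriv_xy] deriv_xy_xv deriv_xy_yv\<close>)+
qed

lemma S_plus_S_minus: "Abs_fps S_plus * Abs_fps S_minus = 1"
proof -
  have "(\<lambda>n. - xv n - yv n) = (\<lambda>n. - (xv n + yv n))" by auto
  then show ?thesis using schur_minus_mult[of "\<lambda>n. xv n + yv n"] by simp
qed

section \<open>Exponentials of shift operators and the fields on a single charge\<close>

lemma sum_fun_apply: "(\<Sum>i\<in>A. f i) x = (\<Sum>i\<in>A. f i x)"
  by (induction A rule: infinite_finite_induct) auto

lemma mps_deriv_commute: "mps_deriv v (mps_deriv w f) = mps_deriv w (mps_deriv v f)"
  by (rule mps_eqI) (auto simp: mps_deriv.rep_eq add_mset_commute)

lemma deriv_xy_commute: "deriv_xy i (deriv_xy j f) = deriv_xy j (deriv_xy i f)"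
  by (simp add: deriv_xy_def derivation_diff[OF derivation_mps_deriv] mps_deriv_commute algebra_simps)

text \<open>The coefficient of z^(-i) in the exponent of the right-hand exponential of a field, on a
  single charge: \<open>\<epsilon> = 1\<close> belongs to \<open>phi\<close> and
  \<open>\<epsilon> = - 1\<close> to \<open>phi_star\<close>.\<close>

definition shift_gen :: "complex \<Rightarrow> nat \<Rightarrow> fock_var mps \<Rightarrow> fock_var mps" where
  "shift_gen \<epsilon> i f = (if i = 0 then 0 else mps_const (\<epsilon> / of_nat i) * deriv_xy i f)"

lemma shift_gen_sum: "shift_gen \<epsilon> i (sum f A) = (\<Sum>x\<in>A. shift_gen \<epsilon> i (f x))"
  by (simp add: shift_gen_def derivation_sum[OF derivation_deriv_xy] sum_distrib_left)

lemma deriv_xy_const_mult: "deriv_xy i (mps_const c * f) = mps_const c * deriv_xy i f"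
  by (simp add: derivation_mult[OF derivation_deriv_xy])

lemma shift_gen_const_mult: "shift_gen \<epsilon> i (mps_const c * f) = mps_const c * shift_gen \<epsilon> i f"
  by (simp add: shift_gen_def deriv_xy_const_mult mult.left_commute)

lemma shift_gen_of_nat_mult: "shift_gen \<epsilon> i (of_nat n * f) = of_nat n * shift_gen \<epsilon> i f"
  by (simp add: shift_gen_const_mult flip: mps_const_of_nat)

lemma shift_gen_commute: "shift_gen \<epsilon> i (shift_gen \<epsilon> j f) = shift_gen \<epsilon> j (shift_gen \<epsilon> i f)"
proof (cases "i = 0 \<or> j = 0")
  case True
  then show ?thesis by (auto simp: shift_gen_def derivation_zero[OF derivation_deriv_xy])
next
  case False
  then show ?thesis
    by (simp add: shift_gen_def deriv_xy_const_mult mult.left_commute deriv_xy_commute[of i j])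
qed

lemma shift_gen_0 [simp]: "shift_gen \<epsilon> 0 f = 0" "shift_gen \<epsilon> i 0 = 0"
  by (auto simp: shift_gen_def derivation_zero[OF derivation_deriv_xy])

lemma of_nat_mult_shift_gen: "i > 0 \<Longrightarrow> of_nat i * shift_gen \<epsilon> i f = mps_const \<epsilon> * deriv_xy i f"
  by (simp add: shift_gen_def flip: mps_const_of_nat mps_const_mult mult.assoc)

primrec gen_pow :: "complex \<Rightarrow> nat \<Rightarrow> nat \<Rightarrow> fock_var mps \<Rightarrow> fock_var mps" where
  "gen_pow \<epsilon> 0 k f = (if k = 0 then f else 0)"
| "gen_pow \<epsilon> (Suc n) k f = (\<Sum>i\<le>k. shift_gen \<epsilon> i (gen_pow \<epsilon> n (k - i) f))"

definition gen_exp :: "complex \<Rightarrow> nat \<Rightarrow> fock_var mps \<Rightarrow> fock_var mps" where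
  "gen_exp \<epsilon> k f = (\<Sum>n\<le>k. mps_const (1 / fact n) * gen_pow \<epsilon> n k f)"

lemma gen_pow_eq_0: "k < n \<Longrightarrow> gen_pow \<epsilon> n k f = 0"
proof (induction n arbitrary: k)
  case (Suc n)
  have "shift_gen \<epsilon> i (gen_pow \<epsilon> n (k - i) f) = 0" if "i \<le> k" for i
    using Suc that by (cases "i = 0") auto
  then show ?case by simp
qed simp

lemma sum_triangle_swap:
  fixes f :: "nat \<Rightarrow> nat \<Rightarrow> 'a::comm_monoid_add"
  shows "(\<Sum>i\<le>k. \<Sum>j\<le>k - i. f i j) = (\<Sum>j\<le>k. \<Sum>i\<le>k - j. f i j)"
proof -
  have "(\<Sum>i\<le>k. \<Sum>j\<le>k - i. f i j) = (\<Sum>(i, j)\<in>(SIGMA i:{..k}. {..k - i}). f i j)"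
    by (rule sum.Sigma) auto
  also have "\<dots> = (\<Sum>(j, i)\<in>(SIGMA j:{..k}. {..k - j}). f i j)"
    by (rule sum.reindex_bij_witness[of _ "\<lambda>(j, i). (i, j)" "\<lambda>(i, j). (j, i)"]) auto
  also have "\<dots> = (\<Sum>j\<le>k. \<Sum>i\<le>k - j. f i j)"
    by (rule sum.Sigma[symmetric]) auto
  finally show ?thesis .
qed

text \<open>The power rule w d/dw D^(n+1) = (n+1) (w D') D^n in coefficients, with w = 1/z. It holds
  because the operators \<open>shift_gen\<close> commute.\<close>

lemma gen_pow_deriv:
  "of_nat k * gen_pow \<epsilon> (Suc n) k f =
    of_nat (Suc n) * (\<Sum>i\<le>k. of_nat i * shift_gen \<epsilon> i (gen_pow \<epsilon> n (k - i) f))"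
proof (induction n arbitrary: k)
  case 0
  have "(\<Sum>i\<le>k. of_nat k * shift_gen \<epsilon> i (gen_pow \<epsilon> 0 (k - i) f)) =
      (\<Sum>i\<le>k. of_nat i * shift_gen \<epsilon> i (gen_pow \<epsilon> 0 (k - i) f))"
    by (rule sum.cong) auto
  then show ?case by (simp add: sum_distrib_left)
next
  case (Suc n)
  let ?P = "\<lambda>n k. gen_pow \<epsilon> n k f" and ?d = "shift_gen \<epsilon>"
  have "of_nat k * ?P (Suc (Suc n)) k = (\<Sum>i\<le>k. of_nat k * ?d i (?P (Suc n) (k - i)))"
    by (simp only: gen_pow.simps(2)[of \<epsilon> "Suc n"] sum_distrib_left)
  also have "\<dots> = (\<Sum>i\<le>k. of_nat i * ?d i (?P (Suc n) (k - i)) + ?d i (of_nat (k - i) * ?P (Suc n) (k - i)))"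
  proof (rule sum.cong)
    fix i assume "i \<in> {..k}"
    then have "of_nat k = (of_nat i + of_nat (k - i) :: fock_var mps)"
      by (simp flip: of_nat_add)
    then show "of_nat k * ?d i (?P (Suc n) (k - i)) =
        of_nat i * ?d i (?P (Suc n) (k - i)) + ?d i (of_nat (k - i) * ?P (Suc n) (k - i))"
      by (simp only: shift_gen_of_nat_mult distrib_right)
  qed simp
  also have "\<dots> = (\<Sum>i\<le>k. of_nat i * ?d i (?P (Suc n) (k - i))) +
      (\<Sum>i\<le>k. ?d i (of_nat (k - i) * ?P (Suc n) (k - i)))"
    by (rule sum.distrib)
  also have "(\<Sum>i\<le>k. ?d i (of_nat (k - i) * ?P (Suc n) (k - i))) =
      of_nat (Suc n) * (\<Sum>i\<le>k. \<Sum>j\<le>k - i. of_nat j * ?d j (?d i (?P n (k - i - j))))"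
    unfolding Suc.IH
    by (simp only: shift_gen_of_nat_mult shift_gen_sum sum_distrib_left shift_gen_commute[of \<epsilon> _ _])
  also have "(\<Sum>i\<le>k. \<Sum>j\<le>k - i. of_nat j * ?d j (?d i (?P n (k - i - j)))) =
      (\<Sum>j\<le>k. \<Sum>i\<le>k - j. of_nat j * ?d j (?d i (?P n (k - i - j))))"
    by (rule sum_triangle_swap)
  also have "\<dots> = (\<Sum>j\<le>k. of_nat j * ?d j (?P (Suc n) (k - j)))"
    by (simp add: shift_gen_sum sum_distrib_left add.commute)
  finally show ?case by (simp only: of_nat_Suc[of "Suc n"] distrib_right mult_1_left)
qed

lemma gen_exp_0: "gen_exp \<epsilon> 0 f = f"
  by (simp add: gen_exp_def)

text \<open>This is w d/dw exp D = (w D') exp D in coefficients; the factor \<open>i\<close> from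
  differentiation cancels the denominator in \<open>shift_gen\<close>.\<close>

lemma gen_exp_recurrence:
  "of_nat k * gen_exp \<epsilon> k f = (\<Sum>i=1..k. mps_const \<epsilon> * deriv_xy i (gen_exp \<epsilon> (k - i) f))"
proof (cases k)
  case (Suc m)
  let ?P = "\<lambda>n k. gen_pow \<epsilon> n k f"
  have "of_nat k * gen_exp \<epsilon> k f = (\<Sum>n\<le>Suc m. mps_const (1 / fact n) * (of_nat k * ?P n k))"
    unfolding gen_exp_def Suc by (simp only: sum_distrib_left mult.left_commute)
  \<comment> \<open>The term \<open>n = 0\<close> vanishes as \<open>k > 0\<close>. After the shift
    the factor \<open>Suc n\<close> of the power rule cancels against the factorial.\<close>
  also have "\<dots> = (\<Sum>n\<le>m. mps_const (1 / fact (Suc n)) * (of_nat k * ?P (Suc n) k))"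
    using Suc by (subst sum.atMost_Suc_shift) (simp del: gen_pow.simps(2))
  also have "\<dots> = (\<Sum>n\<le>m. \<Sum>i\<le>k. of_nat i * shift_gen \<epsilon> i (mps_const (1 / fact n) * ?P n (k - i)))"
  proof (rule sum.cong)
    fix n
    have "mps_const (1 / fact (Suc n)) * of_nat (Suc n) = (mps_const (1 / fact n) :: fock_var mps)"
      by (simp del: of_nat_Suc flip: mps_const_of_nat mps_const_mult)
    then have "mps_const (1 / fact (Suc n)) * (of_nat k * ?P (Suc n) k) =
        mps_const (1 / fact n) * (\<Sum>i\<le>k. of_nat i * shift_gen \<epsilon> i (?P n (k - i)))"
      by (simp only: gen_pow_deriv mult.assoc[symmetric])
    then show "mps_const (1 / fact (Suc n)) * (of_nat k * ?P (Suc n) k) =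
        (\<Sum>i\<le>k. of_nat i * shift_gen \<epsilon> i (mps_const (1 / fact n) * ?P n (k - i)))"
      by (simp only: shift_gen_const_mult sum_distrib_left mult.left_commute)
  qed simp
  also have "\<dots> = (\<Sum>i\<le>k. \<Sum>n\<le>m. of_nat i * shift_gen \<epsilon> i (mps_const (1 / fact n) * ?P n (k - i)))"
    by (rule sum.swap)
  also have "\<dots> = (\<Sum>i\<le>k. of_nat i * shift_gen \<epsilon> i (\<Sum>n\<le>m. mps_const (1 / fact n) * ?P n (k - i)))"
    by (simp only: shift_gen_sum sum_distrib_left)
  also have "\<dots> = (\<Sum>i=1..k. of_nat i * shift_gen \<epsilon> i (\<Sum>n\<le>m. mps_const (1 / fact n) * ?P n (k - i)))"
    by (rule sum.mono_neutral_right) (auto simp: not_less_eq_eq)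
  also have "\<dots> = (\<Sum>i=1..k. mps_const \<epsilon> * deriv_xy i (gen_exp \<epsilon> (k - i) f))"
  proof (rule sum.cong)
    fix i assume i: "i \<in> {1..k}"
    have "gen_exp \<epsilon> (k - i) f = (\<Sum>n\<le>m. mps_const (1 / fact n) * ?P n (k - i))"
      unfolding gen_exp_def by (rule sum.mono_neutral_left) (use i Suc in \<open>auto simp: gen_pow_eq_0\<close>)
    then show "of_nat i * shift_gen \<epsilon> i (\<Sum>n\<le>m. mps_const (1 / fact n) * ?P n (k - i)) =
        mps_const \<epsilon> * deriv_xy i (gen_exp \<epsilon> (k - i) f)"
      using i by (simp add: of_nat_mult_shift_gen)
  qed simp
  finally show ?thesis .
qed simp

text \<open>The recurrence determines all values, since multiplication by \<open>k > 0\<close> is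
  injective. Exponentials of operators can thus be computed by verifying a guess.\<close>

lemma gen_exp_eqI:
  assumes "e 0 = f" "\<And>k. k > 0 \<Longrightarrow> of_nat k * e k = (\<Sum>i=1..k. mps_const \<epsilon> * deriv_xy i (e (k - i)))"
  shows "gen_exp \<epsilon> k f = e k"
proof (induction k rule: less_induct)
  case (less k)
  show ?case
  proof (cases "k = 0")
    case False
    have "of_nat k * gen_exp \<epsilon> k f = of_nat k * e k"
      unfolding gen_exp_recurrence using False by (simp add: assms(2) less)
    with False show ?thesis using mps_of_nat_mult_cancel[of k] by blast
  qed (use assms(1) in \<open>simp add: gen_exp_0\<close>)
qed

lemma op_pow_gen_pow:
  assumes "\<And>i w c. D i w c = shift_gen \<epsilon> i (w c)"
  shows "op_pow D n k v c = gen_pow \<epsilon> n k (v c)"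
  by (induction n arbitrary: k) (simp_all add: sum_fun_apply assms)

lemma op_exp_gen_exp:
  assumes "\<And>i w c. D i w c = shift_gen \<epsilon> i (w c)"
  shows "op_exp D k v = (\<lambda>c. gen_exp \<epsilon> k (v c))"
  by (rule ext) (simp add: op_exp_def gen_exp_def sum_fun_apply scale_def fmult_def op_pow_gen_pow[of D \<epsilon>, OF assms])

lemma Dser_shift_gen: "Dser i w c = shift_gen 1 i (w c)"
  by (simp add: Dser_def shift_gen_def scale_def fmult_def dx_def dy_def deriv_xy_def mps_inverse_of_nat)

lemma minus_Dser_shift_gen: "(- Dser i) w c = shift_gen (- 1) i (w c)"
  using Dser_shift_gen[of i w c] by (simp add: shift_gen_def mps_const_minus)

lemmas op_exp_Dser = op_exp_gen_exp[of Dser, OF Dser_shift_gen]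
  and op_exp_minus_Dser = op_exp_gen_exp[of "\<lambda>n. - Dser n", OF minus_Dser_shift_gen]

lemma gen_exp_zero [simp]: "gen_exp \<epsilon> k 0 = 0"
  by (rule gen_exp_eqI) (auto simp: derivation_zero[OF derivation_deriv_xy])

section \<open>The fields on elements of a single charge\<close>

lemma infsum_finite_support:
  fixes f :: "'a \<Rightarrow> 'b::{comm_monoid_add, t2_space}"
  assumes "finite B" "B \<subseteq> A" "\<And>x. x \<in> A - B \<Longrightarrow> f x = 0"
  shows "infsum f A = sum f B"
proof -
  have "infsum f A = infsum f B"
    by (rule infsum_cong_neutral) (use assms in auto)
  then show ?thesis using assms by simp
qed

definition single_charge :: "int \<Rightarrow> fock_var mps \<Rightarrow> fock" where
  "single_charge c f = (\<lambda>d. if d = c then f else 0)"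

lemma single_charge_add: "single_charge c f + single_charge c g = single_charge c (f + g)"
  by (rule ext) (simp add: single_charge_def)

lemma single_charge_0 [simp]: "single_charge c 0 = 0"
  by (rule ext) (simp add: single_charge_def)

lemma single_charge_sum: "(\<Sum>x\<in>A. single_charge c (f x)) = single_charge c (sum f A)"
  by (induction A rule: infinite_finite_induct) (auto simp: single_charge_add)

lemma fmult_single_charge: "h \<bullet>\<^sub>F single_charge c f = single_charge c (h * f)"
  by (rule ext) (simp add: single_charge_def fmult_def)

lemma p_power_single_charge: "p_power k (single_charge c f) = single_charge (c + k) f"
  by (rule ext) (auto simp: single_charge_def p_power_def)

lemma charge0_single_charge: "charge0 f = single_charge 0 f"
  by (simp add: charge0_def single_charge_def)

lemma op_exp_single_charge:
  "op_exp Dser k (single_charge c f) = single_charge c (gen_exp 1 k f)"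
  "op_exp (\<lambda>n. - Dser n) k (single_charge c f) = single_charge c (gen_exp (- 1) k f)"
  by (simp_all only: op_exp_Dser op_exp_minus_Dser) (rule ext, simp add: single_charge_def)+

text \<open>For index \<open>- s\<close> the condition on exponents reads m - k = s - 1 and
  determines m, so a sum over \<open>k\<close> remains, which ends at \<open>V\<close>.\<close>

lemma phi_single_charge:
  assumes s: "s \<ge> 1" and V: "\<And>k. k > V \<Longrightarrow> gen_exp 1 k f = 0"
  shows "phi (- int s) (single_charge c f) =
    single_charge (c - 1) (\<Sum>k\<le>V. S_minus (s - 1 + k) * gen_exp 1 k f)"
proof -
  let ?h = "\<lambda>(m, k). S_minus m \<bullet>\<^sub>F op_exp Dser k (single_charge c f)"
  let ?A = "{(m, k). int m - int k = - (- int s) - 1}"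
  have "infsum ?h ?A = sum ?h ((\<lambda>k. (s - 1 + k, k)) ` {..V})"
  proof (rule infsum_finite_support)
    show "(\<lambda>k. (s - 1 + k, k)) ` {..V} \<subseteq> ?A" using s by auto
    fix x assume x: "x \<in> ?A - (\<lambda>k. (s - 1 + k, k)) ` {..V}"
    obtain m k where mk: "x = (m, k)" by (cases x)
    with x s have "m = s - 1 + k" by auto
    with x mk have "k > V" by (auto simp: not_le)
    then show "?h x = 0" by (simp add: mk op_exp_single_charge fmult_single_charge V)
  qed simp
  also have "\<dots> = (\<Sum>k\<le>V. ?h (s - 1 + k, k))"
    by (subst sum.reindex) (auto simp: inj_on_def)
  also have "\<dots> = single_charge c (\<Sum>k\<le>V. S_minus (s - 1 + k) * gen_exp 1 k f)"
    by (simp add: op_exp_single_charge fmult_single_charge single_charge_sum)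
  finally show ?thesis by (simp add: phi_def p_power_single_charge)
qed

text \<open>The current on charge 0, where p d/dp acts as zero.\<close>

definition current0 :: "int \<Rightarrow> fock_var mps \<Rightarrow> fock_var mps" where
  "current0 j f = (if j \<ge> 0 then of_nat (nat j + 1) * xv (nat j + 1) * f
     else if j = -1 then 0 else deriv_x (nat (- j - 1)) f)"

lemma current_single_charge: "current j (single_charge 0 f) = single_charge 0 (current0 j f)"
  by (rule ext) (auto simp: current_def current0_def single_charge_def fmult_def p_dp_def dx_def
      deriv_x_def derivation_zero[OF derivation_mps_deriv])

text \<open>The term j = -l-1 of the current is the derivative by x_l, so the lower end
  \<open>-int N-1\<close> keeps exactly \<open>l \<le> N\<close>. The upper end expresses m >=
  0.\<close>

lemma phi_star_single_charge:
  assumes V: "\<And>k. k > V \<Longrightarrow> gen_exp (- 1) k f = 0"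
    and N: "\<And>k l. k \<le> V \<Longrightarrow> l > N \<Longrightarrow> deriv_x l (gen_exp (- 1) k f) = 0"
  shows "phi_star (- int t) (single_charge 0 f) = single_charge 1
    (\<Sum>k\<le>V. \<Sum>j=-int N-1..int t+int k. S_plus (nat (int t + int k - j)) * current0 j (gen_exp (- 1) k f))"
proof -
  let ?h = "\<lambda>(m, j, k). S_plus m \<bullet>\<^sub>F current j (op_exp (\<lambda>n. - Dser n) k (single_charge 0 f))"
  let ?A = "{(m, j, k). int m + j - int k = - (- int t)}"
  let ?S = "SIGMA k:{..V}. {-int N-1..int t+int k}"
  let ?f = "\<lambda>(k, j). (nat (int t + int k - j), j, k)"
  have h: "?h (m, j, k) = single_charge 0 (S_plus m * current0 j (gen_exp (- 1) k f))" for m j k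
    by (simp add: op_exp_single_charge current_single_charge fmult_single_charge)
  have "infsum ?h ?A = sum ?h (?f ` ?S)"
  proof (rule infsum_finite_support)
    show "?f ` ?S \<subseteq> ?A" by auto
    fix x assume x: "x \<in> ?A - ?f ` ?S"
    obtain m j k where mjk: "x = (m, j, k)" by (cases x)
    with x have "j \<le> int t + int k" "m = nat (int t + int k - j)" by auto
    with x mjk have "k > V \<or> (k \<le> V \<and> j < - int N - 1)" by (force simp: image_iff)
    then have "current0 j (gen_exp (- 1) k f) = 0"
    proof
      assume "k > V"
      then show ?thesis by (simp add: V current0_def deriv_x_def derivation_zero[OF derivation_mps_deriv])
    next
      assume "k \<le> V \<and> j < - int N - 1"
      then show ?thesis by (auto simp: current0_def intro!: N)
    qed
    then show "?h x = 0" unfolding mjk h by simp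
  qed simp
  also have "\<dots> = (\<Sum>x\<in>?S. ?h (?f x))"
    by (subst sum.reindex) (auto simp: inj_on_def)
  also have "\<dots> = (\<Sum>(k, j)\<in>?S. single_charge 0 (S_plus (nat (int t + int k - j)) * current0 j (gen_exp (- 1) k f)))"
    by (rule sum.cong) (auto simp: op_exp_single_charge current_single_charge fmult_single_charge)
  also have "\<dots> = single_charge 0 (\<Sum>(k, j)\<in>?S. S_plus (nat (int t + int k - j)) * current0 j (gen_exp (- 1) k f))"
    by (simp only: case_prod_unfold single_charge_sum)
  also have "(\<Sum>(k, j)\<in>?S. S_plus (nat (int t + int k - j)) * current0 j (gen_exp (- 1) k f)) =
      (\<Sum>k\<le>V. \<Sum>j=-int N-1..int t+int k. S_plus (nat (int t + int k - j)) * current0 j (gen_exp (- 1) k f))"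
    by (rule sum.Sigma[symmetric]) auto
  finally show ?thesis
    unfolding phi_star_def by (simp only: p_power_single_charge add_0)
qed

lemma gen_exp_const_mult: "gen_exp \<epsilon> k (mps_const c * f) = mps_const c * gen_exp \<epsilon> k f"
proof (rule gen_exp_eqI)
  fix k :: nat
  have "of_nat k * (mps_const c * gen_exp \<epsilon> k f) = mps_const c * (of_nat k * gen_exp \<epsilon> k f)"
    by (rule mult.left_commute)
  also have "\<dots> = (\<Sum>i=1..k. mps_const \<epsilon> * deriv_xy i (mps_const c * gen_exp \<epsilon> (k - i) f))"
    by (simp only: gen_exp_recurrence deriv_xy_const_mult sum_distrib_left mult.left_commute)
  finally show "of_nat k * (mps_const c * gen_exp \<epsilon> k f) =
      (\<Sum>i=1..k. mps_const \<epsilon> * deriv_xy i (mps_const c * gen_exp \<epsilon> (k - i) f))" .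
qed (simp add: gen_exp_0)

lemma current0_const_mult: "current0 j (mps_const c * f) = mps_const c * current0 j f"
  by (simp add: current0_def mult.left_commute derivation_mult[OF derivation_deriv_x])

text \<open>If z is given weight -1, then \<open>f\<close> is homogeneous of weight \<open>d\<close>
  and its \<open>n\<close>-th power of weight \<open>n * d\<close>. The bounds on the support are
  carried through the same induction.\<close>

lemma homogeneous_fls_power:
  fixes f :: "fock_var mps fls"
  assumes low: "\<And>k. k < - int d \<Longrightarrow> f $$ k = 0" and high: "\<And>k. k > -1 \<Longrightarrow> f $$ k = 0"
    and hom: "\<And>k. k \<ge> - int d \<Longrightarrow> homogeneous (nat (k + int d)) (f $$ k)"
  shows "(k < - int (n * d) \<longrightarrow> (f ^ n) $$ k = 0) \<and> (k > - int n \<longrightarrow> (f ^ n) $$ k = 0) \<and>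
    (k \<ge> - int (n * d) \<longrightarrow> homogeneous (nat (k + int (n * d))) ((f ^ n) $$ k))"
proof (induction n arbitrary: k)
  case (Suc n)
  have eq: "(f ^ Suc n) $$ k = (\<Sum>i=- int d..k + int (n * d). f $$ i * (f ^ n) $$ (k - i))"
    unfolding power_Suc by (rule fls_times_nth_range) (use low Suc in auto)
  have "(f ^ Suc n) $$ k = 0" if "k > - int (Suc n)"
    unfolding power_Suc by (rule fls_mult_nth_le[of "-1" _ "- int n"]) (use high Suc that in auto)
  moreover have "(f ^ Suc n) $$ k = 0" if "k < - int (Suc n * d)"
    using that unfolding eq by simp
  moreover have "homogeneous (nat (k + int (Suc n * d))) ((f ^ Suc n) $$ k)" if "k \<ge> - int (Suc n * d)"
    unfolding eq
  proof (intro homogeneous_sum)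
    fix i assume i: "i \<in> {- int d..k + int (n * d)}"
    have "nat (i + int d) + nat (k - i + int (n * d)) = nat (k + int (Suc n * d))"
      using i by (simp add: nat_add_distrib[symmetric] algebra_simps)
    then show "homogeneous (nat (k + int (Suc n * d))) (f $$ i * (f ^ n) $$ (k - i))"
      using i Suc.IH[of "k - i"] by (intro homogeneous_mult[OF hom]) auto
  qed
  ultimately show ?case by blast
qed simp

section \<open>The action of the fields on the right-hand side\<close>

locale fock_exponential =
  fixes s t :: nat and a :: complex
  assumes s: "s \<ge> 1"
begin

text \<open>\<open>E_low\<close> is \<open>R(z)\<close>, \<open>H\<close> is \<open>z^(-t-1) E(z)\<close>, \<open>y\<close> is
  \<open>q R(z)\<close>, \<open>K\<close> is \<open>1 / (1 + y)\<close>, \<open>L\<close> is \<open>log (1 + y)\<close> and \<open>\<Lambda>\<close> is \<open>- z dL/dz\<close>. The term \<open>n = 0\<close>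
  of \<open>L\<close> vanishes because of \<open>1 / 0 = 0\<close>.\<close>

definition "E_plus = fps_to_fls (Abs_fps S_plus)"
definition "E_minus = fps_to_fls (Abs_fps S_minus)"
definition "E_low = (\<Sum>m\<le>t. fls_const (S_plus m) * fls_X_intpow (- int t - 1 + int m))"
definition "x_field = fps_to_fls (Abs_fps (\<lambda>j. of_nat (j + 1) * xv (j + 1)))"
definition "A = A_elem s t"
definition "B = S_minus (s - 1)"
definition \<tau> :: "fock_var mps fps" where "\<tau> = fps_const (mps_const a) * fps_X ^ (s + t)"
definition "C = grading (inverse (1 - mps_const a * A))"
definition "q = \<tau> * fps_const B * C"

abbreviation "EP \<equiv> fps_const E_plus"
abbreviation "EM \<equiv> fps_const E_minus"
abbreviation "R \<equiv> fps_const E_low"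
abbreviation "X \<equiv> fps_const x_field"

definition "H = zpow (- int t - 1) * EP"
definition "y = emb q * R"
definition "K = Abs_fps (\<lambda>n. (-1) ^ n) oo y"
definition "L = Abs_fps (\<lambda>n. fls_const (mps_const (- ((-1) ^ n / of_nat n)))) oo y"
definition "\<Lambda> = zeuler y * K"
definition "Y = zcoeff (-1) (X * K * R)"
definition "ell = zcoeff (-1) (X * L)"
definition "F = C * (Abs_fps (\<lambda>n. mps_const (1 / fact n)) oo ell)"

section \<open>Inverses and the logarithm in the two-variable ring\<close>

lemma homogeneous_A: "homogeneous (s + t) A"
  unfolding A_def A_elem_def
  by (intro homogeneous_sum homogeneous_mult[OF homogeneous_S_plus homogeneous_S_minus]) auto

lemma homogeneous_B: "homogeneous (s - 1) B"
  unfolding B_def by (rule homogeneous_S_minus)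

lemma C_eq: "C * (1 - \<tau> * fps_const A) = 1"
proof -
  have "mps_coeff A {#} = 0"
    using homogeneousD[OF homogeneous_A] s by simp
  then have "(1 - mps_const a * A) * inverse (1 - mps_const a * A) = 1"
    by (intro mps_inverse) simp
  then have "grading (1 - mps_const a * A) * C = 1"
    unfolding C_def by (metis grading_mult grading_1)
  moreover have "grading (1 - mps_const a * A) = 1 - \<tau> * fps_const A"
    by (simp add: grading_diff grading_1 grading_mult grading_const grading_homogeneous[OF homogeneous_A]
        \<tau>_def mult_ac)
  ultimately show ?thesis by (simp add: mult.commute)
qed

lemma C_eq': "C = 1 + \<tau> * fps_const A * C"
  using C_eq by (simp add: algebra_simps)

lemma q_nth_0 [simp]: "q $ 0 = 0"
  using s by (simp add: q_def \<tau>_def fps_X_power_iff)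

lemma y_nth_0 [simp]: "y $ 0 = 0"
  by (simp add: y_def)

lemma K_eq: "K * (1 + y) = 1"
  unfolding K_def by (rule fps_geometric_compose) simp

lemma derivation_K: "derivation D \<Longrightarrow> D K = - (K * K * D y)"
proof -
  assume D: "derivation D"
  have "D (K * (1 + y)) = 0" by (simp add: K_eq derivation_one[OF D])
  then have "D K * (1 + y) + K * D y = 0" by (simp add: derivation_simps[OF D])
  then have "K * (D K * (1 + y) + K * D y) = 0" by simp
  then have "(K * (1 + y)) * D K + K * K * D y = 0" by (simp add: algebra_simps)
  then show ?thesis by (simp add: K_eq eq_neg_iff_add_eq_0)
qed

lemma derivation_L:
  assumes D: "derivation D" "fps_local D" "\<And>c. D (emb (fps_const (mps_const c))) = 0"
  shows "D L = K * D y"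
proof -
  let ?l = "Abs_fps (\<lambda>n. fls_const (mps_const (- ((-1) ^ n / of_nat n))) :: fock_var mps fls)"
  have "fps_deriv ?l = Abs_fps (\<lambda>n. (-1) ^ n)"
  proof (rule fps_ext)
    fix n
    have "of_nat (Suc n) * - ((-1) ^ Suc n / of_nat (Suc n)) = ((-1) ^ n :: complex)"
      by (simp del: of_nat_Suc)
    then have "of_nat (Suc n) * fls_const (mps_const (- ((-1) ^ Suc n / of_nat (Suc n)))) =
        fls_const (mps_const ((-1) ^ n))"
      by (simp only: fls_of_nat fls_const_mult_const flip: mps_const_of_nat mps_const_mult)
    also have "\<dots> = (-1) ^ n"
    proof -
      have "fls_const (- 1) = (- 1 :: fock_var mps fls)"
        by (rule fls_eqI) simp
      then show ?thesis
        by (simp add: mps_const_power mps_const_minus fls_const_power)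
    qed
    finally show "fps_deriv ?l $ n = Abs_fps (\<lambda>n. (-1) ^ n) $ n"
      by (simp del: of_nat_Suc power_Suc)
  qed
  moreover have "D (fps_const (fls_const (mps_const c))) = 0" for c
  proof -
    have "fps_const (fls_const (mps_const c)) = (emb (fps_const (mps_const c)) :: fock_var mps fls fps)"
      by (rule fps_ext) simp
    then show ?thesis using D(3) by simp
  qed
  ultimately show ?thesis
    unfolding L_def K_def using derivation_fps_compose[OF D(1,2), of ?l y] by simp
qed

section \<open>Coefficients and ranges of exponents of the basic series\<close>

lemma E_plus_nth: "E_plus $$ k = (if k < 0 then 0 else S_plus (nat k))"
  and E_minus_nth: "E_minus $$ k = (if k < 0 then 0 else S_minus (nat k))"
  by (simp_all add: E_plus_def E_minus_def)

lemma E_low_nth: "E_low $$ k = (if - int t - 1 \<le> k \<and> k \<le> -1 then S_plus (nat (k + int t + 1)) else 0)"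
proof -
  have "E_low $$ k = (\<Sum>m\<le>t. if k = - int t - 1 + int m then S_plus m else 0)"
    unfolding E_low_def fls_nth_sum
    by (rule sum.cong) (auto simp: fls_X_intpow_times_conv_shift)
  also have "\<dots> = (\<Sum>m\<le>t. if m = nat (k + int t + 1) then (if - int t - 1 \<le> k \<and> k \<le> -1 then S_plus (nat (k + int t + 1)) else 0) else 0)"
    by (rule sum.cong) auto
  also have "\<dots> = (if - int t - 1 \<le> k \<and> k \<le> -1 then S_plus (nat (k + int t + 1)) else 0)"
    by auto
  finally show ?thesis .
qed

lemma x_field_nth: "x_field $$ k = (if k < 0 then 0 else of_nat (nat k + 1) * xv (nat k + 1))"
  by (simp add: x_field_def)

lemma zge_EM: "zge 0 EM" and zge_X: "zge 0 X"
  and zge_R: "zge (- int t - 1) R" and zle_R: "zle (-1) R"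
  by (simp_all add: zge_def zle_def H_def E_minus_nth E_plus_nth E_low_nth x_field_nth)

lemma R_eq: "R = zneg H"
proof -
  have *: "k - (- int t - 1) = k + int t + 1" for k by simp
  then show ?thesis
    by (intro two_var_eqI) (auto simp: zcoeff_zneg H_def E_low_nth E_plus_nth *)
qed

lemma E_plus_E_minus: "E_plus * E_minus = 1"
proof -
  have "E_plus * E_minus = fps_to_fls (Abs_fps S_plus * Abs_fps S_minus)"
    by (simp add: E_plus_def E_minus_def fls_times_fps_to_fls)
  then show ?thesis by (simp add: S_plus_S_minus)
qed

lemma EM_H: "EM * H = zpow (- int t - 1)"
proof -
  have "EM * H = zpow (- int t - 1) * (EP * EM)" by (simp only: H_def mult_ac)
  then show ?thesis by (simp add: E_plus_E_minus fps_const_mult)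
qed

text \<open>The exponents -t-1+m and s+t-m add up to s-1. In this form the derivatives of
  \<open>A\<close> follow from those of \<open>EM\<close> and \<open>R\<close>.\<close>

lemma fps_const_A: "fps_const A = zcoeff (int s - 1) (EM * R)"
proof -
  have "E_minus * E_low = (\<Sum>m\<le>t. fls_const (S_plus m) * (fls_X_intpow (- int t - 1 + int m) * E_minus))"
    by (simp add: E_low_def sum_distrib_left mult_ac)
  then have "(E_minus * E_low) $$ (int s - 1) = (\<Sum>m\<le>t. S_plus m * S_minus (s + t - m))"
    using s by (auto simp: fls_nth_sum fls_shifted_times_simps E_minus_nth intro!: sum.cong
        arg_cong2[where f = "(*)"] arg_cong[where f = S_minus])
  then show ?thesis by (simp add: A_def A_elem_def)
qed

lemma fps_const_B: "fps_const B = zcoeff (int s - 1) EM"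
  using s by (simp add: E_minus_nth B_def nat_diff_distrib)

lemma zle_y: "zle (-1) y"
  unfolding y_def by (intro zle_emb_mult zle_R)

lemma zle_power: "zle 0 f \<Longrightarrow> zle 0 (f ^ n)"
  by (induction n) (auto intro: zle_1 zle_mult)

lemma zle_K: "zle 0 K"
  unfolding zle_def
proof (intro allI impI fps_ext)
  fix k n assume k: "(0 :: int) < k"
  have "zle 0 (fps_const ((-1) ^ j) * y ^ j)" for j
    by (rule zle_mult[OF _ zle_power[OF zle_mono[OF zle_y]]]) (auto simp: zle_def minus_one_power_iff)
  then have "zcoeff k (\<Sum>j\<le>n. fps_const ((-1) ^ j) * y ^ j) = 0"
    unfolding zcoeff_sum using k by (intro sum.neutral) (auto dest: zleD)
  then have "(\<Sum>j\<le>n. fps_const ((-1) ^ j) * y ^ j) $ n $$ k = 0"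
    by (metis zcoeff_nth fps_zero_nth)
  then show "zcoeff k K $ n = 0 $ n"
    using fps_compose_nth_trunc[OF y_nth_0 order_refl, of "Abs_fps (\<lambda>n. (-1) ^ n)" n]
    by (simp add: K_def)
qed

section \<open>Derivatives of the scalars and of the basic series\<close>

lemma derivation_C:
  assumes D: "derivation D" "D \<tau> = 0"
  shows "D C = C * C * \<tau> * D (fps_const A)"
proof -
  have "D (C * (1 - \<tau> * fps_const A)) = 0" by (simp add: C_eq derivation_one[OF D(1)])
  then have "D C * (1 - \<tau> * fps_const A) = C * \<tau> * D (fps_const A)"
    by (simp add: derivation_simps[OF D(1)] D(2))
  then have "C * (D C * (1 - \<tau> * fps_const A)) = C * (C * \<tau> * D (fps_const A))" by simp
  then have "D C * (C * (1 - \<tau> * fps_const A)) = C * C * \<tau> * D (fps_const A)"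
    by (simp only: mult_ac)
  then show ?thesis by (simp add: C_eq)
qed

lemma derivation_q:
  assumes D: "derivation D" "D \<tau> = 0"
  shows "D q = \<tau> * C * (D (fps_const B) + q * D (fps_const A))"
  by (simp add: q_def derivation_simps[OF D(1)] D(2) derivation_C[OF D] algebra_simps)

lemma fps_map_\<tau>:
  assumes "derivation d" "\<And>c. d (mps_const c) = 0"
  shows "fps_map d \<tau> = 0"
proof -
  have "fps_map d (fps_const (mps_const a)) = 0"
    by (rule fps_ext) (simp add: derivation_zero[OF assms(1)] assms(2))
  then show ?thesis
    unfolding \<tau>_def by (simp add: fps_map_X_power_mult derivation_zero[OF assms(1)])
qed

lemma fps_theta_\<tau>: "fps_theta \<tau> = of_nat (s + t) * \<tau>"
  by (rule fps_ext) (auto simp: \<tau>_def fps_X_power_iff fps_of_nat[symmetric])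

abbreviation "dx' k \<equiv> fps_map (deriv_x k)"
abbreviation "Dx' k \<equiv> lift2 (deriv_x k)"
abbreviation "dxy' k \<equiv> fps_map (deriv_xy k)"
abbreviation "Dxy' k \<equiv> lift2 (deriv_xy k)"

lemmas derivation_dx = derivation_fps_map[OF derivation_deriv_x]
  and derivation_Dx = derivation_lift2[OF derivation_deriv_x]
  and derivation_dxy = derivation_fps_map[OF derivation_deriv_xy]
  and derivation_Dxy = derivation_lift2[OF derivation_deriv_xy]

lemma Dx_EP: "k > 0 \<Longrightarrow> Dx' k EP = zpow (int k) * EP"
  and Dx_EM: "k > 0 \<Longrightarrow> Dx' k EM = - (zpow (int k) * EM)"
proof -
  have *: "fps_const (fps_to_fls (f * fps_X ^ k)) = zpow (int k) * fps_const (fps_to_fls f)"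
    for f :: "fock_var mps fps"
    by (rule two_var_eqI) (auto simp: fps_X_power_mult_right_nth nat_diff_distrib)
  assume k: "k > 0"
  show "Dx' k EP = zpow (int k) * EP"
    using deriv_x_S_plus[OF k] *
    by (simp add: lift2_const derivation_deriv_x derivation_zero E_plus_def fls_map_fps_to_fls)
  show "Dx' k EM = - (zpow (int k) * EM)"
    using deriv_x_S_minus[OF k] *
    by (simp add: lift2_const derivation_deriv_x derivation_zero E_minus_def fls_map_fps_to_fls
        flip: fps_const_neg)
qed

lemma Dx_H: "k > 0 \<Longrightarrow> Dx' k H = zpow (int k) * H"
  by (simp add: H_def derivation_mult[OF derivation_Dx] Dx_EP lift2_zpow[OF derivation_deriv_x] mult_ac)

text \<open>For nonnegative exponents the shift creates no negative ones, so only the part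
  \<open>R\<close> of \<open>H\<close> matters. Hence the derivatives of \<open>R\<close> by x_k can
  be written in terms of \<open>R\<close> alone.\<close>

lemma zneg_zpow_H: "zneg (zpow (int k) * H) = zneg (zpow (int k) * R)"
proof -
  have "zpow (int k) * H = zpow (int k) * R + zpow (int k) * zpos H"
    by (simp add: R_eq zneg_def algebra_simps)
  moreover have "zneg (zpow (int k) * zpos H) = 0"
    by (rule zneg_eq_0) (auto simp: zge_def zcoeff_zpos)
  ultimately show ?thesis by (simp add: zneg_add)
qed

lemma Dx_R: "k > 0 \<Longrightarrow> Dx' k R = zneg (zpow (int k) * R)"
  using lift2_zneg[OF derivation_deriv_x, of k H] by (simp add: R_eq[symmetric] Dx_H zneg_zpow_H)

lemma Dx_X: "k > 0 \<Longrightarrow> Dx' k X = of_nat k * zpow (int k - 1)"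
  and Dxy_X: "k > 0 \<Longrightarrow> Dxy' k X = of_nat k * zpow (int k - 1)"
proof -
  assume k: "k > 0"
  have z: "zcoeff j (of_nat k * zpow (int k - 1) :: fock_var mps fls fps) =
      (if j = int k - 1 then fps_const (of_nat k) else 0)" for j
  proof -
    have "(of_nat k :: fock_var mps fls fps) = emb (of_nat k)"
      by (rule fps_ext) (simp add: fls_of_nat flip: fps_of_nat)
    then show ?thesis by (simp add: zcoeff_zpow fps_of_nat)
  qed
  show "Dx' k X = of_nat k * zpow (int k - 1)"
    by (rule two_var_eqI, subst z) (use k in \<open>auto simp: zcoeff_lift2 derivation_deriv_x x_field_nth
        derivation_simps[OF derivation_deriv_x] deriv_x_xv fps_eq_iff nat_diff_distrib
        simp del: of_nat_nat\<close>)
  show "Dxy' k X = of_nat k * zpow (int k - 1)"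
    by (rule two_var_eqI, subst z) (use k in \<open>auto simp: zcoeff_lift2 derivation_deriv_xy x_field_nth
        derivation_simps[OF derivation_deriv_xy] deriv_xy_xv fps_eq_iff nat_diff_distrib
        simp del: of_nat_nat\<close>)
qed

lemma Dxy_const:
  assumes k: "k > 0"
  shows "Dxy' k R = 0" "dxy' k q = 0" "dxy' k (fps_const A) = 0" "dxy' k (fps_const B) = 0" "dxy' k C = 0"
proof -
  note d = derivation_deriv_xy[of k]
  show "Dxy' k R = 0"
    by (rule two_var_eqI, rule fps_ext) (auto simp: zcoeff_lift2[OF d] E_low_nth deriv_xy_S_plus k derivation_zero[OF d])
  show A: "dxy' k (fps_const A) = 0"
    by (rule fps_ext) (auto simp: A_def A_elem_def derivation_simps[OF d] deriv_xy_S_plus deriv_xy_S_minus k)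
  show B: "dxy' k (fps_const B) = 0"
    by (rule fps_ext) (auto simp: B_def derivation_simps[OF d] deriv_xy_S_minus k)
  show "dxy' k C = 0" "dxy' k q = 0"
    using derivation_C[OF derivation_dxy[of k] fps_map_\<tau>[OF d]] A B
      derivation_q[OF derivation_dxy[of k] fps_map_\<tau>[OF d]] by auto
qed

text \<open>Products such as \<open>EM * R\<close> have to stay visible as products instead of being
  merged into one constant.\<close>

declare fps_const_mult [simp del]

lemma zeuler_y: "zeuler y = emb q * zeuler R"
  by (simp add: y_def derivation_mult[OF derivation_zeuler])

lemma zle_\<Lambda>: "zle (-1) \<Lambda>"
proof -
  have "zle (-1) (zeuler y)"
    using zle_y by (auto simp: zle_def zcoeff_zeuler)
  then show ?thesis unfolding \<Lambda>_def by (rule zle_mult[OF _ zle_K]) simp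
qed

lemma zeuler_L: "zeuler L = \<Lambda>"
  unfolding \<Lambda>_def by (subst derivation_L[OF derivation_zeuler fps_local_zeuler]) auto

lemma ell_nth_0 [simp]: "ell $ 0 = 0"
  by (simp add: ell_def L_def)

lemma fps_map_ell:
  assumes d: "derivation d" "\<And>c. d (mps_const c) = 0"
  shows "fps_map d ell = zcoeff (-1) (lift2 d X * L) + zcoeff (-1) (X * K * lift2 d y)"
proof -
  have "lift2 d (emb (fps_const (mps_const c))) = 0" for c
  proof -
    have "fps_map d (fps_const (mps_const c)) = 0"
      by (rule fps_ext) (simp add: d(2) derivation_zero[OF d(1)])
    then show ?thesis by (simp add: lift2_emb[OF d(1)])
  qed
  then have "lift2 d L = K * lift2 d y"
    by (rule derivation_L[OF derivation_lift2[OF d(1)] fps_local_lift2[OF d(1)]])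
  then show ?thesis
    unfolding ell_def
    by (simp add: derivation_mult[OF derivation_lift2[OF d(1)]] mult.assoc flip: zcoeff_lift2[OF d(1)])
qed

section \<open>The Euler derivative of \<open>F\<close>\<close>

lemma fps_theta_C: "fps_theta C = C * (of_nat (s + t) * \<tau> * fps_const A * C)"
proof -
  note D = derivation_fps_theta
  have "fps_theta (C * (1 - \<tau> * fps_const A)) = 0"
    by (simp add: C_eq derivation_one[OF D])
  then have "fps_theta C * (1 - \<tau> * fps_const A) = C * (of_nat (s + t) * \<tau> * fps_const A)"
    by (simp add: derivation_simps[OF D] fps_theta_\<tau> del: of_nat_add)
  then have "C * (fps_theta C * (1 - \<tau> * fps_const A)) = C * (C * (of_nat (s + t) * \<tau> * fps_const A))"
    by simp
  then have "fps_theta C * (C * (1 - \<tau> * fps_const A)) = C * (of_nat (s + t) * \<tau> * fps_const A * C)"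
    by (simp only: mult_ac)
  then show ?thesis by (simp add: C_eq)
qed

lemma fps_theta_q: "fps_theta q = of_nat (s + t) * \<tau> * fps_const B * C * C"
proof -
  note D = derivation_fps_theta
  have "fps_theta q = of_nat (s + t) * \<tau> * fps_const B * C * (1 + \<tau> * fps_const A * C)"
    by (simp add: q_def derivation_simps[OF D] fps_theta_\<tau> fps_theta_C algebra_simps del: of_nat_add)
  also have "1 + \<tau> * fps_const A * C = C" by (rule C_eq'[symmetric])
  finally show ?thesis .
qed

text \<open>The outer variable enters \<open>ell\<close> only through \<open>q\<close>.\<close>

lemma fps_theta_ell: "fps_theta ell = fps_theta q * Y"
proof -
  note D = derivation_fps_theta
  have "fps_theta L = K * fps_theta y"
  proof (rule derivation_L[OF D fps_local_theta])
    show "fps_theta (emb (fps_const (mps_const c))) = 0" for c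
      by (simp add: fps_theta_emb)
  qed
  moreover have "fps_theta y = emb (fps_theta q) * R"
    by (simp add: y_def derivation_simps[OF D] fps_theta_emb)
  ultimately have "fps_theta (X * L) = X * (K * (emb (fps_theta q) * R))"
    by (simp add: derivation_mult[OF D])
  also have "\<dots> = emb (fps_theta q) * (X * K * R)"
    by (simp only: mult_ac)
  finally have "fps_theta (X * L) = emb (fps_theta q) * (X * K * R)" .
  then show ?thesis by (simp add: ell_def Y_def flip: zcoeff_theta)
qed

text \<open>The logarithmic derivative of \<open>C\<close> times an exponential, multiplied by
  \<open>C\<close> instead of dividing; \<open>C_mult_cancel\<close> removes the factor
  again.\<close>

lemma derivation_F:
  assumes D: "derivation D" "fps_local D" "\<And>c. D (fps_const (mps_const c)) = 0"
  shows "C * D F = F * (D C + C * D ell)"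
  using derivation_exp_compose[OF D ell_nth_0]
  by (simp add: F_def derivation_simps[OF D(1)] algebra_simps)

lemma C_mult_cancel: "C * f = C * g \<Longrightarrow> f = g"
proof -
  assume "C * f = C * g"
  then have "(1 - \<tau> * fps_const A) * (C * f) = (1 - \<tau> * fps_const A) * (C * g)"
    by (rule arg_cong)
  then have "(C * (1 - \<tau> * fps_const A)) * f = (C * (1 - \<tau> * fps_const A)) * g"
    by (simp only: mult_ac)
  then show ?thesis by (simp add: C_eq)
qed

lemma fps_map_F:
  assumes d: "derivation d" "\<And>c. d (mps_const c) = 0"
  shows "fps_map d F = F * (\<tau> * C * fps_map d (fps_const A) + fps_map d ell)"
proof (rule C_mult_cancel)
  have *: "fps_map d (fps_const (mps_const c)) = 0" for c
    by (rule fps_ext) (simp add: d(2) derivation_zero[OF d(1)])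
  have "C * fps_map d F = F * (fps_map d C + C * fps_map d ell)"
    by (rule derivation_F[OF derivation_fps_map[OF d(1)] fps_local_map[of d] *])
      (simp add: derivation_zero[OF d(1)])
  then show "C * fps_map d F = C * (F * (\<tau> * C * fps_map d (fps_const A) + fps_map d ell))"
    using derivation_C[OF derivation_fps_map[OF d(1)] fps_map_\<tau>[OF d]] by (simp add: algebra_simps)
qed

text \<open>The last bracket is the result of applying both fields to \<open>F\<close>, later
  abbreviated \<open>Z\<close>.\<close>

lemma fps_theta_F: "fps_theta F = of_nat (s + t) * \<tau> * (F * C * (fps_const A + fps_const B * C * Y))"
proof (rule C_mult_cancel)
  have "C * fps_theta F = F * (fps_theta C + C * fps_theta ell)"
    by (rule derivation_F[OF derivation_fps_theta fps_local_theta]) simp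
  then show "C * fps_theta F = C * (of_nat (s + t) * \<tau> * (F * C * (fps_const A + fps_const B * C * Y)))"
    by (simp add: fps_theta_ell fps_theta_q fps_theta_C algebra_simps del: of_nat_add)
qed

section \<open>Derivatives of \<open>F\<close>, \<open>Y\<close>, \<open>A\<close> and
  \<open>q\<close> in single directions\<close>

lemma zcoeff_of_nat_mult: "zcoeff k (of_nat n * g) = of_nat n * zcoeff k g"
proof -
  have "(of_nat n :: 'a fls fps) = emb (of_nat n)"
    by (rule fps_ext) (simp add: fls_of_nat flip: fps_of_nat)
  then show ?thesis by simp
qed

text \<open>The derivative of \<open>X\<close> in direction \<open>k\<close> is k z^(k-1), and its
  residue against \<open>g\<close> is \<open>k\<close> times the coefficient of z^(-k).\<close>

lemma zcoeff_x_field: "zcoeff (-1) (of_nat k * zpow (int k - 1) * g) = zcoeff (- int k) (zeuler g)"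
  by (simp add: mult.assoc zcoeff_of_nat_mult zcoeff_zeuler)

text \<open>The four terms come from \<open>C\<close>, from the factor \<open>X\<close> in
  \<open>ell\<close>, and from \<open>q\<close> and \<open>R\<close> inside
  \<open>y\<close>.\<close>

lemma dx_F:
  assumes k: "k > 0"
  shows "dx' k F = F * (\<tau> * C * dx' k (fps_const A) + zcoeff (- int k) \<Lambda> + dx' k q * Y
    + q * zcoeff (-1) (X * K * Dx' k R))"
proof -
  note d = derivation_deriv_x[of k]
  have "Dx' k y = emb (dx' k q) * R + emb q * Dx' k R"
    by (simp add: y_def derivation_mult[OF derivation_Dx] lift2_emb[OF d])
  then have "X * K * Dx' k y = emb (dx' k q) * (X * K * R) + emb q * (X * K * Dx' k R)"
    by (simp add: algebra_simps)
  then have "zcoeff (-1) (X * K * Dx' k y) = dx' k q * Y + q * zcoeff (-1) (X * K * Dx' k R)"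
    by (simp add: Y_def)
  moreover have "zcoeff (-1) (Dx' k X * L) = zcoeff (- int k) \<Lambda>"
    by (simp add: Dx_X[OF k] zcoeff_x_field zeuler_L)
  ultimately show ?thesis
    by (simp add: fps_map_F[OF d] fps_map_ell[OF d] add.assoc)
qed

lemma Dxy_y: "k > 0 \<Longrightarrow> Dxy' k y = 0"
  by (simp add: y_def derivation_mult[OF derivation_Dxy] lift2_emb[OF derivation_deriv_xy] Dxy_const)

lemma Dxy_K: "k > 0 \<Longrightarrow> Dxy' k K = 0"
  by (simp add: derivation_K[OF derivation_Dxy] Dxy_y)

text \<open>\<open>C\<close>, \<open>q\<close> and \<open>R\<close> depend on x + y only, so just
  the factor \<open>X\<close> in \<open>ell\<close> is differentiated.\<close>

lemma dxy_F: "k > 0 \<Longrightarrow> dxy' k F = F * zcoeff (- int k) \<Lambda>"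
  by (simp add: fps_map_F[OF derivation_deriv_xy] fps_map_ell[OF derivation_deriv_xy] Dxy_const
    Dxy_y Dxy_X zcoeff_x_field zeuler_L)

lemma dxy_Y: "k > 0 \<Longrightarrow> dxy' k Y = zcoeff (- int k) (zeuler (K * R))"
proof -
  assume k: "k > 0"
  have "dxy' k Y = zcoeff (-1) (Dxy' k (X * K * R))"
    by (simp add: Y_def zcoeff_lift2[OF derivation_deriv_xy])
  also have "Dxy' k (X * K * R) = of_nat k * zpow (int k - 1) * (K * R)"
    using k by (simp add: derivation_mult[OF derivation_Dxy] Dxy_K Dxy_const Dxy_X mult.assoc)
  finally show ?thesis by (simp only: zcoeff_x_field)
qed

text \<open>Differentiating \<open>EM\<close> gives minus the whole of z^k R, differentiating
  \<open>R\<close> gives back its negative part.\<close>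

lemma dx_A:
  assumes k: "k > 0"
  shows "dx' k (fps_const A) = - zcoeff (int s - 1) (EM * zpos (zpow (int k) * R))"
proof -
  have "dx' k (fps_const A) = zcoeff (int s - 1) (Dx' k (EM * R))"
    unfolding fps_const_A by (rule zcoeff_lift2[OF derivation_deriv_x, symmetric])
  also have "Dx' k (EM * R) = - (EM * zpos (zpow (int k) * R))"
    by (simp add: derivation_mult[OF derivation_Dx] Dx_EM Dx_R k zneg_def algebra_simps)
  finally show ?thesis by simp
qed

lemma dx_B:
  assumes k: "k > 0"
  shows "dx' k (fps_const B) = - zcoeff (int s - 1) (EM * zpow (int k))"
  unfolding fps_const_B zcoeff_lift2[OF derivation_deriv_x, symmetric]
  by (simp add: Dx_EM k mult.commute del: zcoeff_zpow_mult)

lemma zpos_zpow_1y: "zpos (zpow (int k) * (1 + y)) = zpow (int k) + emb q * zpos (zpow (int k) * R)"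
proof -
  have "zpow (int k) * (1 + y) = zpow (int k) + emb q * (zpow (int k) * R)"
    by (simp add: y_def algebra_simps)
  moreover have "zpos (zpow (int k)) = (zpow (int k) :: fock_var mps fls fps)"
    by (rule zpos_eq) (simp add: zge_def zcoeff_zpow)
  ultimately show ?thesis by (simp add: zpos_add zpos_emb_mult)
qed

text \<open>The derivative of \<open>B\<close> and \<open>q\<close> times that of \<open>A\<close>
  combine into one truncation, because z^k is its own nonnegative part.\<close>

lemma dx_q:
  assumes k: "k > 0"
  shows "dx' k q = - (\<tau> * C * zcoeff (int s - 1) (EM * zpos (zpow (int k) * (1 + y))))"
proof -
  have "dx' k q = \<tau> * C * (dx' k (fps_const B) + q * dx' k (fps_const A))"
    by (rule derivation_q[OF derivation_dx fps_map_\<tau>[OF derivation_deriv_x]]) simp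
  also have "dx' k (fps_const B) + q * dx' k (fps_const A) =
      - zcoeff (int s - 1) (EM * zpow (int k) + emb q * (EM * zpos (zpow (int k) * R)))"
    by (simp add: dx_A dx_B k)
  also have "EM * zpow (int k) + emb q * (EM * zpos (zpow (int k) * R)) =
      EM * zpos (zpow (int k) * (1 + y))"
    by (simp only: zpos_zpow_1y distrib_left[of EM "zpow (int k)"] mult.left_commute)
  finally show ?thesis by simp
qed

section \<open>Summing the derivatives over all directions\<close>

lemma zge_zpos_high:
  assumes "\<And>k. 0 \<le> k \<Longrightarrow> k \<le> int V \<Longrightarrow> zcoeff k g = 0"
  shows "zge (int V + 1) (zpos g)"
  using assms by (auto simp: zge_def zcoeff_zpos)

text \<open>The sum reassembles \<open>g\<close> from its coefficients. Negative exponents of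
  \<open>g\<close> do not matter as \<open>U\<close> has no positive ones; exponents above
  \<open>V\<close> do not matter since times \<open>U\<close> they start at z^s, beyond the
  coefficient s-1. The term \<open>k = 0\<close> is split off because the current differentiates
  only by x_k with \<open>k \<ge> 1\<close>.\<close>

lemma sum_positive_part:
  assumes V: "s + t \<le> V" and U: "zle 0 U" "zge (- int t - 1) U"
  defines "\<Phi> \<equiv> \<lambda>g. zcoeff (int s - 1) (EM * zpos (g * U))"
  shows "(\<Sum>k=1..V. zcoeff (int k) g * \<Phi> (zpow (int k))) = \<Phi> g - zcoeff 0 g * \<Phi> 1"
proof -
  have "\<Phi> g = (\<Sum>k\<le>V. zcoeff (int k) g * \<Phi> (zpow (int k)))"
  proof (rule functional_expansion)
    show "\<Phi> (f + g) = \<Phi> f + \<Phi> g" for f g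
      by (simp add: \<Phi>_def distrib_right zpos_add distrib_left)
    show "\<Phi> (emb h * g) = h * \<Phi> g" for h g
    proof -
      have "EM * zpos (emb h * g * U) = emb h * (EM * zpos (g * U))"
        by (simp only: mult.assoc[of "emb h" g U] zpos_emb_mult) (rule mult.left_commute)
      then show ?thesis by (simp add: \<Phi>_def)
    qed
    show "\<Phi> g = 0" if g: "\<And>k. 0 \<le> k \<Longrightarrow> k \<le> int V \<Longrightarrow> zcoeff k g = 0" for g
    proof -
      have high: "zge (int s) (zpos g * U)"
        by (rule zge_mult[OF zge_zpos_high[OF g] U(2)]) (use V in auto)
      have "zle (-1) (zneg g * U)"
        by (rule zle_mult[OF zle_zneg U(1)]) simp
      moreover have "g * U = zneg g * U + zpos g * U"
        by (metis distrib_right zneg_zpos_cases)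
      ultimately have "zpos (g * U) = zpos g * U"
        using zpos_eq[OF zge_mono[OF high]] by (simp add: zpos_add zpos_eq_0)
      moreover have "zge (int s) (EM * (zpos g * U))"
        by (rule zge_mult[OF zge_EM high]) simp
      ultimately show ?thesis by (simp add: \<Phi>_def zgeD)
    qed
  qed
  also have "{..V} = insert 0 {1..V}" by auto
  finally show ?thesis by simp
qed

lemma sum_dx_A:
  assumes V: "s + t \<le> V"
  shows "(\<Sum>k=1..V. zcoeff (int k) g * dx' k (fps_const A)) =
    - zcoeff (int s - 1) (EM * zpos (g * R))"
proof -
  have "(\<Sum>k=1..V. zcoeff (int k) g * dx' k (fps_const A)) =
      - (\<Sum>k=1..V. zcoeff (int k) g * zcoeff (int s - 1) (EM * zpos (zpow (int k) * R)))"
    by (simp add: dx_A sum_negf)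
  also have "\<dots> = - zcoeff (int s - 1) (EM * zpos (g * R))"
    using sum_positive_part[OF V zle_mono[OF zle_R] zge_R, of g] by (simp add: zpos_eq_0[OF zle_R])
  finally show ?thesis .
qed

lemma sum_dx_q:
  assumes V: "s + t \<le> V"
  shows "(\<Sum>k=1..V. zcoeff (int k) g * dx' k q) =
    - (\<tau> * C * (zcoeff (int s - 1) (EM * zpos (g * (1 + y))) - zcoeff 0 g * fps_const B))"
proof -
  have U: "zle 0 (1 + y)" "zge (- int t - 1) (1 + y)"
    using zle_y zge_R by (auto simp: y_def zle_def zge_def)
  have "(\<Sum>k=1..V. zcoeff (int k) g * dx' k q) =
      - (\<tau> * C) * (\<Sum>k=1..V. zcoeff (int k) g * zcoeff (int s - 1) (EM * zpos (zpow (int k) * (1 + y))))"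
    unfolding sum_distrib_left by (rule sum.cong) (auto simp: dx_q mult_ac)
  also have "\<dots> = - (\<tau> * C) * (zcoeff (int s - 1) (EM * zpos (g * (1 + y))) -
      zcoeff 0 g * zcoeff (int s - 1) (EM * zpos (1 + y)))"
    using sum_positive_part[OF V U, of g] by simp
  also have "zpos (1 + y) = 1"
    using zpos_eq_0[OF zle_y] zpos_eq[OF zge_1] by (simp add: zpos_add)
  finally show ?thesis using fps_const_B by simp
qed

text \<open>Here the negative exponents of \<open>g\<close> would survive the outer
  \<open>zneg\<close>, so they are removed before multiplying by \<open>R\<close>.\<close>

lemma sum_Dx_R_residue:
  assumes V: "s + t \<le> V"
  shows "(\<Sum>k=1..V. zcoeff (int k) g * zcoeff (-1) (X * K * Dx' k R)) =
    zcoeff (-1) (X * K * zneg (zpos g * R)) - zcoeff 0 g * Y"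
proof -
  define \<Psi> where "\<Psi> g = zcoeff (-1) (X * K * zneg (zpos g * R))" for g
  have z: "zpos (zpow (int k)) = (zpow (int k) :: fock_var mps fls fps)" for k
    by (rule zpos_eq) (simp add: zge_def zcoeff_zpow)
  have "\<Psi> g = (\<Sum>k\<le>V. zcoeff (int k) g * \<Psi> (zpow (int k)))"
  proof (rule functional_expansion)
    show "\<Psi> (f + g) = \<Psi> f + \<Psi> g" for f g
      by (simp add: \<Psi>_def distrib_right zpos_add zneg_add distrib_left)
    show "\<Psi> (emb h * g) = h * \<Psi> g" for h g
    proof -
      have "X * K * zneg (zpos (emb h * g) * R) = emb h * (X * K * zneg (zpos g * R))"
        by (simp add: mult.assoc zpos_emb_mult zneg_emb_mult mult.left_commute)
      then show ?thesis by (simp add: \<Psi>_def)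
    qed
    show "\<Psi> g = 0" if g: "\<And>k. 0 \<le> k \<Longrightarrow> k \<le> int V \<Longrightarrow> zcoeff k g = 0" for g
    proof -
      have "zge 0 (zpos g * R)"
        by (rule zge_mult[OF zge_zpos_high[OF g] zge_R]) (use V in auto)
      then show ?thesis by (simp add: \<Psi>_def zneg_eq_0)
    qed
  qed
  also have "{..V} = insert 0 {1..V}" by auto
  finally have "\<Psi> g - zcoeff 0 g * \<Psi> 1 = (\<Sum>k=1..V. zcoeff (int k) g * \<Psi> (zpow (int k)))"
    by simp
  moreover have "\<Psi> 1 = Y"
    by (simp add: \<Psi>_def Y_def zpos_eq[OF zge_1] zneg_eq[OF zle_R])
  moreover have "\<Psi> (zpow (int k)) = zcoeff (-1) (X * K * Dx' k R)" if "k > 0" for k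
    using that by (simp add: \<Psi>_def z Dx_R)
  ultimately show ?thesis by (simp add: \<Psi>_def)
qed

text \<open>Shifted back by z^(-k), the derivative of \<open>R\<close> keeps the terms z^j with j <
  -k. Over all \<open>k \<ge> 1\<close> each z^j thus occurs -j-1 times, and -j is its eigenvalue
  under \<open>zeuler\<close>.\<close>

lemma sum_Dx_R:
  assumes V: "s + t \<le> V"
  shows "(\<Sum>k=1..V. zcoeff (int k) (h * Dx' k R)) = zcoeff 0 (h * (zeuler R - R))"
proof -
  have "(\<Sum>k=1..V. zpow (- int k) * Dx' k R) = zeuler R - R"
  proof (rule two_var_eqI)
    fix j
    have "zcoeff j (\<Sum>k=1..V. zpow (- int k) * Dx' k R) = (\<Sum>k=1..V. if int k < - j then zcoeff j R else 0)"
      unfolding zcoeff_sum by (rule sum.cong) (auto simp: Dx_R zcoeff_zneg)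
    also have "\<dots> = (\<Sum>k\<in>{k\<in>{1..V}. int k < - j}. zcoeff j R)"
      by (rule sum.inter_filter[symmetric]) simp
    also have "\<dots> = zcoeff j (zeuler R - R)"
    proof (cases "- int t - 1 \<le> j \<and> j \<le> -1")
      case True
      then have "{k\<in>{1..V}. int k < - j} = {1..<nat (- j)}" using V by auto
      then have "card {k\<in>{1..V}. int k < - j} = nat (- j) - 1" by simp
      moreover have "of_nat (nat (- j) - 1) = (of_int (- j) - 1 :: fock_var mps fps)"
      proof -
        have "int (nat (- j) - 1) = - j - 1" using True by linarith
        then show ?thesis by (metis of_int_diff of_int_of_nat_eq of_int_1)
      qed
      moreover have "zcoeff j (zeuler R - R) = (of_int (- j) - 1) * zcoeff j R"
        by (simp only: zcoeff_diff zcoeff_zeuler left_diff_distrib mult_1)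
      ultimately show ?thesis by (simp only: sum_constant)
    next
      case False
      then show ?thesis by (auto simp: zcoeff_zeuler E_low_nth)
    qed
    finally show "zcoeff j (\<Sum>k=1..V. zpow (- int k) * Dx' k R) = zcoeff j (zeuler R - R)" .
  qed
  then have "zcoeff 0 (h * (zeuler R - R)) = (\<Sum>k=1..V. zcoeff 0 (h * (zpow (- int k) * Dx' k R)))"
    by (metis (no_types) sum_distrib_left zcoeff_sum)
  also have "\<dots> = (\<Sum>k=1..V. zcoeff (int k) (h * Dx' k R))"
    by (rule sum.cong) (auto simp: mult.left_commute[of h "zpow (- int k)" for k])
  finally show ?thesis ..
qed

section \<open>The identity behind the action of \<open>phi_star\<close>\<close>

abbreviation "g \<equiv> H * K"

lemma g_mult: "g * (1 + y) = H"
  by (simp only: mult.assoc K_eq mult_1_right)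

lemma cancel_1y: "f * (1 + y) = h * (1 + y) \<Longrightarrow> f = h"
proof -
  assume "f * (1 + y) = h * (1 + y)"
  then have "f * (1 + y) * K = h * (1 + y) * K" by simp
  moreover have "f * (1 + y) * K = f" for f
    using K_eq by (simp only: mult.assoc mult.commute[of "1 + y"] mult_1_right)
  ultimately show ?thesis by simp
qed

lemma zpos_mult_R: "zpos (f * R) = zpos (zpos f * R)"
proof -
  have "f * R = zneg f * R + zpos f * R"
    by (metis distrib_right zneg_zpos_cases)
  moreover have "zpos (zneg f * R) = 0"
    by (rule zpos_eq_0, rule zle_mult[OF zle_zneg zle_R]) simp
  ultimately show ?thesis by (simp add: zpos_add)
qed

lemma mult_y: "f * y = emb q * (f * R)"
  by (simp only: y_def mult_ac)

text \<open>Multiply by \<open>1 + y\<close> and compare parts of negative and nonnegative exponents in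
  \<open>H = g (1 + y)\<close>.\<close>

lemma key_identity: "g + emb q * (K * zneg (zpos g * R)) = R * K + zpos g"
proof (rule cancel_1y)
  have "H = R + zpos H"
    using zneg_zpos_cases[of H] by (simp add: R_eq)
  also have "zpos H = zpos (g + g * y)"
    using g_mult by (simp add: distrib_left)
  also have "\<dots> = zpos g + emb q * zpos (zpos g * R)"
    by (simp add: zpos_add mult_y zpos_emb_mult zpos_mult_R[of g])
  finally have H: "H = R + (zpos g + emb q * zpos (zpos g * R))" .
  have "(g + emb q * (K * zneg (zpos g * R))) * (1 + y) =
      g * (1 + y) + emb q * zneg (zpos g * R) * (K * (1 + y))"
  proof -
    have "(f + e * (k * z)) * u = f * u + e * z * (k * u)" for f e k z u :: "fock_var mps fls fps"
      by (simp add: algebra_simps)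
    then show ?thesis .
  qed
  also have "\<dots> = R + zpos g + emb q * (zneg (zpos g * R) + zpos (zpos g * R))"
    unfolding g_mult K_eq by (subst H) (simp add: algebra_simps)
  also have "\<dots> = R * (K * (1 + y)) + zpos g + zpos g * y"
    by (simp only: mult_y zneg_zpos_cases[symmetric] K_eq mult_1_right)
  also have "\<dots> = (R * K + zpos g) * (1 + y)"
    by (simp only: distrib_left distrib_right mult_1_left mult_1_right add_ac mult_ac)
  finally show "(g + emb q * (K * zneg (zpos g * R))) * (1 + y) = (R * K + zpos g) * (1 + y)" .
qed

text \<open>The residue of \<open>key_identity\<close> against \<open>X\<close>; the term
  \<open>zpos g\<close> gives none, as \<open>X\<close> has no negative exponents.\<close>

lemma residue_key: "zcoeff (-1) (X * g) + q * zcoeff (-1) (X * K * zneg (zpos g * R)) = Y"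
proof -
  have "zge 0 (X * zpos g)"
    by (rule zge_mult[OF zge_X zge_zpos]) simp
  then have "zcoeff (-1) (X * zpos g) = 0"
    by (rule zgeD) simp
  moreover have "X * (g + emb q * (K * zneg (zpos g * R))) =
      X * g + emb q * (X * K * zneg (zpos g * R))"
    by (simp only: distrib_left mult_ac)
  moreover have "X * (R * K + zpos g) = X * K * R + X * zpos g"
    by (simp only: distrib_left mult_ac)
  ultimately show ?thesis
    using arg_cong[OF key_identity, of "\<lambda>h. zcoeff (-1) (X * h)"] by (simp add: Y_def)
qed

text \<open>\<open>EM * H\<close> is the single power z^(-t-1), which has no coefficient at s-1, so
  the coefficient from \<open>R\<close> returns with the opposite sign.\<close>

lemma zcoeff_EM_zpos_H: "zcoeff (int s - 1) (EM * zpos H) = - fps_const A"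
proof -
  have "EM * zpos H = EM * H - EM * R"
    by (simp add: R_eq zneg_def algebra_simps)
  then have "zcoeff (int s - 1) (EM * zpos H) = zcoeff (int s - 1) (EM * H) - zcoeff (int s - 1) (EM * R)"
    by (simp only: zcoeff_diff)
  then show ?thesis
    using s by (simp only: EM_H fps_const_A[symmetric] zcoeff_zpow) simp
qed

text \<open>The coefficients containing \<open>g * R\<close> and \<open>zeuler R\<close> occur twice
  with opposite signs, and the terms with z^0-coefficients cancel since
  \<open>q = \<tau> * fps_const B * C\<close>. The rest is Y + \<tau> A C Y, which is C Y by
  \<open>C_eq'\<close>.\<close>

lemma star_bracket:
  "zcoeff (-1) (X * g) + (\<tau> * C * - zcoeff (int s - 1) (EM * zpos (g * R)) + zcoeff 0 (g * \<Lambda>)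
    + - (\<tau> * C * (zcoeff (int s - 1) (EM * zpos (g * (1 + y))) - zcoeff 0 g * fps_const B)) * Y
    + q * (zcoeff (-1) (X * K * zneg (zpos g * R)) - zcoeff 0 g * Y)
    - - (\<tau> * C * (zcoeff (int s - 1) (EM * zpos (g * K * R * (1 + y))) - zcoeff 0 (g * K * R) * fps_const B))
    - q * zcoeff 0 (g * K * (zeuler R - R))) = C * Y"
proof -
  \<comment> \<open>Here \<open>al\<close> and \<open>be\<close> stand for \<open>A\<close> and
    \<open>B\<close>, \<open>w\<close> for the coefficient with \<open>g * R\<close>,
    \<open>e\<close> for that with \<open>zeuler R\<close>, and \<open>g0\<close>, \<open>r0\<close>
    for the z^0-coefficients of \<open>g\<close> and \<open>g * K * R\<close>.\<close>
  have ident: "p1 + (u * c * - w + qq * e + - (u * c * (- al - g0 * be)) * yy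
     + qq * (p2 - g0 * yy) - - (u * c * (w - r0 * be)) - qq * (e - r0)) = c * yy"
    if "p1 + qq * p2 = yy" "qq = u * be * c" "c = 1 + u * al * c"
    for p1 p2 qq u c w e al be yy g0 r0 :: "fock_var mps fps"
  proof -
    have "p1 + (u * c * - w + qq * e + - (u * c * (- al - g0 * be)) * yy
       + qq * (p2 - g0 * yy) - - (u * c * (w - r0 * be)) - qq * (e - r0)) =
      (p1 + qq * p2) + u * al * c * yy + (g0 * yy - r0) * (u * be * c - qq)"
      by (simp add: algebra_simps)
    also have "\<dots> = (1 + u * al * c) * yy"
      by (simp add: that(1) that(2)[symmetric] distrib_right)
    finally show ?thesis using that(3) by simp
  qed
  have "g * K * R * (1 + y) = g * R * (K * (1 + y))"
    by (simp only: mult_ac)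
  then have 1: "g * K * R * (1 + y) = g * R" by (simp only: K_eq mult_1_right)
  have "g * \<Lambda> = emb q * (g * K * zeuler R)"
    by (simp only: \<Lambda>_def zeuler_y mult_ac)
  then have 2: "zcoeff 0 (g * \<Lambda>) = q * zcoeff 0 (g * K * zeuler R)"
    by simp
  have 3: "zcoeff 0 (g * K * (zeuler R - R)) = zcoeff 0 (g * K * zeuler R) - zcoeff 0 (g * K * R)"
    by (simp only: right_diff_distrib zcoeff_diff)
  show ?thesis
    unfolding 1 2 3 g_mult zcoeff_EM_zpos_H
    by (rule ident[OF residue_key q_def C_eq'])
qed

text \<open>The sum is the contribution of the derivatives \<open>dx_k\<close> in the current. It is cut off since only
  finitely many of them act nontrivially on a component of fixed weight; the logarithmic
  derivative \<open>\<Lambda>\<close> is the one term whose cut-off depends on the weight.\<close>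

lemma star_identity:
  "\<exists>V0. \<forall>V\<ge>V0. (zcoeff (-1) (X * g * emb F) + (\<Sum>k=1..V. zcoeff (int k) (H * Dx' k (K * emb F)))) $ n
    = (F * C * Y) $ n"
proof -
  obtain V0 where V0: "\<forall>V\<ge>V0. \<forall>m\<le>n.
      (\<Sum>k=1..V. zcoeff (int k) g * zcoeff (- int k) \<Lambda>) $ m = zcoeff 0 (g * \<Lambda>) $ m"
    using zcoeff_mult_zle_nth[where g = g and n = n, OF zle_\<Lambda>] by (elim exE) (rule that)
  show ?thesis
  proof (intro exI[of _ "max V0 (s + t)"] allI impI)
    fix V assume "max V0 (s + t) \<le> V"
    then have V: "V0 \<le> V" "s + t \<le> V" by auto
    define S where "S = (\<Sum>k=1..V. zcoeff (int k) g * zcoeff (- int k) \<Lambda>)"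
    have summand: "zcoeff (int k) (H * Dx' k (K * emb F)) =
        F * (\<tau> * C * (zcoeff (int k) g * dx' k (fps_const A)) + zcoeff (int k) g * zcoeff (- int k) \<Lambda>
          + zcoeff (int k) g * dx' k q * Y + q * (zcoeff (int k) g * zcoeff (-1) (X * K * Dx' k R))
          - zcoeff (int k) (g * K * R) * dx' k q - q * zcoeff (int k) (g * K * Dx' k R))"
      if "k \<in> {1..V}" for k
    proof -
      from that have k: "k > 0" by simp
      have "Dx' k (K * emb F) = K * emb (dx' k F) - K * K * Dx' k y * emb F"
        by (simp add: derivation_mult[OF derivation_Dx] derivation_K[OF derivation_Dx]
            lift2_emb[OF derivation_deriv_x] algebra_simps)
      moreover have "Dx' k y = emb (dx' k q) * R + emb q * Dx' k R"
        by (simp add: y_def derivation_mult[OF derivation_Dx] lift2_emb[OF derivation_deriv_x])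
      ultimately have "H * Dx' k (K * emb F) = H * (K * emb (dx' k F)
          - K * K * (emb (dx' k q) * R + emb q * Dx' k R) * emb F)"
        by simp
      also have "\<dots> = emb (dx' k F) * g - emb F * (emb (dx' k q) * (g * K * R) + emb q * (g * K * Dx' k R))"
        by (simp only: right_diff_distrib distrib_left distrib_right mult_ac)
      finally have "zcoeff (int k) (H * Dx' k (K * emb F)) = dx' k F * zcoeff (int k) g
          - F * (dx' k q * zcoeff (int k) (g * K * R) + q * zcoeff (int k) (g * K * Dx' k R))"
        by (simp only: zcoeff_diff zcoeff_add zcoeff_emb_mult)
      then show ?thesis
        unfolding dx_F[OF k] by (simp only: right_diff_distrib distrib_left distrib_right mult_ac
            diff_diff_add add_ac)
    qed
    have "(\<Sum>k=1..V. zcoeff (int k) (H * Dx' k (K * emb F))) =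
        F * (\<tau> * C * (\<Sum>k=1..V. zcoeff (int k) g * dx' k (fps_const A)) + S
          + (\<Sum>k=1..V. zcoeff (int k) g * dx' k q) * Y
          + q * (\<Sum>k=1..V. zcoeff (int k) g * zcoeff (-1) (X * K * Dx' k R))
          - (\<Sum>k=1..V. zcoeff (int k) (g * K * R) * dx' k q)
          - q * (\<Sum>k=1..V. zcoeff (int k) (g * K * Dx' k R)))"
      unfolding S_def sum_distrib_left[symmetric] sum_distrib_right[symmetric]
      by (simp only: sum.cong[OF refl summand] sum_distrib_left[symmetric] sum_distrib_right[symmetric]
          sum.distrib sum_subtractf)
    moreover have "zcoeff (-1) (X * g * emb F) = F * zcoeff (-1) (X * g)"
      by (simp add: mult.commute[of _ "emb F"])
    ultimately have total: "zcoeff (-1) (X * g * emb F) + (\<Sum>k=1..V. zcoeff (int k) (H * Dx' k (K * emb F))) =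
      F * (zcoeff (-1) (X * g) + (\<tau> * C * - zcoeff (int s - 1) (EM * zpos (g * R)) + S
    + - (\<tau> * C * (zcoeff (int s - 1) (EM * zpos (g * (1 + y))) - zcoeff 0 g * fps_const B)) * Y
    + q * (zcoeff (-1) (X * K * zneg (zpos g * R)) - zcoeff 0 g * Y)
    - - (\<tau> * C * (zcoeff (int s - 1) (EM * zpos (g * K * R * (1 + y))) - zcoeff 0 (g * K * R) * fps_const B))
    - q * zcoeff 0 (g * K * (zeuler R - R))))"
      unfolding sum_dx_A[OF V(2)] sum_dx_q[OF V(2)] sum_Dx_R_residue[OF V(2)] sum_Dx_R[OF V(2)]
      by (simp only: distrib_left)
    show "(zcoeff (-1) (X * g * emb F) + (\<Sum>k=1..V. zcoeff (int k) (H * Dx' k (K * emb F)))) $ n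
      = (F * C * Y) $ n"
      unfolding total mult.assoc[of F C Y]
    \<comment> \<open>\<open>S\<close> equals its limit only up to outer exponent \<open>n\<close>,
      which suffices because coefficient \<open>n\<close> of a product involves no later
      ones.\<close>
    proof (rule fps_mult_cong_upto)
      fix i assume "i \<le> n"
      then have "S $ i = zcoeff 0 (g * \<Lambda>) $ i" unfolding S_def by (rule V0[rule_format, OF V(1)])
      then show "(zcoeff (-1) (X * g) + (\<tau> * C * - zcoeff (int s - 1) (EM * zpos (g * R)) + S
    + - (\<tau> * C * (zcoeff (int s - 1) (EM * zpos (g * (1 + y))) - zcoeff 0 g * fps_const B)) * Y
    + q * (zcoeff (-1) (X * K * zneg (zpos g * R)) - zcoeff 0 g * Y)
    - - (\<tau> * C * (zcoeff (int s - 1) (EM * zpos (g * K * R * (1 + y))) - zcoeff 0 (g * K * R) * fps_const B))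
    - q * zcoeff 0 (g * K * (zeuler R - R)))) $ i = (C * Y) $ i"
        unfolding star_bracket[symmetric] fps_add_nth fps_sub_nth by (simp only:)
    qed simp
  qed
qed

text \<open>The coefficient at s-1 is B + q A for \<open>EM * (1 + y)\<close> and A for
  \<open>EM * R\<close>; by the definition of \<open>q\<close>, B + q A is B C.\<close>

lemma residue_minus: "zcoeff (int s - 1) (EM * (emb (F * C) * (emb Y * (1 + y) + R))) =
  F * C * (fps_const A + fps_const B * C * Y)"
proof -
  have "EM * (emb (F * C) * (emb Y * (1 + y) + R)) =
      emb (F * C) * (emb Y * (EM + emb q * (EM * R)) + EM * R)"
    by (simp only: y_def distrib_left distrib_right mult_1_right mult_1_left mult_ac)
  then have "zcoeff (int s - 1) (EM * (emb (F * C) * (emb Y * (1 + y) + R))) =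
      F * C * (Y * (fps_const B + q * fps_const A) + fps_const A)"
    by (simp only: zcoeff_emb_mult zcoeff_add fps_const_A fps_const_B)
  also have "fps_const B + q * fps_const A = fps_const B * (1 + \<tau> * fps_const A * C)"
    by (simp add: q_def algebra_simps)
  also have "\<dots> = fps_const B * C" by (simp only: C_eq'[symmetric])
  finally show ?thesis by (simp only: mult_ac add_ac)
qed

section \<open>The exponential factors acting on \<open>F\<close> and on
  \<open>F * C * Y\<close>\<close>

lemma zeuler_shift_plus: "zeuler (K * emb F) = - (\<Lambda> * (K * emb F))"
  by (simp add: derivation_mult[OF derivation_zeuler] derivation_K[OF derivation_zeuler] \<Lambda>_def mult_ac)

lemma zeuler_1y: "zeuler (1 + y) = \<Lambda> * (1 + y)"
proof -
  have "\<Lambda> * (1 + y) = zeuler y * (K * (1 + y))" by (simp only: \<Lambda>_def mult_ac)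
  then show ?thesis
    by (simp only: K_eq) (simp add: derivation_simps[OF derivation_zeuler])
qed

lemma zeuler_shift_minus:
  "zeuler (emb (F * C) * (emb Y * (1 + y) + R)) =
    emb (F * C) * (emb Y * (1 + y) + R) * \<Lambda> + emb (F * C) * (1 + y) * zeuler (K * R)"
proof -
  have "(1 + y) * (emb Y + K * R) = emb Y * (1 + y) + (K * (1 + y)) * R"
    by (simp only: distrib_left[of "1 + y"] mult_ac)
  then have eq: "emb Y * (1 + y) + R = (1 + y) * (emb Y + K * R)"
    by (simp only: K_eq mult_1_left)
  have ident: "f * (u * l * v + u * k') = f * (u * v) * l + f * u * k'" for f u l v k' :: "fock_var mps fls fps"
    by (simp add: algebra_simps)
  have "zeuler (emb (F * C) * ((1 + y) * (emb Y + K * R))) =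
      emb (F * C) * ((1 + y) * \<Lambda> * (emb Y + K * R) + (1 + y) * zeuler (K * R))"
    by (simp only: derivation_mult[OF derivation_zeuler, of "emb (F * C)"] zeuler_emb
        derivation_mult[OF derivation_zeuler, of "1 + y"] derivation_add[OF derivation_zeuler, of "emb Y"]
        zeuler_1y mult_zero_left add_0 mult.commute[of \<Lambda>])
  then show ?thesis
    unfolding eq ident .
qed

text \<open>The exponential factors replace x_n by x_n - z^(-n)/n in \<open>phi_star\<close> and by
  x_n + z^(-n)/n in \<open>phi\<close>, with x + y fixed. The residue of \<open>X\<close> against a
  series h with negative exponents only then changes by -h(z) or +h(z). So \<open>ell\<close>
  becomes \<open>ell - L\<close> or \<open>ell + L\<close>, which multiplies \<open>F\<close> by
  \<open>K\<close> or \<open>1 + y\<close>, and \<open>Y\<close> becomes \<open>Y + K * R\<close> in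
  the second case.\<close>

abbreviation "M_plus \<equiv> K * emb F"
abbreviation "M_minus \<equiv> emb (F * C) * (emb Y * (1 + y) + R)"
abbreviation "Z \<equiv> F * C * (fps_const A + fps_const B * C * Y)"

lemma zcoeff_0_K: "zcoeff 0 K = 1"
proof -
  have "zle (-1) (K * y)" by (rule zle_mult[OF zle_K zle_y]) simp
  then have "zcoeff 0 (K * y) = 0" by (rule zleD) simp
  moreover have "K = 1 - K * y" using K_eq by (simp add: algebra_simps)
  ultimately show ?thesis by (metis diff_zero zcoeff_1 zcoeff_diff)
qed

lemma zle_M_plus: "zle 0 M_plus"
  using zle_emb_mult[OF zle_K, of F] by (simp only: mult.commute[of K])

lemma zle_1y: "zle 0 (1 + y)"
  using zle_y by (intro zle_add zle_1) (rule zle_mono, auto)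

lemma zle_M_minus: "zle 0 M_minus"
  by (intro zle_emb_mult zle_add zle_1y zle_mono[OF zle_R]) simp

text \<open>Up to sign, \<open>zeuler\<close> multiplies \<open>M_plus\<close> by
  \<open>\<Lambda>\<close> and the derivative in direction \<open>i\<close> multiplies it by the
  coefficient of z^(-i) in \<open>\<Lambda>\<close>. Comparing both gives the recurrence of
  \<open>gen_exp_eqI\<close>.\<close>

lemma gen_exp_F: "gen_exp (- 1) k (F $ n) = zcoeff (- int k) M_plus $ n"
proof (rule gen_exp_eqI)
  show "zcoeff (- int 0) M_plus $ n = F $ n"
    by (simp add: mult.commute[of K] zcoeff_0_K del: zcoeff_nth)
next
  fix k :: nat assume k: "k > 0"
  have D: "Dxy' i M_plus = emb (zcoeff (- int i) \<Lambda>) * M_plus" if "i > 0" for i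
    using that by (simp add: derivation_mult[OF derivation_Dxy] Dxy_K lift2_emb[OF derivation_deriv_xy]
        dxy_F emb_mult mult_ac)
  have "of_nat k * zcoeff (- int k) M_plus = zcoeff (- int k) (zeuler M_plus)"
    by (simp add: zcoeff_zeuler)
  also have "\<dots> = - (\<Sum>i=1..k. zcoeff (- int i) \<Lambda> * zcoeff (- int (k - i)) M_plus)"
    by (simp only: zeuler_shift_plus zcoeff_minus zcoeff_mult_nonpos[OF zle_\<Lambda> zle_M_plus])
  also have "\<dots> = - (\<Sum>i=1..k. dxy' i (zcoeff (- int (k - i)) M_plus))"
    by (intro arg_cong[where f = uminus] sum.cong)
      (auto simp: D zcoeff_lift2[OF derivation_deriv_xy, symmetric])
  finally have "(of_nat k * zcoeff (- int k) M_plus) $ n = - (\<Sum>i=1..k. dxy' i (zcoeff (- int (k - i)) M_plus)) $ n"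
    by simp
  then show "of_nat k * zcoeff (- int k) M_plus $ n =
      (\<Sum>i=1..k. mps_const (- 1) * deriv_xy i (zcoeff (- int (k - i)) M_plus $ n))"
    by (simp add: fps_sum_nth mps_const_minus sum_negf flip: fps_of_nat)
qed

text \<open>As for \<open>F\<close>, with an inhomogeneous term: \<open>Y\<close> contains
  \<open>X\<close> once more, and its derivatives are coefficients of
  \<open>zeuler (K * R)\<close>.\<close>

lemma gen_exp_FCY: "gen_exp 1 k ((F * C * Y) $ n) = zcoeff (- int k) M_minus $ n"
proof (rule gen_exp_eqI)
  have "zcoeff 0 (1 + y) = 1" "zcoeff 0 R = 0"
    using zleD[OF zle_y, of 0] zleD[OF zle_R, of 0] by simp_all
  then show "zcoeff (- int 0) M_minus $ n = (F * C * Y) $ n"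
    by (simp del: zcoeff_nth zcoeff_const add: distrib_left zcoeff_emb)
next
  fix k :: nat assume k: "k > 0"
  have D: "Dxy' i M_minus = emb (zcoeff (- int i) \<Lambda>) * M_minus
      + emb (zcoeff (- int i) (zeuler (K * R))) * (emb (F * C) * (1 + y))" if "i > 0" for i
  proof -
    have "dxy' i (F * C) = zcoeff (- int i) \<Lambda> * (F * C)"
      using that by (simp add: derivation_mult[OF derivation_dxy] dxy_F Dxy_const)
    moreover have "Dxy' i (1 + y) = 0"
      using that by (simp add: derivation_simps[OF derivation_Dxy] Dxy_y)
    moreover have "Dxy' i R = 0" "dxy' i Y = zcoeff (- int i) (zeuler (K * R))"
      using that by (simp_all add: Dxy_const dxy_Y)
    ultimately have "Dxy' i M_minus = emb (zcoeff (- int i) \<Lambda>) * emb (F * C) * (emb Y * (1 + y) + R)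
        + emb (F * C) * (emb (zcoeff (- int i) (zeuler (K * R))) * (1 + y))"
      by (simp only: derivation_mult[OF derivation_Dxy, where x = "emb f" for f]
          derivation_add[OF derivation_Dxy, where y = R] lift2_emb[OF derivation_deriv_xy]
          mult_zero_right add_0_right emb_mult[of "zcoeff (- int i) \<Lambda>" "F * C"])
    then show ?thesis
      by (simp only: mult_ac)
  qed
  have "zle (-1) (zeuler (K * R))"
  proof -
    have "zle (-1) (K * R)" by (rule zle_mult[OF zle_K zle_R]) simp
    then show ?thesis by (auto simp: zle_def zcoeff_zeuler)
  qed
  note split = zcoeff_mult_nonpos[OF zle_\<Lambda> zle_M_minus]
    zcoeff_mult_nonpos[OF this zle_emb_mult[OF zle_1y]]
  have "zeuler M_minus = \<Lambda> * M_minus + zeuler (K * R) * (emb (F * C) * (1 + y))"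
    by (rule trans[OF zeuler_shift_minus]) (simp only: mult_ac)
  have "of_nat k * zcoeff (- int k) M_minus = zcoeff (- int k) (zeuler M_minus)"
    by (simp add: zcoeff_zeuler)
  also have "\<dots> = (\<Sum>i=1..k. zcoeff (- int i) \<Lambda> * zcoeff (- int (k - i)) M_minus
      + zcoeff (- int i) (zeuler (K * R)) * zcoeff (- int (k - i)) (emb (F * C) * (1 + y)))"
    by (simp only: \<open>zeuler M_minus = _\<close> zcoeff_add split sum.distrib)
  also have "\<dots> = (\<Sum>i=1..k. dxy' i (zcoeff (- int (k - i)) M_minus))"
  proof (rule sum.cong)
    fix i assume "i \<in> {1..k}"
    then have "i > 0" by simp
    show "zcoeff (- int i) \<Lambda> * zcoeff (- int (k - i)) M_minus
      + zcoeff (- int i) (zeuler (K * R)) * zcoeff (- int (k - i)) (emb (F * C) * (1 + y))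
      = dxy' i (zcoeff (- int (k - i)) M_minus)"
      unfolding zcoeff_lift2[OF derivation_deriv_xy, symmetric] D[OF \<open>i > 0\<close>]
      by (simp only: zcoeff_add[of _ "emb _ * M_minus"] zcoeff_emb_mult[of _ "zcoeff (- int i) \<Lambda>"]
          zcoeff_emb_mult[of _ "zcoeff (- int i) (zeuler (K * R))"])
  qed simp
  finally have "(of_nat k * zcoeff (- int k) M_minus) $ n = (\<Sum>i=1..k. dxy' i (zcoeff (- int (k - i)) M_minus)) $ n"
    by simp
  then show "of_nat k * zcoeff (- int k) M_minus $ n =
      (\<Sum>i=1..k. mps_const 1 * deriv_xy i (zcoeff (- int (k - i)) M_minus $ n))"
    by (simp add: fps_sum_nth flip: fps_of_nat)
qed

section \<open>Evaluation of both fields\<close>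

lemma two_var_window:
  assumes "zle 0 M" "\<And>k. k > V \<Longrightarrow> M $ n $$ (- int k) = 0" "\<And>i. i < 0 \<Longrightarrow> f $$ i = 0"
  shows "zcoeff m (fps_const f * M) $ n = (\<Sum>k\<le>V. f $$ (m + int k) * zcoeff (- int k) M $ n)"
proof -
  have "M $ n $$ i = 0" if "i > 0" for i
    using zleD[OF assms(1) that] by (metis zcoeff_nth fps_zero_nth)
  moreover have "M $ n $$ i = 0" if "i < - int V" for i
    using assms(2)[of "nat (- i)"] that by simp
  ultimately show ?thesis
    using fls_mult_nth_window[of f "M $ n" V m] assms(3) by simp
qed

lemma phi_FCY:
  "phi (- int s) (single_charge 1 (mps_const c * (F * C * Y) $ n)) = single_charge 0 (mps_const c * Z $ n)"
proof -
  obtain V where V: "\<forall>k>V. M_minus $ n $$ (- int k) = 0" by (rule fls_nth_vanishes_below_natE)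
  have "phi (- int s) (single_charge 1 (mps_const c * (F * C * Y) $ n)) =
    single_charge (1 - 1) (\<Sum>k\<le>V. S_minus (s - 1 + k) * gen_exp 1 k (mps_const c * (F * C * Y) $ n))"
    by (rule phi_single_charge[OF s])
      (simp only: gen_exp_const_mult gen_exp_FCY zcoeff_nth V[rule_format] mult_zero_right)
  also have "(\<Sum>k\<le>V. S_minus (s - 1 + k) * gen_exp 1 k (mps_const c * (F * C * Y) $ n)) =
      mps_const c * (\<Sum>k\<le>V. S_minus (s - 1 + k) * zcoeff (- int k) M_minus $ n)"
    unfolding sum_distrib_left gen_exp_const_mult gen_exp_FCY by (simp only: mult.left_commute)
  also have "(\<Sum>k\<le>V. S_minus (s - 1 + k) * zcoeff (- int k) M_minus $ n) =
      zcoeff (int s - 1) (EM * M_minus) $ n"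
  proof (subst two_var_window[OF zle_M_minus, of V])
    have "E_minus $$ (int s - 1 + int k) = S_minus (s - 1 + k)" for k
    proof -
      have "nat (int s - 1 + int k) = s - 1 + k" using s by simp
      then show ?thesis using s by (simp add: E_minus_nth)
    qed
    then show "(\<Sum>k\<le>V. S_minus (s - 1 + k) * zcoeff (- int k) M_minus $ n) =
        (\<Sum>k\<le>V. E_minus $$ (int s - 1 + int k) * zcoeff (- int k) M_minus $ n)" by simp
  qed (use V in \<open>auto simp: E_minus_nth\<close>)
  finally show ?thesis unfolding residue_minus by simp
qed

lemma E_plus_x_field_nth:
  assumes "p \<ge> 0"
  shows "(E_plus * x_field) $$ p = (\<Sum>j=0..p. S_plus (nat (p - j)) * x_field $$ j)"
proof -
  have "(x_field * E_plus) $$ p = (\<Sum>j=0..p. x_field $$ j * E_plus $$ (p - j))"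
    by (rule fls_times_nth_range) (auto simp: x_field_nth E_plus_nth)
  also have "\<dots> = (\<Sum>j=0..p. S_plus (nat (p - j)) * x_field $$ j)"
    by (rule sum.cong) (auto simp: E_plus_nth mult.commute)
  finally show ?thesis by (simp only: mult.commute)
qed

text \<open>The term j = -1 is zero on charge 0. The indices j >= 0 form a coefficient of E(z) X(z),
  and j = -l-1 gives the derivative by x_l.\<close>

lemma current_sum_split:
  assumes "p \<ge> 0"
  shows "(\<Sum>j=-int N-1..p. S_plus (nat (p - j)) * current0 j f) =
    (E_plus * x_field) $$ p * f + (\<Sum>l=1..N. E_plus $$ (p + int l + 1) * deriv_x l f)"
proof -
  have "{-int N-1..p} = {-int N-1..-2} \<union> ({-1} \<union> {0..p})" using assms by auto
  then have "(\<Sum>j=-int N-1..p. S_plus (nat (p - j)) * current0 j f) =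
      (\<Sum>j=-int N-1..-2. S_plus (nat (p - j)) * current0 j f) + (\<Sum>j=0..p. S_plus (nat (p - j)) * current0 j f)"
    by (simp only:) (subst sum.union_disjoint, auto simp: current0_def)
  also have "(\<Sum>j=0..p. S_plus (nat (p - j)) * current0 j f) = (E_plus * x_field) $$ p * f"
    unfolding E_plus_x_field_nth[OF assms] sum_distrib_right
    by (rule sum.cong) (auto simp: current0_def x_field_nth mult.assoc)
  also have "(\<Sum>j=-int N-1..-2. S_plus (nat (p - j)) * current0 j f) =
      (\<Sum>l=1..N. E_plus $$ (p + int l + 1) * deriv_x l f)"
  proof (rule sum.reindex_bij_witness[of _ "\<lambda>l. - int l - 1" "\<lambda>j. nat (- j - 1)"])
    fix j assume j: "j \<in> {-int N-1..-2}"
    then have "p + int (nat (- j - 1)) + 1 = p - j" by auto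
    with j assms show "E_plus $$ (p + int (nat (- j - 1)) + 1) * deriv_x (nat (- j - 1)) f =
        S_plus (nat (p - j)) * current0 j f"
      by (auto simp: current0_def E_plus_nth)
  qed auto
  finally show ?thesis by (simp only: add.commute)
qed

lemma homogeneous_deriv_x_eq_0: "homogeneous n f \<Longrightarrow> n < l \<Longrightarrow> deriv_x l f = 0"
  unfolding deriv_x_def by (rule mps_deriv_homogeneous_eq_0) auto

text \<open>A homogeneous series of weight below \<open>l\<close> contains no x_l. The weights
  occurring in \<open>A\<close>, \<open>B\<close> and \<open>R\<close> are at most s + t, those of
  \<open>F\<close> up to outer exponent \<open>n\<close> at most \<open>n\<close>.\<close>

lemma Dx_M_plus_nth_eq_0:
  assumes F: "\<And>i. homogeneous i (F $ i)" and l: "l > n" "l > s + t"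
  shows "Dx' l M_plus $ n = 0"
proof -
  note d = derivation_deriv_x[of l]
  have A: "dx' l (fps_const A) = 0"
    by (rule fps_ext) (auto simp: derivation_zero[OF d] homogeneous_deriv_x_eq_0[OF homogeneous_A] l)
  have B: "dx' l (fps_const B) = 0"
    using l by (intro fps_ext) (auto simp: derivation_zero[OF d] homogeneous_deriv_x_eq_0[OF homogeneous_B])
  have "dx' l q = 0"
    using derivation_q[OF derivation_dx fps_map_\<tau>[OF d]] A B by simp
  moreover have "Dx' l R = 0"
    using l by (intro two_var_eqI fps_ext)
      (auto simp: zcoeff_lift2[OF d] E_low_nth derivation_zero[OF d] homogeneous_deriv_x_eq_0[OF homogeneous_S_plus])
  ultimately have "Dx' l y = 0"
    by (simp add: y_def derivation_mult[OF derivation_Dx] lift2_emb[OF d])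
  then have "Dx' l M_plus = K * emb (dx' l F)"
    by (simp add: derivation_mult[OF derivation_Dx] derivation_K[OF derivation_Dx] lift2_emb[OF d])
  then show ?thesis
    using l by (simp add: fps_mult_nth homogeneous_deriv_x_eq_0[OF F])
qed

lemma phi_star_F:
  assumes F: "\<And>i. homogeneous i (F $ i)"
  shows "phi_star (- int t) (single_charge 0 (mps_const c * F $ n)) =
    single_charge 1 (mps_const c * (F * C * Y) $ n)"
proof -
  note d = derivation_deriv_x
  obtain V where V: "\<forall>k>V. M_plus $ n $$ (- int k) = 0" by (rule fls_nth_vanishes_below_natE)
  obtain N0 where N0: "\<forall>N\<ge>N0. (zcoeff (-1) (X * g * emb F) +
      (\<Sum>k=1..N. zcoeff (int k) (H * Dx' k M_plus))) $ n = (F * C * Y) $ n"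
    using star_identity[of n] by blast
  \<comment> \<open>Large enough for \<open>star_identity\<close> and for all derivatives by x_l
    with \<open>l > N\<close> to vanish at outer exponent \<open>n\<close>.\<close>
  define N where "N = N0 + n + s + t"
  let ?e = "\<lambda>k. zcoeff (- int k) M_plus $ n"
  have e: "gen_exp (- 1) k (mps_const c * F $ n) = mps_const c * ?e k" for k
    by (simp only: gen_exp_const_mult gen_exp_F)
  have De: "zcoeff (- int k) (Dx' l M_plus) $ n = deriv_x l (?e k)" for k l
    by (simp only: zcoeff_lift2[OF d] fps_map_nth)
  have "phi_star (- int t) (single_charge 0 (mps_const c * F $ n)) = single_charge 1
    (\<Sum>k\<le>V. \<Sum>j=-int N-1..int t+int k. S_plus (nat (int t + int k - j)) *
      current0 j (gen_exp (- 1) k (mps_const c * F $ n)))"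
  proof (rule phi_star_single_charge)
    show "gen_exp (- 1) k (mps_const c * F $ n) = 0" if "k > V" for k
      using V that by (simp only: e zcoeff_nth mult_zero_right)
    show "deriv_x l (gen_exp (- 1) k (mps_const c * F $ n)) = 0" if "l > N" for k l
    proof -
      have "Dx' l M_plus $ n = 0"
        by (rule Dx_M_plus_nth_eq_0[OF F]) (use that in \<open>auto simp: N_def\<close>)
      then have "deriv_x l (?e k) = 0" using De[of k l] by (metis zcoeff_nth fls_zero_nth)
      then show ?thesis by (simp only: e derivation_mult[OF d] deriv_x_const) simp
    qed
  qed
  also have "(\<Sum>k\<le>V. \<Sum>j=-int N-1..int t+int k. S_plus (nat (int t + int k - j)) *
      current0 j (gen_exp (- 1) k (mps_const c * F $ n))) = mps_const c *
      (\<Sum>k\<le>V. \<Sum>j=-int N-1..int t+int k. S_plus (nat (int t + int k - j)) * current0 j (?e k))"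
    by (simp only: e current0_const_mult sum_distrib_left mult.left_commute)
  also have "(\<Sum>k\<le>V. \<Sum>j=-int N-1..int t+int k. S_plus (nat (int t + int k - j)) * current0 j (?e k)) =
      (\<Sum>k\<le>V. (E_plus * x_field) $$ (int t + int k) * ?e k) +
      (\<Sum>k\<le>V. \<Sum>l=1..N. E_plus $$ (int t + int k + int l + 1) * deriv_x l (?e k))"
    by (simp add: current_sum_split sum.distrib del: zcoeff_nth)
  also have "(\<Sum>k\<le>V. (E_plus * x_field) $$ (int t + int k) * ?e k) = zcoeff (-1) (X * g * emb F) $ n"
  proof -
    have "X * g * emb F = zpow (- int t - 1) * (fps_const (E_plus * x_field) * M_plus)"
      by (simp only: H_def fps_const_mult[symmetric] mult_ac)
    then have "zcoeff (-1) (X * g * emb F) = zcoeff (int t) (fps_const (E_plus * x_field) * M_plus)"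
      by simp
    moreover have "(E_plus * x_field) $$ i = 0" if "i < 0" for i
      using fls_mult_nth_ge[of 0 E_plus 0 x_field i] that by (simp add: E_plus_nth x_field_nth)
    ultimately show ?thesis
      using two_var_window[OF zle_M_plus, of V n "E_plus * x_field" "int t"] V by simp
  qed
  also have "(\<Sum>k\<le>V. \<Sum>l=1..N. E_plus $$ (int t + int k + int l + 1) * deriv_x l (?e k)) =
      (\<Sum>l=1..N. zcoeff (int l) (H * Dx' l M_plus) $ n)"
  proof (subst sum.swap, rule sum.cong)
    fix l
    have "H * Dx' l M_plus = zpow (- int t - 1) * (EP * Dx' l M_plus)"
      by (simp only: H_def mult.assoc)
    then have "zcoeff (int l) (H * Dx' l M_plus) = zcoeff (int t + int l + 1) (EP * Dx' l M_plus)"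
    proof -
      have "int l - (- int t - 1) = int t + int l + 1" by simp
      then show ?thesis by (simp only: \<open>H * Dx' l M_plus = _\<close> zcoeff_zpow_mult)
    qed
    moreover have "zle 0 (Dx' l M_plus)"
      using zle_M_plus by (auto simp: zle_def zcoeff_lift2[OF d] fps_eq_iff derivation_zero[OF d])
    moreover have "Dx' l M_plus $ n $$ (- int k) = 0" if "k > V" for k
      using De[of k l] V that by (simp only: zcoeff_nth derivation_zero[OF d])
    ultimately have "zcoeff (int l) (H * Dx' l M_plus) $ n =
        (\<Sum>k\<le>V. E_plus $$ (int t + int l + 1 + int k) * deriv_x l (?e k))"
      using two_var_window[of "Dx' l M_plus" V n E_plus "int t + int l + 1"]
      by (simp only: De) (simp add: E_plus_nth)
    then show "(\<Sum>k\<le>V. E_plus $$ (int t + int k + int l + 1) * deriv_x l (?e k)) =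
        zcoeff (int l) (H * Dx' l M_plus) $ n"
      by (simp only: ac_simps)
  qed simp
  also have "zcoeff (-1) (X * g * emb F) $ n + (\<Sum>l=1..N. zcoeff (int l) (H * Dx' l M_plus) $ n) =
      (F * C * Y) $ n"
    using N0[rule_format, of N] by (simp add: N_def fps_sum_nth del: zcoeff_nth)
  finally show ?thesis .
qed

section \<open>\<open>F\<close> as the grading of the closed formula\<close>

lemma E_low_power:
  shows "k > - int n \<Longrightarrow> (E_low ^ n) $$ k = 0"
    and "k < - int (n * (t + 1)) \<Longrightarrow> (E_low ^ n) $$ k = 0"
    and "k \<ge> - int (n * (t + 1)) \<Longrightarrow> homogeneous (nat (k + int (n * (t + 1)))) ((E_low ^ n) $$ k)"
proof -
  have "(k < - int (n * (t + 1)) \<longrightarrow> (E_low ^ n) $$ k = 0) \<and> (k > - int n \<longrightarrow> (E_low ^ n) $$ k = 0) \<and>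
    (k \<ge> - int (n * (t + 1)) \<longrightarrow> homogeneous (nat (k + int (n * (t + 1)))) ((E_low ^ n) $$ k))"
  proof (rule homogeneous_fls_power)
    show "homogeneous (nat (k + int (t + 1))) (E_low $$ k)" if "k \<ge> - int (t + 1)" for k
    proof -
      have "nat (k + int (t + 1)) = nat (k + int t + 1)" by simp
      then show ?thesis using homogeneous_S_plus[of "nat (k + int t + 1)"] by (simp add: E_low_nth)
    qed
  qed (auto simp: E_low_nth)
  then show "k > - int n \<Longrightarrow> (E_low ^ n) $$ k = 0"
    "k < - int (n * (t + 1)) \<Longrightarrow> (E_low ^ n) $$ k = 0"
    "k \<ge> - int (n * (t + 1)) \<Longrightarrow> homogeneous (nat (k + int (n * (t + 1)))) ((E_low ^ n) $$ k)"
    by auto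
qed

lemma f_coeff_E_low: "f_coeff t n i = (E_low ^ n) $$ (- int (n * (t + 1)) + int i)"
  by (simp only: f_coeff_def E_low_def)

text \<open>The residue runs over i < n(t+1), while the definition stops at nt; the terms in between
  vanish because the exponents of the \<open>n\<close>-th power of \<open>R\<close> are at most
  -n.\<close>

lemma p_elem_eq:
  assumes n: "n > 0"
  shows "p_elem t n = (x_field * E_low ^ n) $$ (-1)"
proof -
  define d where "d = n * (t + 1)"
  have f: "f_coeff t n i = (E_low ^ n) $$ (- int d + int i)" for i
    by (simp only: f_coeff_E_low d_def)
  have low: "(E_low ^ n) $$ k = 0" if "k < - int d" for k
    using E_low_power(2) that unfolding d_def .
  have "(E_low ^ n * x_field) $$ (-1) = (\<Sum>j=- int d..-1. (E_low ^ n) $$ j * x_field $$ (-1 - j))"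
    by (rule fls_times_nth_range) (auto intro: low simp: x_field_nth)
  also have "\<dots> = (\<Sum>i<d. f_coeff t n i * of_nat (d - i) * xv (d - i))"
  proof (rule sum.reindex_bij_witness[of _ "\<lambda>i. - int d + int i" "\<lambda>j. nat (j + int d)"])
    fix j assume j: "j \<in> {- int d..-1}"
    define i where "i = nat (j + int d)"
    have i: "i < d" "j = - int d + int i" using j by (auto simp: i_def)
    then have "nat (-1 - j) + 1 = d - i" "-1 - j \<ge> 0" by auto
    then have "x_field $$ (-1 - j) = of_nat (d - i) * xv (d - i)"
      by (simp only: x_field_nth) simp
    then show "f_coeff t n (nat (j + int d)) * of_nat (d - nat (j + int d)) * xv (d - nat (j + int d)) =
        (E_low ^ n) $$ j * x_field $$ (-1 - j)"
      unfolding i_def[symmetric] f i(2)[symmetric] by (simp only: mult.assoc)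
  qed auto
  also have "\<dots> = (\<Sum>i\<le>n * t. f_coeff t n i * of_nat (d - i) * xv (d - i))"
  proof (rule sum.mono_neutral_right)
    show "\<forall>i\<in>{..<d} - {..n * t}. f_coeff t n i * of_nat (d - i) * xv (d - i) = 0"
    proof
      fix i assume i: "i \<in> {..<d} - {..n * t}"
      have "int d = int (n * t) + int n" by (simp add: d_def)
      moreover have "int i > int (n * t)" using i by (simp del: of_nat_mult)
      ultimately have "- int d + int i > - int n" by linarith
      then show "f_coeff t n i * of_nat (d - i) * xv (d - i) = 0"
        by (simp only: f E_low_power(1) mult_zero_left)
    qed
  qed (use n in \<open>auto simp: d_def\<close>)
  finally show ?thesis by (simp only: p_elem_def d_def mult.commute[of x_field])
qed

lemma homogeneous_p_elem: "homogeneous (n * (t + 1)) (p_elem t n)"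
  unfolding p_elem_def
proof (rule homogeneous_sum)
  fix i assume i: "i \<in> {..n * t}"
  let ?d = "n * (t + 1)"
  have "nat (- int ?d + int i + int ?d) = i" by simp
  then have f: "homogeneous i (f_coeff t n i)"
    using E_low_power(3)[of n "- int ?d + int i"] by (simp only: f_coeff_E_low)
  show "homogeneous ?d (f_coeff t n i * of_nat (?d - i) * xv (?d - i))"
  proof (cases "i < ?d")
    case True
    then show ?thesis unfolding mult.assoc
      by (intro homogeneous_mult[OF f homogeneous_of_nat_mult[OF homogeneous_xv]]) auto
  qed auto
qed

definition "summand n = p_elem t n / of_nat n *
  (- mps_const a * S_minus (s - 1) / (1 - mps_const a * A_elem s t)) ^ n"

text \<open>Per factor, \<open>p_elem t n\<close> contributes weight t+1 and \<open>B\<close> weight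
  s-1. Together this is the exponent s+t in \<open>\<tau>\<close>.\<close>

lemma grading_summand:
  assumes n: "n > 0"
  shows "grading (summand n) = fps_const (mps_const ((-1) ^ n / of_nat n) * p_elem t n) * q ^ n"
proof -
  let ?u = "mps_const a * B * inverse (1 - mps_const a * A)"
  have "summand n = p_elem t n * mps_const (1 / of_nat n) * (- ?u) ^ n"
    unfolding summand_def divide_mps_def mps_inverse_of_nat[OF n] A_def[symmetric] B_def[symmetric]
    by simp
  also have "(- ?u) ^ n = mps_const ((-1) ^ n) * ?u ^ n"
    by (simp add: power_minus[of ?u] mps_const_power mps_const_minus)
  finally have "summand n = (mps_const (1 / of_nat n) * mps_const ((-1) ^ n)) * (p_elem t n * ?u ^ n)"
    by (simp only: mult_ac)
  also have "mps_const (1 / of_nat n) * mps_const ((-1) ^ n) = (mps_const ((-1) ^ n / of_nat n) :: fock_var mps)"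
    by (simp flip: mps_const_mult)
  finally have "grading (summand n) = fps_const (mps_const ((-1) ^ n / of_nat n)) *
      (grading (p_elem t n) * grading ?u ^ n)"
    by (simp add: grading_mult grading_const grading_power)
  also have "grading (p_elem t n) = fps_const (p_elem t n) * (fps_X ^ (t + 1)) ^ n"
    by (simp only: grading_homogeneous[OF homogeneous_p_elem] power_mult[symmetric] mult.commute[of n])
  also have "grading ?u = fps_const (mps_const a) * (fps_const B * fps_X ^ (s - 1)) * C"
    by (simp only: grading_mult grading_const grading_homogeneous[OF homogeneous_B] C_def)
  also have "fps_const (p_elem t n) * (fps_X ^ (t + 1)) ^ n *
      (fps_const (mps_const a) * (fps_const B * fps_X ^ (s - 1)) * C) ^ n = fps_const (p_elem t n) * q ^ n"
  proof -
    have "fps_X ^ (t + 1) * fps_X ^ (s - 1) = (fps_X ^ (s + t) :: fock_var mps fps)"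
      using s by (simp only: power_add[symmetric]) simp
    then have "fps_X ^ (t + 1) * (fps_const (mps_const a) * (fps_const B * fps_X ^ (s - 1)) * C) = q"
      unfolding q_def \<tau>_def by (metis (no_types, lifting) mult.assoc mult.left_commute)
    then show ?thesis by (simp only: mult.assoc power_mult_distrib[symmetric])
  qed
  finally show ?thesis by (simp only: fps_const_mult[symmetric] mult.assoc)
qed

text \<open>The logarithm is expanded: powers of \<open>q\<close> beyond \<open>w\<close> do not
  reach coefficient \<open>w\<close>, and the term \<open>n = 0\<close> is zero by division by
  zero.\<close>

lemma ell_nth:
  "ell $ w = - (\<Sum>n=1..w. (fps_const (mps_const ((-1) ^ n / of_nat n) * p_elem t n) * q ^ n) $ w)"
proof -
  have "y ^ n = emb (q ^ n) * fps_const (E_low ^ n)" for n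
    by (simp add: y_def power_mult_distrib emb_power fps_const_power)
  then have yn: "(y ^ n) $ w = fls_const ((q ^ n) $ w) * E_low ^ n" for n
    by (simp add: fps_mult_right_const_nth)
  have "ell $ w = (x_field * L $ w) $$ (-1)"
    by (simp add: ell_def)
  also have "L $ w = (\<Sum>n=0..w. fls_const (mps_const (- ((-1) ^ n / of_nat n)) * (q ^ n) $ w) * E_low ^ n)"
    by (simp add: L_def fps_compose_nth yn mult.assoc flip: fls_const_mult_const)
  also have "(x_field * \<dots>) $$ (-1) =
      (\<Sum>n=0..w. (mps_const (- ((-1) ^ n / of_nat n)) * (q ^ n) $ w) * (x_field * E_low ^ n) $$ (-1))"
    unfolding sum_distrib_left fls_nth_sum
    by (rule sum.cong) (simp_all only: mult.left_commute[of x_field] fls_mult_const_nth)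
  also have "\<dots> = (\<Sum>n=1..w. (mps_const (- ((-1) ^ n / of_nat n)) * (q ^ n) $ w) * (x_field * E_low ^ n) $$ (-1))"
    by (rule sum.mono_neutral_right) (auto simp: not_less_eq_eq)
  also have "\<dots> = (\<Sum>n=1..w. - (fps_const (mps_const ((-1) ^ n / of_nat n) * p_elem t n) * q ^ n) $ w)"
  proof (rule sum.cong)
    fix n assume "n \<in> {1..w}"
    then show "(mps_const (- ((-1) ^ n / of_nat n)) * (q ^ n) $ w) * (x_field * E_low ^ n) $$ (-1) =
        - (fps_const (mps_const ((-1) ^ n / of_nat n) * p_elem t n) * q ^ n) $ w"
      by (simp add: p_elem_eq mps_const_minus mult_ac)
  qed simp
  finally show ?thesis by (simp add: sum_negf)
qed

lemma grading_exponent: "grading (- (\<Sum>\<^sub>\<infinity>n\<in>{1..}. summand n)) = ell"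
proof (rule fps_ext, rule mps_eqI)
  fix w M
  \<comment> \<open>The power \<open>q ^ n\<close> starts at outer exponent \<open>n\<close> or
    later, so a monomial meets only finitely many summands.\<close>
  have zero: "mps_coeff (summand n) M = 0" if "n > weight M" for n M
  proof -
    have "grading (summand n) $ weight M = 0"
      using that power_nth_eq_0[OF q_nth_0, of "weight M" n] by (subst grading_summand) auto
    then show ?thesis using mps_coeff_grading[of "summand n" "weight M" M] by simp
  qed
  have sum: "mps_coeff (\<Sum>\<^sub>\<infinity>n\<in>{1..}. summand n) M = (\<Sum>n=1..weight M. mps_coeff (summand n) M)" for M
    by (rule mps_infsum_coeff) (auto intro: zero)
  have "mps_coeff (grading (- (\<Sum>\<^sub>\<infinity>n\<in>{1..}. summand n)) $ w) M =
      - (\<Sum>n=1..w. mps_coeff (grading (summand n) $ w) M)"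
    by (simp add: mps_coeff_grading sum del: One_nat_def)
  also have "\<dots> = mps_coeff (ell $ w) M"
    by (simp add: ell_nth grading_summand del: fps_mult_left_const_nth)
  finally show "mps_coeff (grading (- (\<Sum>\<^sub>\<infinity>n\<in>{1..}. summand n)) $ w) M = mps_coeff (ell $ w) M" .
qed

definition "tau_function = 1 / (1 - mps_const a * A_elem s t) *
  mps_exp (- (\<Sum>\<^sub>\<infinity>n\<in>{1..}. p_elem t n / of_nat n *
    (- mps_const a * S_minus (s - 1) / (1 - mps_const a * A_elem s t)) ^ n))"

lemma grading_tau_function: "grading tau_function = F"
proof -
  let ?l = "- (\<Sum>\<^sub>\<infinity>n\<in>{1..}. summand n)"
  \<comment> \<open>The constant term is read off in weight 0, where \<open>ell\<close> vanishes;
    \<open>grading_exp\<close> requires this.\<close>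
  have "mps_coeff ?l {#} = mps_coeff (grading ?l $ 0) {#}"
    by (subst mps_coeff_grading) simp
  then have l: "mps_coeff ?l {#} = 0" by (simp only: grading_exponent ell_nth_0 zero_mps.rep_eq)
  have "tau_function = inverse (1 - mps_const a * A) * mps_exp ?l"
    by (simp add: tau_function_def summand_def A_def divide_mps_def)
  then have "grading tau_function = C * grading (mps_exp ?l)"
    by (simp only: grading_mult C_def)
  then show ?thesis by (simp only: grading_exp[OF l] grading_exponent F_def)
qed

lemma homogeneous_F: "homogeneous n (F $ n)"
  using homogeneous_grading[of n tau_function] by (simp only: grading_tau_function)

section \<open>Comparison with the operator exponential\<close>

lemma F_nth_0: "F $ 0 = 1"
proof -
  have "\<tau> $ 0 = 0" using s by (simp add: \<tau>_def fps_X_power_iff)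
  then have "(1 + \<tau> * fps_const A * C) $ 0 = 1" by (simp add: fps_mult_nth_0)
  then have "C $ 0 = 1" by (simp only: C_eq'[symmetric])
  then show ?thesis by (simp add: F_def)
qed

lemma F_recurrence:
  "of_nat m * F $ m = (if m < s + t then 0 else of_nat (s + t) * (mps_const a * Z $ (m - (s + t))))"
proof -
  have "of_nat m * F $ m = (of_nat (s + t) * \<tau> * Z) $ m"
    using fps_theta_F by (metis fps_theta_nth)
  also have "of_nat (s + t) * \<tau> * Z = fps_const (of_nat (s + t) * mps_const a) * (fps_X ^ (s + t) * Z)"
    by (simp only: \<tau>_def fps_const_mult[symmetric] fps_of_nat mult_ac)
  also have "\<dots> $ m = (if m < s + t then 0 else of_nat (s + t) * (mps_const a * Z $ (m - (s + t))))"
    by (simp only: fps_mult_left_const_nth fps_X_power_mult_nth mult.assoc) simp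
  finally show ?thesis .
qed

lemma phi_phi_star_F:
  "phi (- int s) (phi_star (- int t) (single_charge 0 (mps_const c * F $ n))) =
    single_charge 0 (mps_const c * Z $ n)"
  by (simp only: phi_star_F[OF homogeneous_F] phi_FCY)

lemma F_nth_eq_0: "\<not> s + t dvd m \<Longrightarrow> F $ m = 0"
proof (induction m rule: less_induct)
  case (less m)
  have "m > 0" using less.prems by (cases "m = 0") auto
  have "of_nat m * F $ m = 0"
  proof (cases "m < s + t")
    case False
    have "\<not> s + t dvd m - (s + t)" using False less.prems by (simp add: dvd_minus_self)
    then have "F $ (m - (s + t)) = 0" using less.IH[of "m - (s + t)"] False s by simp
    \<comment> \<open>Vanishing passes from \<open>F\<close> to \<open>Z\<close> through the fields:
      on a zero component the scalars 1 and 0 give the same argument, hence the same image.\<close>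
    then have "single_charge 0 (Z $ (m - (s + t))) = single_charge 0 (mps_const 0 * Z $ (m - (s + t)))"
      using phi_phi_star_F[of 1 "m - (s + t)"] phi_phi_star_F[of 0 "m - (s + t)"] by simp
    then have "Z $ (m - (s + t)) = 0"
      by (auto simp: single_charge_def dest: fun_cong[of _ _ 0])
    then show ?thesis by (simp add: F_recurrence)
  qed (simp add: F_recurrence)
  with \<open>m > 0\<close> show ?case by (rule mps_of_nat_mult_eq_0D)
qed

lemma F_step: "mps_const a * Z $ (k * (s + t)) = of_nat (Suc k) * F $ (Suc k * (s + t))"
proof -
  have "of_nat (s + t) * (mps_const a * Z $ (k * (s + t))) = of_nat (Suc k * (s + t)) * F $ (Suc k * (s + t))"
    by (subst F_recurrence) simp
  also have "\<dots> = of_nat (s + t) * (of_nat (Suc k) * F $ (Suc k * (s + t)))"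
    by (simp only: of_nat_mult mult_ac)
  finally show ?thesis using mps_of_nat_mult_cancel[of "s + t"] s by auto
qed

text \<open>By \<open>F_step\<close> each application of the operator produces the factor
  \<open>Suc n\<close>, so that the factorial builds up and cancels.\<close>

lemma exp_series_eq:
  "exp_series (\<lambda>v. a \<bullet>\<^sub>C phi (- int s) (phi_star (- int t) v)) (charge0 1) n =
    single_charge 0 (F $ (n * (s + t)))"
proof -
  let ?T = "\<lambda>v. a \<bullet>\<^sub>C phi (- int s) (phi_star (- int t) v)"
  have "(?T ^^ n) (charge0 1) = single_charge 0 (mps_const (fact n) * F $ (n * (s + t)))"
  proof (induction n)
    case 0
    then show ?case by (simp add: charge0_single_charge F_nth_0)
  next
    case (Suc n)
    have "(?T ^^ Suc n) (charge0 1) = ?T (single_charge 0 (mps_const (fact n) * F $ (n * (s + t))))"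
      by (simp only: funpow.simps comp_apply Suc)
    also have "\<dots> = single_charge 0 (mps_const a * (mps_const (fact n) * Z $ (n * (s + t))))"
      by (simp only: phi_phi_star_F scale_def fmult_single_charge)
    also have "mps_const a * (mps_const (fact n) * Z $ (n * (s + t))) =
        mps_const (fact n) * (mps_const a * Z $ (n * (s + t)))"
      by (rule mult.left_commute)
    also have "\<dots> = mps_const (fact n) * of_nat (Suc n) * F $ (Suc n * (s + t))"
      by (subst F_step) (rule mult.assoc[symmetric])
    also have "mps_const (fact n) * of_nat (Suc n) = (mps_const (fact (Suc n)) :: fock_var mps)"
      by (simp only: fact_Suc mps_const_mult mps_const_of_nat mult.commute of_nat_mult of_nat_id)
    finally show ?case .
  qed
  then show ?thesis
    by (simp add: exp_series_def scale_def fmult_single_charge mult.assoc[symmetric] flip: mps_const_mult)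
qed

lemma sums_tau_function:
  "(\<lambda>n. single_charge 0 (F $ (n * (s + t)))) sums charge0 tau_function"
  unfolding sums_def
proof (rule tendsto_funI)
  fix c
  show "(\<lambda>N. (\<Sum>n<N. single_charge 0 (F $ (n * (s + t)))) c) \<longlonglongrightarrow> charge0 tau_function c"
  proof (cases "c = 0")
    case True
    have "(\<lambda>n. F $ (n * (s + t))) sums tau_function"
    proof (rule mps_sumsI)
      fix M
      have M: "mps_coeff tau_function M = mps_coeff (F $ weight M) M"
        by (simp add: mps_coeff_grading flip: grading_tau_function)
      show "\<forall>\<^sub>F N in sequentially. (\<Sum>n<N. mps_coeff (F $ (n * (s + t))) M) = mps_coeff tau_function M"
        using eventually_gt_at_top[of "weight M"]
      proof eventually_elim
        case (elim N)
        show ?case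
        proof (cases "s + t dvd weight M")
          case True
          then obtain k where k: "weight M = k * (s + t)" by (metis dvd_def mult.commute)
          \<comment> \<open>Hence \<open>N > weight M\<close> terms include the only one that
            contributes to this monomial.\<close>
          then have "k \<le> weight M" using s by simp
          have "(\<Sum>n<N. mps_coeff (F $ (n * (s + t))) M) = (\<Sum>n<N. if n = k then mps_coeff (F $ weight M) M else 0)"
          proof (rule sum.cong)
            fix n
            show "mps_coeff (F $ (n * (s + t))) M = (if n = k then mps_coeff (F $ weight M) M else 0)"
              using k s homogeneousD[OF homogeneous_F, of M "n * (s + t)"] by auto
          qed simp
          also have "\<dots> = mps_coeff (F $ weight M) M" using \<open>k \<le> weight M\<close> elim by simp
          finally show ?thesis using M by simp
        next
          case False
          have "mps_coeff (F $ (n * (s + t))) M = 0" for n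
            by (rule homogeneousD[OF homogeneous_F]) (use False in auto)
          then show ?thesis using M F_nth_eq_0[OF False] by simp
        qed
      qed
    qed
    then show ?thesis
      using True by (simp add: sums_def sum_fun_apply single_charge_def charge0_def)
  qed (simp add: sum_fun_apply single_charge_def charge0_def)
qed

end

theorem corollary3p1:
  fixes s t :: nat and a :: complex
  assumes "s \<ge> 1"
  shows "exp_series (\<lambda>v. a \<bullet>\<^sub>C phi (- int s) (phi_star (- int t) v)) (charge0 1) sums
    charge0 (1 / (1 - mps_const a * A_elem s t) *
      mps_exp (- (\<Sum>\<^sub>\<infinity>n\<in>{1..}. p_elem t n / of_nat n *
        (- mps_const a * S_minus (s - 1) / (1 - mps_const a * A_elem s t)) ^ n)))"
proof -
  interpret fock_exponential s t a
    by unfold_locales (rule assms)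
  show ?thesis
    using sums_tau_function by (simp only: exp_series_eq[abs_def] tau_function_def)
qed

end
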